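(* Let $\Omega=(0,1)\times(0,1)$, let $\mathcal T_h$ be the nonsymmetric triangulation of $\Omega$ described in the context (with $h=4/(3N)$, $N$ a positive integer divisible by $4$), let $\mathcal P_h=\{z=(x_{2j},y_m)\in\mathcal P\}$ be the set of mesh vertices with even first index lying in the square $\mathcal P$, and let $v_h=\sum_{z\in\mathcal P_h}\Phi_z$, where $\Phi_z\in S_h$ is the nodal basis function of $S_h$ at $z$. Then for every $t>0$ there is a constant $c(t)>0$, independent of $h$, such that, for all $h$ sufficiently small, $$\|\tilde E_h(t)\tilde\Delta_hQ_hv_h\|\ge c(t)\,h\,\|v_h\|.$$
   Context: Triangulation: let $N$ be a positive integer divisible by $4$, $h=4/(3N)$, $M=\tfrac34N$, $x_0=0$, and for $j=1,\dots,N$ let $x_j=x_{j-1}+\tfrac12h$ if $j$ is odd and $x_j=x_{j-1}+h$ if $j$ is even; let $y_m=mh$ for $m=0,\dots,M$ (so $x_N=y_M=1$). Each rectangle $(x_j,x_{j+1})\times(y_m,y_{m+1})$ is split into two triangles by the diagonal connecting its upper left corner $(x_j,y_{m+1})$ with its lower right corner $(x_{j+1},y_m)$. This gives $\mathcal T_h$. The square $\mathcal P$: let $\phi_1(x,y)=2\sin(\pi x)\sin(\pi y)$ (the first Dirichlet eigenfunction of $-\Delta$ on $\Omega$). Since $\nabla\phi_1(1/4,1/4)\cdot(3,-1)=2\pi$, one can fix $0<d<1/4$ such that $\nabla\phi_1(z)\cdot(3,-1)\ge1$ for all $z\in\mathcal P:=[1/4-d,1/4+d]^2$. $(\cdot,\cdot)$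 and $\|\cdot\|$ are the inner product and norm of $L_2(\Omega)$. $S_h$ is the space of continuous functions on $\overline\Omega$ that are linear on each $\tau\in\mathcal T_h$ and vanish on $\partial\Omega$. The nodal basis function $\Phi_z\in S_h$ equals $1$ at the vertex $z$ and $0$ at all other vertices. Control volumes: for each triangle $\tau$, connect its barycenter by line segments to the midpoints of its edges, which partitions $\tau$ into three quadrilaterals $\tau_z$, one for each vertex $z$ of $\tau$. For a vertex $z$ of $\mathcal T_h$, the control volume $V_z$ is the union of the $\tau_z$ over all triangles $\tau$ having $z$ as a vertex. Let $Z_h^0$ be the set of interior vertices and $J_h\chi=\sum_{z\in Z_h^0}\chi(z)\Psi_z$, where $\Psi_z$ is the characteristic function of $V_z$. Then $\langle\chi,\psi\rangle=(\chi,J_h\psi)$ is an inner product on $S_h$. The operator $\tilde\Delta_h:S_h\to S_h$ is defined by $-\langle\tilde\Delta_h\psi,\chi\rangle=(\nabla\psi,\nabla\chi)$ for all $\psi,\chi\in S_h$, and $\tilde E_h(t)=e^{\tilde\Delta_ht}$. The operator $Q_h:S_h\to S_h$ is defined by $(\nabla Q_h\psi,\nabla\chi)=(\psi,J_h\chi)-(\psi,\chi)$ for all $\psi,\chi\in S_h$. *)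

theory Defs
  imports "HOL-Analysis.Analysis"
begin

section \<open>The nonsymmetric triangulation of the unit square\<close>

definition Omega :: "(real \<times> real) set" where
  "Omega = {0<..<1} \<times> {0<..<1}"

definition mesh_h :: "nat \<Rightarrow> real" where
  "mesh_h N = 4 / (3 * real N)"

definition mesh_M :: "nat \<Rightarrow> nat" where
  "mesh_M N = 3 * N div 4"

primrec mesh_x :: "nat \<Rightarrow> nat \<Rightarrow> real" where
  "mesh_x N 0 = 0"
| "mesh_x N (Suc j) = mesh_x N j + (if odd (Suc j) then mesh_h N / 2 else mesh_h N)"

definition mesh_y :: "nat \<Rightarrow> nat \<Rightarrow> real" where
  "mesh_y N m = real m * mesh_h N"

text \<open>A triangle is represented by the set of its three vertices; the closed triangle itself is
  the convex hull of that set. The diagonal of each rectangle joins its upper left to its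
  lower right corner.\<close>

definition lower_tri :: "nat \<Rightarrow> nat \<Rightarrow> nat \<Rightarrow> (real \<times> real) set" where
  "lower_tri N j m =
     {(mesh_x N j, mesh_y N m), (mesh_x N (Suc j), mesh_y N m), (mesh_x N j, mesh_y N (Suc m))}"

definition upper_tri :: "nat \<Rightarrow> nat \<Rightarrow> nat \<Rightarrow> (real \<times> real) set" where
  "upper_tri N j m =
     {(mesh_x N (Suc j), mesh_y N (Suc m)), (mesh_x N (Suc j), mesh_y N m),
      (mesh_x N j, mesh_y N (Suc m))}"

definition triangulation :: "nat \<Rightarrow> (real \<times> real) set set" where
  "triangulation N =
     {T. \<exists>j<N. \<exists>m<mesh_M N. T = lower_tri N j m \<or> T = upper_tri N j m}"

definition vertices :: "nat \<Rightarrow> (real \<times> real) set" where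
  "vertices N = \<Union> (triangulation N)"

definition interior_vertices :: "nat \<Rightarrow> (real \<times> real) set" where
  "interior_vertices N = vertices N \<inter> Omega"


section \<open>Inner products, gradients and the finite element space\<close>

definition L2_inner :: "(real \<times> real \<Rightarrow> real) \<Rightarrow> (real \<times> real \<Rightarrow> real) \<Rightarrow> real" where
  "L2_inner f g = (LINT z:Omega|lebesgue. f z * g z)"

definition L2_norm_Omega :: "(real \<times> real \<Rightarrow> real) \<Rightarrow> real" where
  "L2_norm_Omega f = sqrt (L2_inner f f)"

text \<open>The pointwise gradient. For a continuous piecewise linear function it exists off the mesh
  edges, a null set, where it agrees with the weak gradient.\<close>

definition grad :: "(real \<times> real \<Rightarrow> real) \<Rightarrow> real \<times> real \<Rightarrow> real \<times> real" where
  "grad f z = (THE D. GDERIV f z :> D)"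

definition grad_inner :: "(real \<times> real \<Rightarrow> real) \<Rightarrow> (real \<times> real \<Rightarrow> real) \<Rightarrow> real" where
  "grad_inner f g = (LINT z:Omega|lebesgue. inner (grad f z) (grad g z))"

text \<open>Functions on the closed unit square that vanish on its boundary are represented by their
  extensions by zero, so that equality in the space is equality of functions; ``linear'' on
  a triangle means affine.\<close>

definition S_h :: "nat \<Rightarrow> (real \<times> real \<Rightarrow> real) set" where
  "S_h N = {f. continuous_on (closure Omega) f \<and>
     (\<forall>T\<in>triangulation N. \<exists>a b c. \<forall>(x, y)\<in>convex hull T. f (x, y) = a + b * x + c * y) \<and>
     (\<forall>z. z \<notin> Omega \<longrightarrow> f z = 0)}"

definition nodal_basis :: "nat \<Rightarrow> real \<times> real \<Rightarrow> (real \<times> real \<Rightarrow> real)" where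
  "nodal_basis N z =
     (THE f. f \<in> S_h N \<and> f z = 1 \<and> (\<forall>w\<in>vertices N - {z}. f w = 0))"


section \<open>Control volumes and the lumped inner product\<close>

definition barycenter :: "(real \<times> real) set \<Rightarrow> real \<times> real" where
  "barycenter T = (1 / 3) *\<^sub>R (\<Sum>v\<in>T. v)"

text \<open>For the triangle with vertices z, a, b, this is the closed quadrilateral with corners z, the
  midpoints of the edges za and zb, and the barycenter (note that midpoint z z = z).\<close>

definition tri_part :: "(real \<times> real) set \<Rightarrow> real \<times> real \<Rightarrow> (real \<times> real) set" where
  "tri_part T z = convex hull (insert (barycenter T) (midpoint z ` T))"

definition control_volume :: "nat \<Rightarrow> real \<times> real \<Rightarrow> (real \<times> real) set" where
  "control_volume N z = (\<Union>T\<in>{T \<in> triangulation N. z \<in> T}. tri_part T z)"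

definition J_h :: "nat \<Rightarrow> (real \<times> real \<Rightarrow> real) \<Rightarrow> (real \<times> real \<Rightarrow> real)" where
  "J_h N \<eta> = (\<lambda>p. \<Sum>z\<in>interior_vertices N. \<eta> z * indicator (control_volume N z) p)"

definition lumped_inner ::
    "nat \<Rightarrow> (real \<times> real \<Rightarrow> real) \<Rightarrow> (real \<times> real \<Rightarrow> real) \<Rightarrow> real" where
  "lumped_inner N \<eta> \<psi> = L2_inner \<eta> (J_h N \<psi>)"


section \<open>The discrete operators\<close>

definition Laplace_h :: "nat \<Rightarrow> (real \<times> real \<Rightarrow> real) \<Rightarrow> (real \<times> real \<Rightarrow> real)" where
  "Laplace_h N \<psi> =
     (THE w. w \<in> S_h N \<and> (\<forall>\<eta>\<in>S_h N. - lumped_inner N w \<eta> = grad_inner \<psi> \<eta>))"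

text \<open>The operator exponential, as a power series. The space is finite-dimensional,
  so pointwise convergence of the series coincides with convergence in norm.\<close>

definition E_h :: "nat \<Rightarrow> real \<Rightarrow> (real \<times> real \<Rightarrow> real) \<Rightarrow> (real \<times> real \<Rightarrow> real)" where
  "E_h N t \<psi> = (\<lambda>p. \<Sum>n. t ^ n / fact n * (Laplace_h N ^^ n) \<psi> p)"

definition Q_h :: "nat \<Rightarrow> (real \<times> real \<Rightarrow> real) \<Rightarrow> (real \<times> real \<Rightarrow> real)" where
  "Q_h N \<psi> =
     (THE w. w \<in> S_h N \<and>
       (\<forall>\<eta>\<in>S_h N. grad_inner w \<eta> = L2_inner \<psi> (J_h N \<eta>) - L2_inner \<psi> \<eta>))"


section \<open>The initial data\<close>

definition phi1 :: "real \<times> real \<Rightarrow> real" where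
  "phi1 = (\<lambda>(x, y). 2 * sin (pi * x) * sin (pi * y))"

definition square_P :: "real \<Rightarrow> (real \<times> real) set" where
  "square_P d = {1/4 - d..1/4 + d} \<times> {1/4 - d..1/4 + d}"

definition P_h :: "nat \<Rightarrow> real \<Rightarrow> (real \<times> real) set" where
  "P_h N d =
     {(mesh_x N (2 * j), mesh_y N m) | j m. 2 * j \<le> N \<and> m \<le> mesh_M N} \<inter> square_P d"

definition v_h :: "nat \<Rightarrow> real \<Rightarrow> (real \<times> real \<Rightarrow> real)" where
  "v_h N d = (\<lambda>p. \<Sum>z\<in>P_h N d. nodal_basis N z p)"

end

theory Submission
  imports Defs
begin

text \<open>
  Let \<open>a\<close> be the Dirichlet form \<open>(\<nabla>f, \<nabla>g)\<close>, let \<open>\<langle>f, g\<rangle>\<close> be the lumped inner product and let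
  \<open>\<epsilon>(f, g) = \<langle>f, g\<rangle> - (f, g)\<close> be the error of lumping, so that \<open>a(Q f, g) = \<epsilon>(f, g)\<close> for the operator
  \<open>Q\<close> of the statement. The norm of \<open>w(t) = E(t) \<Delta> Q v\<close> is bounded below by pairing \<open>w(t)\<close> with one
  function: the nodal interpolant \<open>g\<close> of the first eigenfunction \<open>\<phi>\<close>. At time zero the pairing is
  \<open>\<langle>\<Delta> Q v, g\<rangle> = - a(Q v, g) = - \<epsilon>(v, g)\<close>.

  This number is as large as \<open>h\<close>. On a triangle \<open>T\<close> the lumping error is \<open>|T| / 54\<close> times the sum,
  over the three edges, of the products of the differences of nodal values (\<open>quad_error_cells\<close>). Summed
  over the six triangles around a vertex \<open>z\<close>, the first-order terms would cancel on a mesh that is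
  symmetric about \<open>z\<close>. At an even vertex the column on the left has width \<open>h\<close> and the one on the right
  has width \<open>h / 2\<close>, and what remains is \<open>\<epsilon>(\<Phi>\<^sub>z, g) = h\<^sup>3 / 108 \<nabla>\<phi>(z) \<cdot> (3, -1) + O(h\<^sup>4)\<close>
  (\<open>quad_error_at_even_node\<close>). All these terms have the same sign on the square, which contains at
  least a constant times \<open>h\<^sup>-\<^sup>2\<close> such vertices.

  The heat flow preserves this size. If \<open>g\<close> were an eigenfunction of the discrete Laplacian, the
  pairing would decay exactly by \<open>exp (- \<lambda> t)\<close> with its eigenvalue \<open>\<lambda>\<close>. It is almost one: with
  \<open>\<lambda> = 2 \<pi>\<^sup>2\<close>, the residual \<open>r = - \<Delta> g - \<lambda> g\<close> has norm \<open>O(h)\<close> (\<open>residual_energy\<close>), because the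
  stencils of both forms are consistent to first order on the nonuniform mesh. Since \<open>w = \<Delta> u\<close> for the
  solution \<open>u\<close> of the semidiscrete heat equation that starts from \<open>Q v\<close>, decay of the Dirichlet energy
  bounds the time integral of \<open>\<parallel>w\<parallel>\<^sup>2\<close> by \<open>a(Q v, Q v) / 2\<close>, which is \<open>O(h\<^sup>2)\<close> (\<open>Q_h_energy\<close>). So the
  residual changes the pairing by \<open>O(h\<^sup>2)\<close> only (\<open>heat_pairing\<close>), which is negligible against \<open>h\<close>. This
  energy argument replaces any knowledge of the spectrum of the discrete Laplacian.

  All forms are computed cell by cell (\<open>integral_over_cells\<close>) from a few integrals over one reference
  triangle. There the three parts of the control volumes are the regions in which one of the
  barycentric coordinates is the largest.
\<close>

section \<open>Finite-dimensional function spaces with a nodal basis\<close>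

definition linear_on :: "('a \<Rightarrow> real) set \<Rightarrow> (('a \<Rightarrow> real) \<Rightarrow> real) \<Rightarrow> bool" where
  "linear_on V l \<longleftrightarrow> (\<forall>f\<in>V. \<forall>g\<in>V. \<forall>c. l (\<lambda>p. f p + c * g p) = l f + c * l g)"

definition symmetric_form_on ::
    "('a \<Rightarrow> real) set \<Rightarrow> (('a \<Rightarrow> real) \<Rightarrow> ('a \<Rightarrow> real) \<Rightarrow> real) \<Rightarrow> bool" where
  "symmetric_form_on V b \<longleftrightarrow> (\<forall>f\<in>V. \<forall>g\<in>V. b f g = b g f) \<and> (\<forall>g\<in>V. linear_on V (\<lambda>f. b f g))"

definition inner_product_on ::
    "('a \<Rightarrow> real) set \<Rightarrow> (('a \<Rightarrow> real) \<Rightarrow> ('a \<Rightarrow> real) \<Rightarrow> real) \<Rightarrow> bool" where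
  "inner_product_on V b \<longleftrightarrow>
     symmetric_form_on V b \<and> (\<forall>f\<in>V. 0 \<le> b f f \<and> (b f f = 0 \<longrightarrow> f = (\<lambda>p. 0)))"

lemma linear_onD:
  "linear_on V l \<Longrightarrow> f \<in> V \<Longrightarrow> g \<in> V \<Longrightarrow> l (\<lambda>p. f p + c * g p) = l f + c * l g"
  by (simp add: linear_on_def)

text \<open>The dimension of the finite element space depends on the mesh. So the space is a set of functions
  with an expansion in a finite nodal basis, and not a type.\<close>

locale nodal_space =
  fixes V :: "('a \<Rightarrow> real) set" and Z :: "'a set" and \<Phi> :: "'a \<Rightarrow> 'a \<Rightarrow> real"
  assumes finite_nodes: "finite Z"
    and zero_mem: "(\<lambda>p. 0) \<in> V"
    and comb_mem: "f \<in> V \<Longrightarrow> g \<in> V \<Longrightarrow> (\<lambda>p. f p + c * g p) \<in> V"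
    and basis_mem: "z \<in> Z \<Longrightarrow> \<Phi> z \<in> V"
    and nodal_expansion: "f \<in> V \<Longrightarrow> f p = (\<Sum>z\<in>Z. f z * \<Phi> z p)"
begin

lemma sum_mem:
  assumes "finite S" "S \<subseteq> Z"
  shows "(\<lambda>p. \<Sum>z\<in>S. c z * \<Phi> z p) \<in> V"
  using assms
proof (induction S rule: finite_induct)
  case (insert x S)
  have "(\<lambda>p. (\<Sum>z\<in>S. c z * \<Phi> z p) + c x * \<Phi> x p) \<in> V"
    using insert by (intro comb_mem basis_mem) auto
  then show ?case using insert by (simp add: add.commute)
qed (simp add: zero_mem)

lemma linear_on_zero:
  assumes "linear_on V l" shows "l (\<lambda>p. 0) = 0"
  using linear_onD[OF assms zero_mem zero_mem, of 1] by simp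

lemma linear_on_sum:
  assumes l: "linear_on V l" and "finite S" "S \<subseteq> Z"
  shows "l (\<lambda>p. \<Sum>z\<in>S. c z * \<Phi> z p) = (\<Sum>z\<in>S. c z * l (\<Phi> z))"
  using assms(2,3)
proof (induction S rule: finite_induct)
  case (insert x S)
  have "l (\<lambda>p. (\<Sum>z\<in>S. c z * \<Phi> z p) + c x * \<Phi> x p) = l (\<lambda>p. \<Sum>z\<in>S. c z * \<Phi> z p) + c x * l (\<Phi> x)"
    using insert by (intro linear_onD[OF l] sum_mem basis_mem) auto
  then show ?case using insert by (simp add: add.commute)
qed (simp add: linear_on_zero[OF l])

lemma linear_on_nodal:
  assumes l: "linear_on V l" and f: "f \<in> V"
  shows "l f = (\<Sum>z\<in>Z. f z * l (\<Phi> z))"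
proof -
  have "f = (\<lambda>p. \<Sum>z\<in>Z. f z * \<Phi> z p)" using nodal_expansion[OF f] by blast
  then have "l f = l (\<lambda>p. \<Sum>z\<in>Z. f z * \<Phi> z p)" by simp
  also have "\<dots> = (\<Sum>z\<in>Z. f z * l (\<Phi> z))" using linear_on_sum[OF l finite_nodes] by blast
  finally show ?thesis .
qed

lemma form_linear1: "symmetric_form_on V b \<Longrightarrow> g \<in> V \<Longrightarrow> linear_on V (\<lambda>f. b f g)"
  by (simp add: symmetric_form_on_def)

lemma form_sym: "symmetric_form_on V b \<Longrightarrow> f \<in> V \<Longrightarrow> g \<in> V \<Longrightarrow> b f g = b g f"
  by (simp add: symmetric_form_on_def)

lemma form_linear2: "symmetric_form_on V b \<Longrightarrow> f \<in> V \<Longrightarrow> linear_on V (b f)"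
  unfolding linear_on_def
proof (intro ballI allI)
  fix g k c assume *: "symmetric_form_on V b" "f \<in> V" "g \<in> V" "k \<in> V"
  show "b f (\<lambda>p. g p + c * k p) = b f g + c * b f k"
    using linear_onD[OF form_linear1[OF *(1,2)] *(3,4), of c] form_sym[OF *(1,2)] comb_mem[OF *(3,4)] *
    by simp
qed

definition span_of :: "'a set \<Rightarrow> ('a \<Rightarrow> real) set" where
  "span_of S = {\<lambda>p. \<Sum>z\<in>S. c z * \<Phi> z p | c. True}"

lemma span_of_mem: "S \<subseteq> Z \<Longrightarrow> f \<in> span_of S \<Longrightarrow> f \<in> V"
  unfolding span_of_def using sum_mem finite_subset[OF _ finite_nodes] by blast

lemma span_ofI: "(\<lambda>p. \<Sum>z\<in>S. c z * \<Phi> z p) \<in> span_of S"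
  unfolding span_of_def by blast

lemma span_of_comb:
  assumes "f \<in> span_of S" "g \<in> span_of S" shows "(\<lambda>p. f p + c * g p) \<in> span_of S"
proof -
  obtain a b where "f = (\<lambda>p. \<Sum>z\<in>S. a z * \<Phi> z p)" "g = (\<lambda>p. \<Sum>z\<in>S. b z * \<Phi> z p)"
    using assms unfolding span_of_def by blast
  moreover have "(\<Sum>z\<in>S. a z * \<Phi> z p) + c * (\<Sum>z\<in>S. b z * \<Phi> z p)
      = (\<Sum>z\<in>S. (a z + c * b z) * \<Phi> z p)" for p
    by (simp only: sum_distrib_left distrib_right sum.distrib mult.assoc)
  ultimately have "(\<lambda>p. f p + c * g p) = (\<lambda>p. \<Sum>z\<in>S. (a z + c * b z) * \<Phi> z p)"
    by simp
  then show ?thesis using span_ofI[of "\<lambda>z. a z + c * b z" S] by simp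
qed

lemma span_of_insert:
  assumes "finite S" "x \<notin> S"
  shows "f \<in> span_of (insert x S) \<longleftrightarrow> (\<exists>g\<in>span_of S. \<exists>c. f = (\<lambda>p. g p + c * \<Phi> x p))"
proof
  assume "f \<in> span_of (insert x S)"
  then obtain a where "f = (\<lambda>p. \<Sum>z\<in>insert x S. a z * \<Phi> z p)" unfolding span_of_def by blast
  then have "f = (\<lambda>p. (\<Sum>z\<in>S. a z * \<Phi> z p) + a x * \<Phi> x p)" using assms by (simp add: add.commute)
  then show "\<exists>g\<in>span_of S. \<exists>c. f = (\<lambda>p. g p + c * \<Phi> x p)"
    by (intro bexI[OF _ span_ofI[of a S]] exI[of _ "a x"])
next
  assume "\<exists>g\<in>span_of S. \<exists>c. f = (\<lambda>p. g p + c * \<Phi> x p)"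
  then obtain a c where "f = (\<lambda>p. (\<Sum>z\<in>S. a z * \<Phi> z p) + c * \<Phi> x p)" unfolding span_of_def by blast
  moreover have "(\<Sum>z\<in>S. (a(x := c)) z * \<Phi> z p) = (\<Sum>z\<in>S. a z * \<Phi> z p)" for p
    using assms by (intro sum.cong) auto
  ultimately have "f = (\<lambda>p. \<Sum>z\<in>insert x S. (a(x := c)) z * \<Phi> z p)"
    using assms by (simp add: add.commute)
  then show "f \<in> span_of (insert x S)" using span_ofI[of "a(x := c)" "insert x S"] by simp
qed

text \<open>Riesz representation by Gram--Schmidt: passing from a span to the one with
  \<^term>\<open>\<Phi> x\<close> added, the representer is corrected by a multiple of the component of
  \<^term>\<open>\<Phi> x\<close> orthogonal to the old span. That component is found by applying the
  induction hypothesis to the functional \<^term>\<open>b (\<Phi> x)\<close>.\<close>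

lemma riesz_span:
  assumes b: "inner_product_on V b" and "finite S" "S \<subseteq> Z" "linear_on V l"
  shows "\<exists>w\<in>span_of S. \<forall>k\<in>span_of S. b w k = l k"
  using assms(2,3,4)
proof (induction S arbitrary: l rule: finite_induct)
  case empty
  have bs: "symmetric_form_on V b" using b by (simp add: inner_product_on_def)
  have "b (\<lambda>p. 0) (\<lambda>p. 0) = l (\<lambda>p. 0)"
    using linear_on_zero[OF empty(2)] linear_on_zero[OF form_linear2[OF bs zero_mem]] by simp
  then show ?case by (auto simp: span_of_def)
next
  case (insert x S)
  have bs: "symmetric_form_on V b" using b by (simp add: inner_product_on_def)
  note l = \<open>linear_on V l\<close>
  have SZ: "S \<subseteq> Z" and x: "x \<in> Z" using insert by auto
  have xV: "\<Phi> x \<in> V" using x basis_mem by blast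
  obtain w where w: "w \<in> span_of S" "\<And>k. k \<in> span_of S \<Longrightarrow> b w k = l k"
    using insert.IH[OF SZ l] by blast
  obtain u where u: "u \<in> span_of S" "\<And>k. k \<in> span_of S \<Longrightarrow> b u k = b (\<Phi> x) k"
    using insert.IH[OF SZ form_linear2[OF bs xV]] by blast
  note V = span_of_mem[OF SZ]
  define n where "n = (\<lambda>p. \<Phi> x p + (-1) * u p)"
  define s where "s = l n / b n n"
  define w' where "w' = (\<lambda>p. w p + s * n p)"
  have nV: "n \<in> V" unfolding n_def using comb_mem[OF xV V[OF u(1)]] .
  have n0: "b n k = 0" if "k \<in> span_of S" for k
    using linear_onD[OF form_linear1[OF bs V[OF that]] xV V[OF u(1)], of "-1"] u(2)[OF that]
    by (simp add: n_def)
  have sn: "s * b n n = l n"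
  proof (cases "b n n = 0")
    case True
    then have "n = (\<lambda>p. 0)" using b nV by (simp add: inner_product_on_def)
    then show ?thesis using True linear_on_zero[OF l] by simp
  qed (simp add: s_def)
  have w'V: "w' \<in> V" unfolding w'_def using comb_mem V[OF w(1)] nV by blast
  have w'k: "b w' k = l k" if "k \<in> span_of S" for k
    using linear_onD[OF form_linear1[OF bs V[OF that]] V[OF w(1)] nV, of s] n0[OF that] w(2)[OF that]
    by (simp add: w'_def)
  have w'n: "b w' n = l n"
    using linear_onD[OF form_linear1[OF bs nV] V[OF w(1)] nV, of s] sn n0[OF w(1)]
      form_sym[OF bs nV V[OF w(1)]] by (simp add: w'_def)
  have xn: "\<Phi> x = (\<lambda>p. n p + 1 * u p)" by (simp add: n_def)
  have w'x: "b w' (\<Phi> x) = l (\<Phi> x)"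
    using linear_onD[OF form_linear2[OF bs w'V] nV V[OF u(1)], of 1]
      linear_onD[OF l nV V[OF u(1)], of 1] w'n w'k[OF u(1)] xn by simp
  have "w' = (\<lambda>p. (w p + (- s) * u p) + s * \<Phi> x p)" by (auto simp: w'_def n_def algebra_simps)
  then have "w' \<in> span_of (insert x S)"
    unfolding span_of_insert[OF insert.hyps] using span_of_comb[OF w(1) u(1), of "- s"]
    by (intro bexI[of _ "\<lambda>p. w p + (- s) * u p"] exI[of _ s])
  moreover have "b w' k = l k" if kS: "k \<in> span_of (insert x S)" for k
  proof -
    obtain g c where k: "g \<in> span_of S" "k = (\<lambda>p. g p + c * \<Phi> x p)"
      using kS unfolding span_of_insert[OF insert.hyps] by (elim bexE exE)
    show ?thesis
      using linear_onD[OF form_linear2[OF bs w'V] V[OF k(1)] xV, of c]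
        linear_onD[OF l V[OF k(1)] xV, of c] w'k[OF k(1)] w'x k(2) by simp
  qed
  ultimately show ?case by blast
qed

lemma riesz_unique:
  assumes b: "inner_product_on V b" and l: "linear_on V l"
  shows "\<exists>!w. w \<in> V \<and> (\<forall>k\<in>V. b w k = l k)"
proof -
  have V: "f \<in> V \<longleftrightarrow> f \<in> span_of Z" for f
  proof
    assume "f \<in> V"
    then have "f = (\<lambda>p. \<Sum>z\<in>Z. f z * \<Phi> z p)" using nodal_expansion by blast
    then show "f \<in> span_of Z" unfolding span_of_def by blast
  qed (use span_of_mem in blast)
  have bs: "symmetric_form_on V b" using b by (simp add: inner_product_on_def)
  obtain w where w: "w \<in> V" "\<forall>k\<in>V. b w k = l k"
    using riesz_span[OF b finite_nodes subset_refl l] V by blast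
  have "w' = w" if w': "w' \<in> V" "\<forall>k\<in>V. b w' k = l k" for w'
  proof -
    define n where "n = (\<lambda>p. w' p + (-1) * w p)"
    have n: "n \<in> V" unfolding n_def using comb_mem w' w by blast
    have "b n n = b w' n - b w n"
      using linear_onD[OF form_linear1[OF bs n] w'(1) w(1), of "-1"] by (simp add: n_def)
    then have "b n n = 0" using w w' n by simp
    then have "n = (\<lambda>p. 0)" using b n by (simp add: inner_product_on_def)
    then show ?thesis by (auto simp: n_def fun_eq_iff)
  qed
  then show ?thesis using w by blast
qed

end

section \<open>The exponential of an operator and an energy argument\<close>

locale nodal_operator = nodal_space V Z \<Phi>
  for V :: "('a \<Rightarrow> real) set" and Z \<Phi> +
  fixes D :: "('a \<Rightarrow> real) \<Rightarrow> 'a \<Rightarrow> real"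
  assumes D_mem: "f \<in> V \<Longrightarrow> D f \<in> V"
    and D_comb: "f \<in> V \<Longrightarrow> g \<in> V \<Longrightarrow> D (\<lambda>p. f p + c * g p) = (\<lambda>p. D f p + c * D g p)"
begin

lemma D_linear_on: "linear_on V (\<lambda>f. D f p)"
  by (simp add: linear_on_def D_comb)

lemma D_pow_mem: "f \<in> V \<Longrightarrow> (D ^^ n) f \<in> V"
  by (induction n) (auto intro: D_mem)

definition expD :: "real \<Rightarrow> ('a \<Rightarrow> real) \<Rightarrow> 'a \<Rightarrow> real" where
  "expD t f = (\<lambda>p. \<Sum>n. t ^ n / fact n * (D ^^ n) f p)"

text \<open>In the sum norm of the nodal values, an operator is bounded by the sum of the norms of its values
  on the basis. Hence its powers grow at most geometrically and the exponential series converges.\<close>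

lemma D_pow_bound: "\<exists>K. \<forall>f\<in>V. \<forall>n. (\<Sum>z\<in>Z. \<bar>(D ^^ n) f z\<bar>) \<le> K ^ n * (\<Sum>z\<in>Z. \<bar>f z\<bar>)"
proof -
  define K where "K = (\<Sum>w\<in>Z. \<Sum>z\<in>Z. \<bar>D (\<Phi> w) z\<bar>)"
  have K0: "0 \<le> K" unfolding K_def by (intro sum_nonneg) auto
  have step: "(\<Sum>z\<in>Z. \<bar>D f z\<bar>) \<le> K * (\<Sum>z\<in>Z. \<bar>f z\<bar>)" if f: "f \<in> V" for f
  proof -
    have "(\<Sum>z\<in>Z. \<bar>D f z\<bar>) = (\<Sum>z\<in>Z. \<bar>\<Sum>w\<in>Z. f w * D (\<Phi> w) z\<bar>)"
      using linear_on_nodal[OF D_linear_on f] by simp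
    also have "\<dots> \<le> (\<Sum>z\<in>Z. \<Sum>w\<in>Z. \<bar>f w\<bar> * \<bar>D (\<Phi> w) z\<bar>)"
      by (intro sum_mono order_trans[OF sum_abs]) (simp add: abs_mult)
    also have "\<dots> = (\<Sum>w\<in>Z. \<bar>f w\<bar> * (\<Sum>z\<in>Z. \<bar>D (\<Phi> w) z\<bar>))"
      by (subst sum.swap) (simp add: sum_distrib_left)
    also have "\<dots> \<le> (\<Sum>w\<in>Z. \<bar>f w\<bar> * K)"
    proof (intro sum_mono mult_left_mono)
      fix w assume "w \<in> Z"
      then show "(\<Sum>z\<in>Z. \<bar>D (\<Phi> w) z\<bar>) \<le> K" unfolding K_def
        by (intro member_le_sum[where f="\<lambda>w. \<Sum>z\<in>Z. \<bar>D (\<Phi> w) z\<bar>"] finite_nodes) (auto intro: sum_nonneg)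
    qed auto
    also have "\<dots> = K * (\<Sum>z\<in>Z. \<bar>f z\<bar>)" by (simp add: sum_distrib_left mult.commute)
    finally show ?thesis .
  qed
  have "(\<Sum>z\<in>Z. \<bar>(D ^^ n) f z\<bar>) \<le> K ^ n * (\<Sum>z\<in>Z. \<bar>f z\<bar>)" if f: "f \<in> V" for f n
  proof (induction n)
    case (Suc n)
    have "(\<Sum>z\<in>Z. \<bar>(D ^^ Suc n) f z\<bar>) \<le> K * (\<Sum>z\<in>Z. \<bar>(D ^^ n) f z\<bar>)"
      using step[OF D_pow_mem[OF f], of n] by simp
    also have "\<dots> \<le> K * (K ^ n * (\<Sum>z\<in>Z. \<bar>f z\<bar>))" using Suc K0 by (rule mult_left_mono)
    finally show ?case by (simp add: mult.assoc)
  qed auto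
  then show ?thesis by blast
qed

lemma expD_summable_at_node:
  assumes f: "f \<in> V" and z: "z \<in> Z"
  shows "summable (\<lambda>n. (D ^^ n) f z / fact n * t ^ n)"
proof -
  obtain K where K: "(\<Sum>z\<in>Z. \<bar>(D ^^ n) f z\<bar>) \<le> K ^ n * (\<Sum>z\<in>Z. \<bar>f z\<bar>)" for n
    using D_pow_bound f by blast
  define C where "C = (\<Sum>z\<in>Z. \<bar>f z\<bar>)"
  have b: "norm ((D ^^ n) f z / fact n * t ^ n) \<le> C * ((K * \<bar>t\<bar>) ^ n /\<^sub>R fact n)" for n
  proof -
    have "\<bar>(D ^^ n) f z\<bar> \<le> (\<Sum>z\<in>Z. \<bar>(D ^^ n) f z\<bar>)"
      by (intro member_le_sum[OF z, where f="\<lambda>z. \<bar>(D ^^ n) f z\<bar>"]) (auto simp: finite_nodes)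
    also note K[of n]
    finally have "\<bar>(D ^^ n) f z\<bar> * (\<bar>t\<bar> ^ n / fact n) \<le> K ^ n * C * (\<bar>t\<bar> ^ n / fact n)"
      unfolding C_def by (rule mult_right_mono) auto
    moreover have "norm ((D ^^ n) f z / fact n * t ^ n) = \<bar>(D ^^ n) f z\<bar> * (\<bar>t\<bar> ^ n / fact n)"
      by (simp add: abs_mult power_abs)
    moreover have "C * ((K * \<bar>t\<bar>) ^ n /\<^sub>R fact n) = K ^ n * C * (\<bar>t\<bar> ^ n / fact n)"
      by (simp add: power_mult_distrib divide_inverse mult_ac)
    ultimately show ?thesis by simp
  qed
  show ?thesis
    by (rule summable_comparison_test'[OF summable_mult[OF summable_exp_generic[of "K * \<bar>t\<bar>"], of C], of 0])
      (use b in auto)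
qed

lemma expD_summable:
  assumes f: "f \<in> V"
  shows "summable (\<lambda>n. (D ^^ n) f p / fact n * t ^ n)"
proof -
  have eq: "(\<lambda>n. (D ^^ n) f p / fact n * t ^ n) = (\<lambda>n. \<Sum>z\<in>Z. ((D ^^ n) f z / fact n * t ^ n) * \<Phi> z p)"
  proof
    fix n
    show "(D ^^ n) f p / fact n * t ^ n = (\<Sum>z\<in>Z. ((D ^^ n) f z / fact n * t ^ n) * \<Phi> z p)"
      by (subst nodal_expansion[OF D_pow_mem[OF f]])
        (simp add: sum_distrib_left sum_distrib_right sum_divide_distrib mult_ac)
  qed
  show ?thesis unfolding eq by (intro summable_sum summable_mult2 expD_summable_at_node[OF f])
qed

lemma expD_expand:
  assumes f: "f \<in> V"
  shows "expD t f p = (\<Sum>z\<in>Z. expD t f z * \<Phi> z p)"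
proof -
  have s: "summable (\<lambda>n. t ^ n / fact n * (D ^^ n) f z)" for z
    using expD_summable[OF f, of z t] by (simp add: mult_ac)
  have "expD t f p = (\<Sum>n. \<Sum>z\<in>Z. (t ^ n / fact n * (D ^^ n) f z) * \<Phi> z p)"
    unfolding expD_def
    by (subst nodal_expansion[OF D_pow_mem[OF f]])
      (simp add: sum_distrib_left sum_distrib_right sum_divide_distrib mult_ac)
  also have "\<dots> = (\<Sum>z\<in>Z. \<Sum>n. (t ^ n / fact n * (D ^^ n) f z) * \<Phi> z p)"
    by (rule suminf_sum) (intro summable_mult2 s)
  also have "\<dots> = (\<Sum>z\<in>Z. expD t f z * \<Phi> z p)"
    unfolding expD_def by (intro sum.cong refl suminf_mult2[symmetric] s)
  finally show ?thesis .
qed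

lemma expD_mem: assumes "f \<in> V" shows "expD t f \<in> V"
proof -
  have "expD t f = (\<lambda>p. \<Sum>z\<in>Z. expD t f z * \<Phi> z p)" using expD_expand[OF assms] by blast
  then show ?thesis using sum_mem[OF finite_nodes subset_refl] by metis
qed

lemma expD_0: "expD 0 f = f"
proof
  fix p
  have "expD 0 f p = (\<Sum>n. ((D ^^ n) f p / fact n) * 0 ^ n)"
    unfolding expD_def by (simp add: mult_ac)
  then show "expD 0 f p = f p" by (subst (asm) powser_zero) simp
qed

lemma D_expD:
  assumes f: "f \<in> V"
  shows "D (expD t f) = expD t (D f)"
proof
  fix p
  have s: "summable (\<lambda>n. t ^ n / fact n * (D ^^ n) f z)" for z
    using expD_summable[OF f, of z t] by (simp add: mult_ac)
  have "D (expD t f) p = (\<Sum>z\<in>Z. expD t f z * D (\<Phi> z) p)"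
    by (rule linear_on_nodal[OF D_linear_on expD_mem[OF f]])
  also have "\<dots> = (\<Sum>z\<in>Z. \<Sum>n. (t ^ n / fact n * (D ^^ n) f z) * D (\<Phi> z) p)"
    unfolding expD_def by (intro sum.cong refl suminf_mult2 s)
  also have "\<dots> = (\<Sum>n. \<Sum>z\<in>Z. (t ^ n / fact n * (D ^^ n) f z) * D (\<Phi> z) p)"
    by (rule suminf_sum[symmetric]) (intro summable_mult2 s)
  also have "\<dots> = (\<Sum>n. t ^ n / fact n * D ((D ^^ n) f) p)"
    by (subst linear_on_nodal[OF D_linear_on D_pow_mem[OF f]])
      (simp add: sum_distrib_left sum_distrib_right sum_divide_distrib mult_ac)
  also have "\<dots> = expD t (D f) p"
    unfolding expD_def by (simp add: funpow_swap1)
  finally show "D (expD t f) p = expD t (D f) p" .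
qed

lemma expD_deriv:
  assumes f: "f \<in> V"
  shows "((\<lambda>t. expD t f p) has_real_derivative expD t (D f) p) (at t)"
proof -
  define c where "c n = (D ^^ n) f p / fact n" for n
  have "((\<lambda>t. \<Sum>n. c n * t ^ n) has_real_derivative (\<Sum>n. diffs c n * t ^ n)) (at t)"
    by (rule termdiffs_strong_converges_everywhere) (unfold c_def, rule expD_summable[OF f])
  moreover have "diffs c n = (D ^^ n) (D f) p / fact n" for n
    by (simp add: diffs_def c_def funpow_swap1 field_simps del: of_nat_Suc)
  ultimately show ?thesis unfolding expD_def c_def by (simp add: mult_ac)
qed

lemma form_deriv:
  assumes b: "symmetric_form_on V b" and f: "f \<in> V" and g: "g \<in> V"
  shows "((\<lambda>t. b (expD t f) g) has_real_derivative b (expD t (D f)) g) (at t)"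
proof -
  have "((\<lambda>t. \<Sum>z\<in>Z. expD t f z * b (\<Phi> z) g) has_real_derivative
      (\<Sum>z\<in>Z. expD t (D f) z * b (\<Phi> z) g)) (at t)"
    by (intro DERIV_sum DERIV_cmult_right expD_deriv[OF f])
  then show ?thesis
    using linear_on_nodal[OF form_linear1[OF b g] expD_mem] f D_mem[OF f] by simp
qed

lemma form_deriv_quadratic:
  assumes b: "symmetric_form_on V b" and f: "f \<in> V"
  shows "((\<lambda>t. b (expD t f) (expD t f)) has_real_derivative 2 * b (expD t (D f)) (expD t f)) (at t)"
proof -
  note m = expD_mem[OF f] expD_mem[OF D_mem[OF f]]
  have e: "b (expD t f) (expD s f) = (\<Sum>z\<in>Z. expD t f z * b (\<Phi> z) (expD s f))" for t s
    by (rule linear_on_nodal[OF form_linear1[OF b m(1)] m(1)])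
  have d: "((\<lambda>t. b (\<Phi> z) (expD t f)) has_real_derivative b (\<Phi> z) (expD t (D f))) (at t)"
    if "z \<in> Z" for z
    using form_deriv[OF b f basis_mem[OF that], of t] form_sym[OF b _ basis_mem[OF that]] m by simp
  have "((\<lambda>t. \<Sum>z\<in>Z. expD t f z * b (\<Phi> z) (expD t f)) has_real_derivative
      (\<Sum>z\<in>Z. expD t (D f) z * b (\<Phi> z) (expD t f) + b (\<Phi> z) (expD t (D f)) * expD t f z)) (at t)"
    by (intro DERIV_sum DERIV_mult expD_deriv[OF f] d)
  moreover have "(\<Sum>z\<in>Z. expD t (D f) z * b (\<Phi> z) (expD t f) + b (\<Phi> z) (expD t (D f)) * expD t f z)
      = b (expD t (D f)) (expD t f) + b (expD t f) (expD t (D f))"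
    using linear_on_nodal[OF form_linear1[OF b m(1)] m(2)] linear_on_nodal[OF form_linear1[OF b m(2)] m(1)]
    by (simp add: sum.distrib mult.commute)
  ultimately show ?thesis using e form_sym[OF b m(1) m(2)] by simp
qed

text \<open>Let \<open>w(s)\<close> solve the heat equation with initial value \<open>D q\<close>. The derivative of
  \<open>exp (\<mu> s) m(w(s), g)\<close> is \<open>- exp (\<mu> s) m(w(s), r)\<close>, so only the residual of \<open>g\<close> as an eigenvector
  matters. It is split by Young's inequality into \<open>m(w, w) / 2 + m(r, r) / 2\<close>, and \<open>m(w, w)\<close> is absorbed
  by the decay of the energy \<open>F(s) = a(u(s), u(s))\<close> with \<open>u(s) = exp(s D) q\<close>, as \<open>F' = - 2 m(w, w)\<close>. The
  combination of both quantities is nonincreasing.\<close>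

lemma heat_pairing:
  assumes m: "inner_product_on V m" and a: "inner_product_on V a"
    and D: "\<And>f g. f \<in> V \<Longrightarrow> g \<in> V \<Longrightarrow> - m (D f) g = a f g"
    and q: "q \<in> V" and g: "g \<in> V" and t: "0 \<le> t" and \<mu>: "0 \<le> \<mu>"
    and r: "r = (\<lambda>p. - D g p - \<mu> * g p)"
  shows "exp (\<mu> * t) * m (expD t (D q)) g
    \<le> m (D q) g + exp (\<mu> * t) * (a q q / 4 + t / 2 * m r r)"
proof -
  have ms: "symmetric_form_on V m" and as: "symmetric_form_on V a"
    using m a by (auto simp: inner_product_on_def)
  note qD = D_mem[OF q]
  define w where "w s = expD s (D q)" for s
  define G where "G s = exp (\<mu> * s) * m (w s) g" for s
  define F where "F s = a (expD s q) (expD s q)" for s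
  define R where "R = m r r"
  have wV: "w s \<in> V" for s unfolding w_def by (rule expD_mem[OF qD])
  have rV: "r \<in> V"
  proof -
    have "(\<lambda>p. ((\<lambda>p. 0) p + (- 1) * D g p)) \<in> V" by (rule comb_mem[OF zero_mem D_mem[OF g]])
    from comb_mem[OF this g, of "-\<mu>"] show ?thesis by (simp add: r)
  qed
  have dF: "(F has_real_derivative - 2 * m (w s) (w s)) (at s)" for s
  proof -
    have "a (expD s (D q)) (expD s q) = - m (w s) (w s)"
      using D[OF expD_mem[OF q] expD_mem[OF qD], of s s]
        form_sym[OF as expD_mem[OF q] expD_mem[OF qD], of s s] D_expD[OF q, of s]
      unfolding w_def by simp
    then show ?thesis using form_deriv_quadratic[OF as q, of s] unfolding F_def by simp
  qed
  have Dm: "m (expD s (D (D q))) g = - (\<mu> * m (w s) g + m (w s) r)" for s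
  proof -
    have "m (expD s (D (D q))) g = - a (w s) g" using D[OF wV g, of s] D_expD[OF qD, of s] by (simp add: w_def)
    also have "\<dots> = - a g (w s)" using form_sym[OF as wV g] by simp
    also have "\<dots> = m (D g) (w s)" using D[OF g wV, of s] by simp
    also have "\<dots> = m (w s) (D g)" using form_sym[OF ms wV D_mem[OF g]] by simp
    also have "\<dots> = - m (w s) r - \<mu> * m (w s) g"
    proof -
      have "m (w s) (\<lambda>p. (\<lambda>p. 0 + (-1) * r p) p + (-\<mu>) * g p) = m (w s) (\<lambda>p. 0 + (-1) * r p) + (-\<mu>) * m (w s) g"
        by (rule linear_onD[OF form_linear2[OF ms wV] comb_mem[OF zero_mem rV] g])
      moreover have "m (w s) (\<lambda>p. (\<lambda>p. 0) p + (-1) * r p) = m (w s) (\<lambda>p. 0) + (-1) * m (w s) r"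
        by (rule linear_onD[OF form_linear2[OF ms wV] zero_mem rV])
      moreover have "m (w s) (\<lambda>p. 0) = 0" by (rule linear_on_zero[OF form_linear2[OF ms wV]])
      ultimately show ?thesis by (simp add: r)
    qed
    finally show ?thesis by simp
  qed
  have dG: "(G has_real_derivative - exp (\<mu> * s) * m (w s) r) (at s)" for s
  proof -
    have "((\<lambda>s. exp (\<mu> * s) * m (w s) g) has_real_derivative
        (\<mu> * exp (\<mu> * s)) * m (w s) g + m (expD s (D (D q))) g * exp (\<mu> * s)) (at s)"
      unfolding w_def
      by (rule DERIV_mult[OF _ form_deriv[OF ms qD g]]) (auto intro!: derivative_eq_intros)
    then show ?thesis unfolding G_def Dm by (simp add: algebra_simps)
  qed
  have young: "- m (w s) r \<le> m (w s) (w s) / 2 + R / 2" for s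
  proof -
    define e where "e = (\<lambda>p. w s p + 1 * r p)"
    have eV: "e \<in> V" unfolding e_def by (rule comb_mem[OF wV rV])
    have "m e e = m (w s) e + m r e"
      using linear_onD[OF form_linear1[OF ms eV] wV rV, of s 1] by (simp add: e_def)
    also have "m (w s) e = m (w s) (w s) + m (w s) r"
      using linear_onD[OF form_linear2[OF ms wV] wV rV, of s s 1] by (simp add: e_def)
    also have "m r e = m r (w s) + m r r"
      using linear_onD[OF form_linear2[OF ms rV] wV rV, of s 1] by (simp add: e_def)
    finally have "m e e = m (w s) (w s) + 2 * m (w s) r + R"
      using form_sym[OF ms rV wV] by (simp add: R_def)
    moreover have "0 \<le> m e e" using m eV by (simp add: inner_product_on_def)
    ultimately show ?thesis by simp
  qed
  \<comment> \<open>The weight \<open>exp (\<mu> t)\<close> of the final time dominates \<open>exp (\<mu> s)\<close> on the whole interval.\<close>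
  define L where "L s = exp (\<mu> * t) * (F s / 4 - s / 2 * R) + G s" for s
  have mm: "0 \<le> m (w s) (w s)" "0 \<le> R" for s
    using m wV rV by (simp_all add: inner_product_on_def R_def)
  have dL: "(L has_real_derivative
      exp (\<mu> * t) * (- 2 * m (w s) (w s) / 4 - 1 / 2 * R) + - exp (\<mu> * s) * m (w s) r) (at s)" for s
    unfolding L_def by (intro DERIV_add dG DERIV_cmult DERIV_diff DERIV_cdivide dF)
      (auto intro!: derivative_eq_intros)
  have "L t \<le> L 0"
  proof (rule DERIV_nonpos_imp_nonincreasing[OF t])
    fix s assume s: "0 \<le> s" "s \<le> t"
    have "exp (\<mu> * s) * (- m (w s) r) \<le> exp (\<mu> * s) * (m (w s) (w s) / 2 + R / 2)"
      by (intro mult_left_mono young) auto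
    also have "\<dots> \<le> exp (\<mu> * t) * (m (w s) (w s) / 2 + R / 2)"
      using s \<mu> mm by (intro mult_right_mono) (auto intro: mult_left_mono)
    finally have "exp (\<mu> * t) * (- 2 * m (w s) (w s) / 4 - 1 / 2 * R) + - exp (\<mu> * s) * m (w s) r \<le> 0"
      by (simp add: algebra_simps)
    then show "\<exists>y. (L has_real_derivative y) (at s) \<and> y \<le> 0" using dL by blast
  qed
  moreover have "L 0 = exp (\<mu> * t) * (a q q / 4) + m (D q) g"
    by (simp add: L_def F_def G_def w_def expD_0)
  moreover have "0 \<le> exp (\<mu> * t) * (F t / 4)"
    unfolding F_def using a expD_mem[OF q] by (simp add: inner_product_on_def)
  ultimately show ?thesis
    unfolding L_def[of t] G_def w_def R_def right_diff_distrib distrib_left by (simp add: mult.commute mult.left_commute)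
qed

end

section \<open>Integration over the reference triangle\<close>

text \<open>The reference triangle has the vertices \<open>(0, 0)\<close>, \<open>(1, 0)\<close>, \<open>(0, 1)\<close>; these are the barycentric
  coordinates with respect to them.\<close>

definition bary :: "nat \<Rightarrow> real \<times> real \<Rightarrow> real" where
  "bary i p = (if i = 0 then 1 - fst p - snd p else if i = 1 then fst p else snd p)"

definition ref_tri :: "(real \<times> real) set" where
  "ref_tri = {p. \<forall>i<3. 0 \<le> bary i p}"

text \<open>Joining the barycenter to the midpoints of the edges cuts a triangle along its medians, on which
  two barycentric coordinates agree.\<close>

definition ref_part :: "nat \<Rightarrow> (real \<times> real) set" where
  "ref_part i = {p \<in> ref_tri. \<forall>j<3. bary j p \<le> bary i p}"

lemma all_lt_3: "(\<forall>i<3::nat. P i) \<longleftrightarrow> P 0 \<and> P 1 \<and> P 2"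
  by (auto simp: less_Suc_eq numeral_3_eq_3 numeral_2_eq_2)

lemma sum_lt_3: "(\<Sum>i<3::nat. f i) = f 0 + f 1 + (f 2 :: real)"
  by (simp add: numeral_3_eq_3 numeral_2_eq_2)

text \<open>The outer integral is asked for as a gauge integral, so that it can be put together from the two
  sides of a break point of \<^term>\<open>l\<close> or \<^term>\<open>u\<close>.\<close>

lemma vertical_region_integral:
  fixes f :: "real \<times> real \<Rightarrow> real"
  assumes S: "S = {p. a \<le> fst p \<and> fst p \<le> b \<and> l (fst p) \<le> snd p \<and> snd p \<le> u (fst p)}"
    and "compact S" and f: "continuous_on UNIV f"
    and F: "\<And>x y. ((\<lambda>y. F x y) has_real_derivative f (x, y)) (at y)"
    and lu: "\<And>x. a \<le> x \<Longrightarrow> x \<le> b \<Longrightarrow> l x \<le> u x"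
    and I: "((\<lambda>x. F x (u x) - F x (l x)) has_integral I) {a..b}"
  shows "integrable lborel (\<lambda>p. indicator S p * f p)" "(\<integral>p. indicator S p * f p \<partial>lborel) = I"
proof -
  have int: "integrable lborel (\<lambda>p. indicator S p * f p)"
    using borel_integrable_compact[OF \<open>compact S\<close> continuous_on_subset[OF f]] by simp
  then show "integrable lborel (\<lambda>p. indicator S p * f p)" .
  have inner: "(\<integral>y. indicator S (x, y) * f (x, y) \<partial>lborel)
      = (if x \<in> {a..b} then F x (u x) - F x (l x) else 0)" for x
  proof (cases "x \<in> {a..b}")
    case True
    have "(\<integral>y. indicator {l x..u x} y *\<^sub>R f (x, y) \<partial>lborel) = F x (u x) - F x (l x)"
    proof (rule integral_FTC_atLeastAtMost)
      show "l x \<le> u x" using lu True by auto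
      show "(F x has_vector_derivative f (x, y)) (at y within {l x..u x})" for y
        using F[of x y]
        by (simp add: has_real_derivative_iff_has_vector_derivative has_vector_derivative_at_within)
      show "continuous_on {l x..u x} (\<lambda>y. f (x, y))"
        by (intro continuous_on_compose2[OF f] continuous_intros) auto
    qed
    moreover have "(\<lambda>y. indicator S (x, y) * f (x, y)) = (\<lambda>y. indicator {l x..u x} y *\<^sub>R f (x, y))"
      using True by (auto simp: S indicator_def)
    ultimately show ?thesis using True by (simp only: if_True)
  qed (auto simp: S indicator_def intro!: Bochner_Integration.integral_eq_zero_AE)
  have int': "integrable (lborel \<Otimes>\<^sub>M lborel) (\<lambda>p. indicator S p * f p)"
    using int by (simp add: lborel_prod)
  note Q = lborel_pair.integrable_fst'[OF int'] lborel_pair.integral_fst'[OF int']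
  have "((\<lambda>x. if x \<in> {a..b} then F x (u x) - F x (l x) else 0)
      has_integral (\<integral>p. indicator S p * f p \<partial>lborel)) UNIV"
    using has_integral_integral_real[OF Q(1)] Q(2) by (simp add: inner lborel_prod)
  then have "((\<lambda>x. F x (u x) - F x (l x)) has_integral (\<integral>p. indicator S p * f p \<partial>lborel)) {a..b}"
    by (simp only: has_integral_restrict_UNIV)
  then show "(\<integral>p. indicator S p * f p \<partial>lborel) = I"
    using I has_integral_unique by blast
qed

lemma ref_tri_iff: "p \<in> ref_tri \<longleftrightarrow> 0 \<le> fst p \<and> 0 \<le> snd p \<and> fst p + snd p \<le> 1"
  by (auto simp: ref_tri_def all_lt_3 bary_def)

lemma ref_tri_bounded: "bounded ref_tri"
proof (rule bounded_subset[OF bounded_cbox])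
  show "ref_tri \<subseteq> cbox (0, 0) (1, 1)" by (auto simp: ref_tri_iff cbox_Pair_eq)
qed

lemma continuous_on_bary [continuous_intros]: "continuous_on S (bary i)"
  unfolding bary_def by (cases "i = 0"; cases "i = 1") (auto intro!: continuous_intros)

lemma ref_tri_compact: "compact ref_tri"
  unfolding compact_eq_bounded_closed
proof
  have eq: "ref_tri = {p. 0 \<le> bary 0 p} \<inter> {p. 0 \<le> bary 1 p} \<inter> {p. 0 \<le> bary 2 p}"
    by (auto simp: ref_tri_def all_lt_3)
  show "closed ref_tri" unfolding eq by (intro closed_Int closed_Collect_le continuous_intros)
qed (rule ref_tri_bounded)

lemma ref_part_compact: "compact (ref_part i)"
proof -
  have eq: "ref_part i = ref_tri \<inter> ({p. bary 0 p \<le> bary i p} \<inter> {p. bary 1 p \<le> bary i p} \<inter> {p. bary 2 p \<le> bary i p})"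
    by (auto simp: ref_part_def all_lt_3)
  show ?thesis
    unfolding eq by (intro compact_Int_closed ref_tri_compact closed_Int closed_Collect_le continuous_intros)
qed

lemma ref_tri_quadratic:
  fixes c0 c1 c2 c3 c4 c5 :: real
  defines "f \<equiv> \<lambda>p::real\<times>real. c0 + c1 * fst p + c2 * snd p + c3 * (fst p)\<^sup>2 + c4 * fst p * snd p + c5 * (snd p)\<^sup>2"
  shows "integrable lborel (\<lambda>p. indicator ref_tri p * f p)"
    and "(\<integral>p. indicator ref_tri p * f p \<partial>lborel) = c0 / 2 + c1 / 6 + c2 / 6 + c3 / 12 + c4 / 24 + c5 / 12"
proof -
  define F where "F x y = c0 * y + c1 * x * y + c2 * y\<^sup>2 / 2 + c3 * x\<^sup>2 * y + c4 * x * y\<^sup>2 / 2 + c5 * y ^ 3 / 3" for x y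
  define G where "G x = c0 * (x - x\<^sup>2 / 2) + c1 * (x\<^sup>2 / 2 - x ^ 3 / 3) - c2 * (1 - x) ^ 3 / 6
    + c3 * (x ^ 3 / 3 - x ^ 4 / 4) + c4 / 2 * (x\<^sup>2 / 2 - 2 * x ^ 3 / 3 + x ^ 4 / 4) - c5 * (1 - x) ^ 4 / 12" for x
  have S: "ref_tri = {p. 0 \<le> fst p \<and> fst p \<le> 1 \<and> (\<lambda>x. 0) (fst p) \<le> snd p \<and> snd p \<le> (\<lambda>x. 1 - x) (fst p)}"
    by (auto simp: ref_tri_iff)
  have dG: "(G has_real_derivative F x (1 - x) - F x 0) (at x)" for x
    unfolding G_def F_def by (auto intro!: derivative_eq_intros simp: power2_eq_square power3_eq_cube field_simps)
  have I: "((\<lambda>x. F x (1 - x) - F x 0) has_integral G 1 - G 0) {0..1}"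
    by (rule fundamental_theorem_of_calculus)
      (use dG in \<open>auto simp: has_real_derivative_iff_has_vector_derivative has_vector_derivative_at_within\<close>)
  have dF: "((\<lambda>y. F x y) has_real_derivative f (x, y)) (at y)" for x y
    unfolding F_def f_def by (auto intro!: derivative_eq_intros simp: power2_eq_square field_simps)
  have cf: "continuous_on UNIV f" unfolding f_def by (intro continuous_intros)
  note R = vertical_region_integral[OF S ref_tri_compact cf dF _ I]
  show "integrable lborel (\<lambda>p. indicator ref_tri p * f p)" by (rule R(1)) auto
  have "(\<integral>p. indicator ref_tri p * f p \<partial>lborel) = G 1 - G 0" by (rule R(2)) auto
  also have "\<dots> = c0 / 2 + c1 / 6 + c2 / 6 + c3 / 12 + c4 / 24 + c5 / 12"
    by (simp add: G_def field_simps)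
  finally show "(\<integral>p. indicator ref_tri p * f p \<partial>lborel) = c0 / 2 + c1 / 6 + c2 / 6 + c3 / 12 + c4 / 24 + c5 / 12" .
qed

lemma quadratic_has_integral:
  assumes "a \<le> b"
  shows "((\<lambda>x::real. p0 + p1 * x + p2 * x\<^sup>2) has_integral
    p0 * (b - a) + p1 * (b\<^sup>2 - a\<^sup>2) / 2 + p2 * (b ^ 3 - a ^ 3) / 3) {a..b}"
proof -
  define G where "G x = p0 * x + p1 * x\<^sup>2 / 2 + p2 * x ^ 3 / 3" for x
  have "(G has_real_derivative p0 + p1 * x + p2 * x\<^sup>2) (at x)" for x
    unfolding G_def by (auto intro!: derivative_eq_intros simp: power2_eq_square field_simps)
  then have "((\<lambda>x. p0 + p1 * x + p2 * x\<^sup>2) has_integral G b - G a) {a..b}"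
    by (intro fundamental_theorem_of_calculus assms)
      (auto simp: has_real_derivative_iff_has_vector_derivative has_vector_derivative_at_within)
  moreover have "G b - G a = p0 * (b - a) + p1 * (b\<^sup>2 - a\<^sup>2) / 2 + p2 * (b ^ 3 - a ^ 3) / 3"
    by (simp add: G_def diff_divide_distrib algebra_simps)
  ultimately show ?thesis by simp
qed

lemma ref_part_iff:
  "p \<in> ref_part 0 \<longleftrightarrow> 0 \<le> fst p \<and> 0 \<le> snd p \<and> 2 * fst p + snd p \<le> 1 \<and> fst p + 2 * snd p \<le> 1"
  "p \<in> ref_part 1 \<longleftrightarrow> 0 \<le> snd p \<and> fst p + snd p \<le> 1 \<and> 1 \<le> 2 * fst p + snd p \<and> snd p \<le> fst p"
  "p \<in> ref_part 2 \<longleftrightarrow> 0 \<le> fst p \<and> fst p + snd p \<le> 1 \<and> 1 \<le> fst p + 2 * snd p \<and> fst p \<le> snd p"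
  by (auto simp: ref_part_def ref_tri_iff all_lt_3 bary_def)

text \<open>Each part of the reference triangle is swept out by vertical segments whose end points are
  affine in the abscissa on either side of one break point.\<close>

lemma broken_region_affine:
  fixes c0 c1 c2 :: real and S :: "(real \<times> real) set"
  assumes S: "S = {p. a \<le> fst p \<and> fst p \<le> b \<and> l (fst p) \<le> snd p \<and> snd p \<le> u (fst p)}" and "compact S"
    and e: "a \<le> e" "e \<le> b"
    and l1: "\<And>x. a \<le> x \<Longrightarrow> x \<le> e \<Longrightarrow> l x = la + la' * x \<and> u x = ua + ua' * x \<and> l x \<le> u x"
    and l2: "\<And>x. e \<le> x \<Longrightarrow> x \<le> b \<Longrightarrow> l x = lb + lb' * x \<and> u x = ub + ub' * x \<and> l x \<le> u x"
  defines "q \<equiv> \<lambda>l0 l1 u0 u1 a b. (c0 * (u0 - l0) + c2 / 2 * (u0\<^sup>2 - l0\<^sup>2)) * (b - a)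
    + (c0 * (u1 - l1) + c1 * (u0 - l0) + c2 * (u0 * u1 - l0 * l1)) * (b\<^sup>2 - a\<^sup>2) / 2
    + (c1 * (u1 - l1) + c2 / 2 * (u1\<^sup>2 - l1\<^sup>2)) * (b ^ 3 - a ^ 3) / 3"
  shows "(\<integral>p. indicator S p * (c0 + c1 * fst p + c2 * snd p) \<partial>lborel)
    = q la la' ua ua' a e + q lb lb' ub ub' e b"
proof -
  define F where "F x y = c0 * y + c1 * x * y + c2 * y\<^sup>2 / 2" for x y :: real
  have piece: "((\<lambda>x. F x (u x) - F x (l x)) has_integral q l0 l1 u0 u1 v w) {v..w}"
    if "v \<le> w" and eq: "\<And>x. v \<le> x \<Longrightarrow> x \<le> w \<Longrightarrow> l x = l0 + l1 * x \<and> u x = u0 + u1 * x"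
    for v w l0 l1 u0 u1
  proof -
    have "F x (u x) - F x (l x) = (c0 * (u0 - l0) + c2 / 2 * (u0\<^sup>2 - l0\<^sup>2))
        + (c0 * (u1 - l1) + c1 * (u0 - l0) + c2 * (u0 * u1 - l0 * l1)) * x
        + (c1 * (u1 - l1) + c2 / 2 * (u1\<^sup>2 - l1\<^sup>2)) * x\<^sup>2" if "x \<in> {v..w}" for x
      using eq[of x] that unfolding F_def by (simp add: power2_eq_square field_simps)
    then show ?thesis unfolding q_def
      by (subst has_integral_cong) (auto intro!: quadratic_has_integral that(1))
  qed
  have I: "((\<lambda>x. F x (u x) - F x (l x)) has_integral q la la' ua ua' a e + q lb lb' ub ub' e b) {a..b}"
    by (rule has_integral_combine[OF e]; rule piece) (use e l1 l2 in auto)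
  show ?thesis
    by (rule vertical_region_integral(2)[OF S \<open>compact S\<close> _ _ _ I])
      (use l1 l2 in \<open>auto simp: F_def power2_eq_square field_simps intro!: continuous_intros derivative_eq_intros,
         metis linear\<close>)
qed

lemma ref_part_affine_integral:
  fixes c0 c1 c2 :: real
  defines "f \<equiv> \<lambda>p. c0 + c1 * fst p + c2 * snd p"
  shows "(\<integral>p. indicator (ref_part 0) p * f p \<partial>lborel) = c0 / 6 + 7 / 216 * c1 + 7 / 216 * c2"
    and "(\<integral>p. indicator (ref_part 1) p * f p \<partial>lborel) = c0 / 6 + 22 / 216 * c1 + 7 / 216 * c2"
    and "(\<integral>p. indicator (ref_part 2) p * f p \<partial>lborel) = c0 / 6 + 7 / 216 * c1 + 22 / 216 * c2"
proof -
  have S0: "ref_part 0 = {p. 0 \<le> fst p \<and> fst p \<le> 1/2 \<and> (\<lambda>x. 0) (fst p) \<le> snd p \<and>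
      snd p \<le> (\<lambda>x. min ((1 - x) / 2) (1 - 2 * x)) (fst p)}"
    by (auto simp: ref_part_iff simp del: One_nat_def)
  show "(\<integral>p. indicator (ref_part 0) p * f p \<partial>lborel) = c0 / 6 + 7 / 216 * c1 + 7 / 216 * c2"
    unfolding f_def
    by (subst broken_region_affine[OF S0 ref_part_compact, where e="1/3" and la=0 and la'=0 and lb=0 and lb'=0
        and ua="1/2" and ua'="-1/2" and ub=1 and ub'="-2"])
      (auto simp: field_simps power2_eq_square power3_eq_cube)
  have S1: "ref_part 1 = {p. 1/3 \<le> fst p \<and> fst p \<le> 1 \<and> (\<lambda>x. max 0 (1 - 2 * x)) (fst p) \<le> snd p \<and>
      snd p \<le> (\<lambda>x. min x (1 - x)) (fst p)}"
    by (auto simp: ref_part_iff simp del: One_nat_def)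
  show "(\<integral>p. indicator (ref_part 1) p * f p \<partial>lborel) = c0 / 6 + 22 / 216 * c1 + 7 / 216 * c2"
    unfolding f_def
    by (subst broken_region_affine[OF S1 ref_part_compact, where e="1/2" and la=1 and la'="-2" and lb=0 and lb'=0
        and ua=0 and ua'=1 and ub=1 and ub'="-1"])
      (auto simp: field_simps power2_eq_square power3_eq_cube)
  have S2: "ref_part 2 = {p. 0 \<le> fst p \<and> fst p \<le> 1/2 \<and> (\<lambda>x. max x ((1 - x) / 2)) (fst p) \<le> snd p \<and>
      snd p \<le> (\<lambda>x. 1 - x) (fst p)}"
    by (auto simp: ref_part_iff simp del: One_nat_def)
  show "(\<integral>p. indicator (ref_part 2) p * f p \<partial>lborel) = c0 / 6 + 7 / 216 * c1 + 22 / 216 * c2"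
    unfolding f_def
    by (subst broken_region_affine[OF S2 ref_part_compact, where e="1/3" and la="1/2" and la'="-1/2" and lb=0 and lb'=1
        and ua=1 and ua'="-1" and ub=1 and ub'="-1"])
      (auto simp: field_simps power2_eq_square power3_eq_cube)
qed

lemma less_3_cases: "(i::nat) < 3 \<Longrightarrow> i = 0 \<or> i = 1 \<or> i = 2"
  by auto

lemma bary_mult_integral:
  assumes "i < 3" "j < 3"
  shows "integrable lborel (\<lambda>p. indicator ref_tri p * (bary i p * bary j p))"
    and "(\<integral>p. indicator ref_tri p * (bary i p * bary j p) \<partial>lborel) = (if i = j then 1 / 12 else 1 / 24)"
proof -
  define d where "d k i = (if k = i then 1 else 0 :: real)" for k i :: nat
  have b: "bary i p = d 0 i + (d 1 i - d 0 i) * fst p + (d 2 i - d 0 i) * snd p" if "i < 3" for i p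
    using less_3_cases[OF that] by (auto simp: bary_def d_def)
  have e: "bary i p * bary j p = d 0 i * d 0 j + (d 0 i * (d 1 j - d 0 j) + d 0 j * (d 1 i - d 0 i)) * fst p
      + (d 0 i * (d 2 j - d 0 j) + d 0 j * (d 2 i - d 0 i)) * snd p
      + ((d 1 i - d 0 i) * (d 1 j - d 0 j)) * (fst p)\<^sup>2
      + ((d 1 i - d 0 i) * (d 2 j - d 0 j) + (d 1 j - d 0 j) * (d 2 i - d 0 i)) * fst p * snd p
      + ((d 2 i - d 0 i) * (d 2 j - d 0 j)) * (snd p)\<^sup>2" for p
    unfolding b[OF assms(1)] b[OF assms(2)] by (simp add: power2_eq_square algebra_simps)
  show "integrable lborel (\<lambda>p. indicator ref_tri p * (bary i p * bary j p))"
    unfolding e by (rule ref_tri_quadratic)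
  show "(\<integral>p. indicator ref_tri p * (bary i p * bary j p) \<partial>lborel) = (if i = j then 1 / 12 else 1 / 24)"
    unfolding e ref_tri_quadratic(2)
    using less_3_cases[OF assms(1)] less_3_cases[OF assms(2)] by (auto simp: d_def)
qed

text \<open>The value depends only on whether \<^term>\<open>i\<close> and \<^term>\<open>j\<close> agree. This is why the lumped product is
  symmetric although only its second argument is lumped.\<close>

lemma bary_part_integral:
  assumes "i < 3" "j < 3"
  shows "integrable lborel (\<lambda>p. indicator (ref_part i) p * bary j p)"
    and "(\<integral>p. indicator (ref_part i) p * bary j p \<partial>lborel) = (if i = j then 22 / 216 else 7 / 216)"
proof -
  show "integrable lborel (\<lambda>p. indicator (ref_part i) p * bary j p)"
    using borel_integrable_compact[OF ref_part_compact continuous_on_bary[of _ j]] by simp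
  define d where "d k i = (if k = i then 1 else 0 :: real)" for k i :: nat
  have b: "bary j p = d 0 j + (d 1 j - d 0 j) * fst p + (d 2 j - d 0 j) * snd p" for p
    using less_3_cases[OF assms(2)] by (auto simp: bary_def d_def)
  show "(\<integral>p. indicator (ref_part i) p * bary j p \<partial>lborel) = (if i = j then 22 / 216 else 7 / 216)"
    unfolding b using less_3_cases[OF assms(1)] less_3_cases[OF assms(2)]
    by (elim disjE) (simp_all only: ref_part_affine_integral, simp_all add: d_def)
qed

lemma lborel_affine_plane:
  fixes k :: "real \<times> real \<Rightarrow> real"
  assumes "\<alpha> \<noteq> 0" "\<beta> \<noteq> 0" and k: "integrable lborel k"
  shows "integrable lborel (\<lambda>p. k ((fst p - x0) / \<alpha>, (snd p - y0) / \<beta>))"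
    and "(\<integral>p. k ((fst p - x0) / \<alpha>, (snd p - y0) / \<beta>) \<partial>lborel) = \<bar>\<alpha> * \<beta>\<bar> * (\<integral>p. k p \<partial>lborel)"
proof -
  define c where "c j = (if j = (1, 0) then \<alpha> else \<beta>)" for j :: "real \<times> real"
  define T where "T = (\<lambda>p::real\<times>real. (x0 + \<alpha> * fst p, y0 + \<beta> * snd p))"
  define g where "g = (\<lambda>p::real\<times>real. k ((fst p - x0) / \<alpha>, (snd p - y0) / \<beta>))"
  have B: "(Basis :: (real \<times> real) set) = {(1, 0), (0, 1)}" by (auto simp: Basis_prod_def)
  have T: "(x0, y0) + (\<Sum>j\<in>Basis. (c j * (x \<bullet> j)) *\<^sub>R j) = T x" for x
    unfolding B by (cases x) (simp add: T_def c_def)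
  have [measurable]: "T \<in> borel \<rightarrow>\<^sub>M borel" unfolding T_def
    by (intro borel_measurable_continuous_onI continuous_intros)
  have [measurable]: "k \<in> borel_measurable borel" using k by simp
  have "(\<lambda>p::real\<times>real. ((fst p - x0) / \<alpha>, (snd p - y0) / \<beta>)) \<in> borel \<rightarrow>\<^sub>M borel"
    using assms by (intro borel_measurable_continuous_onI continuous_intros) auto
  then have gm[measurable]: "g \<in> borel_measurable borel"
    unfolding g_def using measurable_compose[OF _ \<open>k \<in> borel_measurable borel\<close>] by blast
  have "(lborel :: (real \<times> real) measure)
      = density (distr lborel borel (\<lambda>x. (x0, y0) + (\<Sum>j\<in>Basis. (c j * (x \<bullet> j)) *\<^sub>R j))) (\<lambda>_. \<Prod>j\<in>Basis. \<bar>c j\<bar>)"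
    by (rule lborel_affine_euclidean) (auto simp: c_def assms)
  then have L: "lborel = density (distr lborel borel T) (\<lambda>_. ennreal \<bar>\<alpha> * \<beta>\<bar>)"
    unfolding T unfolding B by (simp add: c_def abs_mult)
  have gT: "g (T x) = k x" for x using assms by (cases x) (simp add: g_def T_def)
  show "integrable lborel (\<lambda>p. k ((fst p - x0) / \<alpha>, (snd p - y0) / \<beta>))"
    unfolding g_def[symmetric]
    by (subst L) (auto simp: integrable_density integrable_distr_eq gT k)
  have "(\<integral>p. g p \<partial>lborel) = (\<integral>p. g p \<partial>(density (distr lborel borel T) (\<lambda>_. ennreal \<bar>\<alpha> * \<beta>\<bar>)))"
    by (subst L) simp
  also have "\<dots> = (\<integral>p. \<bar>\<alpha> * \<beta>\<bar> *\<^sub>R g (T p) \<partial>lborel)"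
    by (subst integral_density) (auto simp: integral_distr)
  also have "\<dots> = \<bar>\<alpha> * \<beta>\<bar> * (\<integral>p. k p \<partial>lborel)" unfolding gT by simp
  finally show "(\<integral>p. k ((fst p - x0) / \<alpha>, (snd p - y0) / \<beta>) \<partial>lborel) = \<bar>\<alpha> * \<beta>\<bar> * (\<integral>p. k p \<partial>lborel)"
    unfolding g_def .
qed

section \<open>The cells of the triangulation\<close>

text \<open>A point with barycentric coordinates \<open>u \<ge> v \<ge> w\<close> is the combination of the vertex, the midpoint
  and the barycenter with weights \<open>u - v\<close>, \<open>2 (v - w)\<close> and \<open>3 w\<close>.\<close>

lemma convex_hull_part:
  fixes a b c :: "'a :: real_vector"
  shows "convex hull {(1/3) *\<^sub>R (a + b + c), a, midpoint a b, midpoint a c}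
    = {u *\<^sub>R a + v *\<^sub>R b + w *\<^sub>R c | u v w. 0 \<le> v \<and> 0 \<le> w \<and> v \<le> u \<and> w \<le> u \<and> u + v + w = 1}"
    (is "?H = ?R")
proof
  have "convex ?R"
  proof (rule convexI)
    fix x y :: 'a and s t :: real
    assume "x \<in> ?R" "y \<in> ?R" and st: "0 \<le> s" "0 \<le> t" "s + t = 1"
    then obtain u v w u' v' w' where x: "x = u *\<^sub>R a + v *\<^sub>R b + w *\<^sub>R c" "0 \<le> v" "0 \<le> w" "v \<le> u" "w \<le> u" "u + v + w = 1"
      and y: "y = u' *\<^sub>R a + v' *\<^sub>R b + w' *\<^sub>R c" "0 \<le> v'" "0 \<le> w'" "v' \<le> u'" "w' \<le> u'" "u' + v' + w' = 1"
      by blast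
    have "s *\<^sub>R x + t *\<^sub>R y = (s * u + t * u') *\<^sub>R a + (s * v + t * v') *\<^sub>R b + (s * w + t * w') *\<^sub>R c"
      unfolding x(1) y(1) by (simp add: algebra_simps)
    moreover have "(s * u + t * u') + (s * v + t * v') + (s * w + t * w') = s * (u + v + w) + t * (u' + v' + w')"
      by (simp add: algebra_simps)
    ultimately show "s *\<^sub>R x + t *\<^sub>R y \<in> ?R"
      using x y st by (intro CollectI exI[of _ "s * u + t * u'"] exI[of _ "s * v + t * v'"] exI[of _ "s * w + t * w'"])
        (auto intro!: add_mono mult_left_mono)
  qed
  moreover have "\<exists>u v w. z = u *\<^sub>R a + v *\<^sub>R b + w *\<^sub>R c \<and> 0 \<le> v \<and> 0 \<le> w \<and> v \<le> u \<and> w \<le> u \<and> u + v + w = 1"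
    if z: "z \<in> {(1/3) *\<^sub>R (a + b + c), a, midpoint a b, midpoint a c}" for z
  proof -
    consider "z = (1/3) *\<^sub>R (a + b + c)" | "z = a" | "z = midpoint a b" | "z = midpoint a c" using z by blast
    then show ?thesis
    proof cases
      case 1 then show ?thesis by (intro exI[of _ "1/3"]) (simp add: scaleR_right_distrib)
    next
      case 2 then show ?thesis by (intro exI[of _ 1] exI[of _ 0]) simp
    next
      case 3 then show ?thesis
        by (intro exI[of _ "1/2"] exI[of _ "1/2"] exI[of _ 0]) (simp add: midpoint_def scaleR_right_distrib)
    next
      case 4 then show ?thesis
        by (intro exI[of _ "1/2"] exI[of _ 0] exI[of _ "1/2"]) (simp add: midpoint_def scaleR_right_distrib)
    qed
  qed
  ultimately show "?H \<subseteq> ?R" by (intro hull_minimal) blast+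
next
  have sub: "m \<in> ?H" if m: "m = p *\<^sub>R a + q *\<^sub>R (a + e) + r *\<^sub>R (a + b + c)"
    and e: "e = b \<or> e = c" and p: "0 \<le> p" "0 \<le> q" "0 \<le> r" "p + 2 * q + 3 * r = 1" for p q r m e
  proof -
    have "m \<in> convex hull {a, midpoint a e, (1/3) *\<^sub>R (a + b + c)}"
      unfolding convex_hull_3 using m p
      by (intro CollectI exI[of _ p] exI[of _ "2 * q"] exI[of _ "3 * r"]) (simp add: midpoint_def)
    moreover have "convex hull {a, midpoint a e, (1/3) *\<^sub>R (a + b + c)} \<subseteq> ?H"
      by (rule hull_mono) (use e in auto)
    ultimately show ?thesis by blast
  qed
  show "?R \<subseteq> ?H"
  proof
    fix z assume "z \<in> ?R"
    then obtain u v w where z: "z = u *\<^sub>R a + v *\<^sub>R b + w *\<^sub>R c" "0 \<le> v" "0 \<le> w" "v \<le> u" "w \<le> u" "u + v + w = 1"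
      by blast
    show "z \<in> ?H"
    proof (cases "w \<le> v")
      case True
      show ?thesis
        by (rule sub[of z "u - v" "v - w" b w])
          (use True z in \<open>auto simp: algebra_simps\<close>)
    next
      case False
      show ?thesis
        by (rule sub[of z "u - w" "w - v" c v])
          (use False z in \<open>auto simp: algebra_simps\<close>)
    qed
  qed
qed

lemma tri_part_eq:
  assumes "a \<noteq> b" "b \<noteq> c" "a \<noteq> c"
  shows "tri_part {a, b, c} a
    = {u *\<^sub>R a + v *\<^sub>R b + w *\<^sub>R c | u v w. 0 \<le> v \<and> 0 \<le> w \<and> v \<le> u \<and> w \<le> u \<and> u + v + w = 1}"
proof -
  have "barycenter {a, b, c} = (1/3) *\<^sub>R (a + b + c)"
    using assms by (simp add: barycenter_def add.assoc)
  then show ?thesis unfolding tri_part_def convex_hull_part[symmetric] by simp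
qed

definition ref_int :: "(real \<times> real) set" where
  "ref_int = {p. \<forall>i<3. 0 < bary i p}"

lemma bary_sum: "bary 0 p + bary 1 p + bary 2 p = 1"
  by (simp add: bary_def)

lemma ref_int_subset: "p \<in> ref_int \<Longrightarrow> p \<in> ref_tri"
  by (auto simp: ref_int_def ref_tri_def)

locale mesh =
  fixes N :: nat
  assumes N_pos: "0 < N" and N_dvd: "4 dvd N"
begin

\<comment> \<open>Keeps the number of local node 1 from being rewritten.\<close>
declare One_nat_def [simp del]

abbreviation "h \<equiv> mesh_h N"
abbreviation "M \<equiv> mesh_M N"
abbreviation "X \<equiv> mesh_x N"
abbreviation "Y \<equiv> mesh_y N"

definition wid :: "nat \<Rightarrow> real" where "wid j = X (Suc j) - X j"

lemma h_pos: "0 < h" using N_pos by (simp add: mesh_h_def)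

lemma wid_eq: "wid j = (if even j then h / 2 else h)"
  by (simp add: wid_def)

lemma wid_pos: "0 < wid j" and wid_le: "wid j \<le> h" and wid_ge: "h / 2 \<le> wid j"
  using h_pos by (auto simp: wid_eq)

lemma X_Suc: "X (Suc j) = X j + wid j" by (simp add: wid_def)

lemma Y_Suc: "Y (Suc m) = Y m + h" by (simp add: mesh_y_def algebra_simps)

declare mesh_x.simps(2) [simp del]

lemma X_strict_mono: "strict_mono X"
  by (rule strict_monoI_Suc) (simp add: X_Suc wid_pos)

lemma Y_strict_mono: "strict_mono Y"
  by (rule strict_monoI_Suc) (simp add: Y_Suc h_pos)

lemma X_even: "X (2 * k) = 3 / 2 * h * real k"
  by (induction k) (auto simp: X_Suc wid_eq algebra_simps)

lemma M_eq: "real M = 3 * real N / 4"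
proof -
  obtain k where "N = 4 * k" using N_dvd by auto
  then show ?thesis by (simp add: mesh_M_def)
qed

lemma X_0: "X 0 = 0" and Y_0: "Y 0 = 0" by (simp_all add: mesh_y_def)

lemma X_N: "X N = 1"
proof -
  obtain k where k: "N = 4 * k" using N_dvd by auto
  then have "X N = 3 / 2 * h * real (2 * k)" using X_even[of "2 * k"] by (simp add: mult.assoc)
  then show ?thesis using k N_pos by (simp add: mesh_h_def)
qed

lemma Y_M: "Y M = 1"
  using N_pos by (simp add: mesh_y_def M_eq mesh_h_def)

lemma M_pos: "0 < M"
  using M_eq N_pos by (cases M) auto

definition pt :: "nat \<times> nat \<Rightarrow> real \<times> real" where
  "pt n = (X (fst n), Y (snd n))"

lemma pt_inj: "pt n = pt n' \<longleftrightarrow> n = n'"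
  using strict_mono_eq[OF X_strict_mono] strict_mono_eq[OF Y_strict_mono]
  by (auto simp: pt_def prod_eq_iff)

definition cells :: "(nat \<times> nat \<times> bool) set" where
  "cells = {..<N} \<times> {..<M} \<times> UNIV"

lemma finite_cells: "finite cells" by (simp add: cells_def)

text \<open>A cell is a column, a row and a flag that tells the upper triangle from the lower one. Local
  node 0 carries the right angle, node 1 is its horizontal and node 2 its vertical neighbour.\<close>

fun node :: "nat \<times> nat \<times> bool \<Rightarrow> nat \<Rightarrow> nat \<times> nat" where
  "node (j, m, b) i =
     (if b then (if i = 0 then (Suc j, Suc m) else if i = 1 then (j, Suc m) else (Suc j, m))
      else (if i = 0 then (j, m) else if i = 1 then (Suc j, m) else (j, Suc m)))"

fun legx :: "nat \<times> nat \<times> bool \<Rightarrow> real" where "legx (j, m, b) = (if b then - wid j else wid j)"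
fun legy :: "nat \<times> nat \<times> bool \<Rightarrow> real" where "legy (j, m, b) = (if b then - h else h)"

text \<open>The legs carry signs, so the chart of an upper triangle turns the reference triangle by half a
  turn, and one formula serves both kinds.\<close>

definition chart :: "nat \<times> nat \<times> bool \<Rightarrow> real \<times> real \<Rightarrow> real \<times> real" where
  "chart c p = (fst (pt (node c 0)) + legx c * fst p, snd (pt (node c 0)) + legy c * snd p)"

definition unchart :: "nat \<times> nat \<times> bool \<Rightarrow> real \<times> real \<Rightarrow> real \<times> real" where
  "unchart c z = ((fst z - fst (pt (node c 0))) / legx c, (snd z - snd (pt (node c 0))) / legy c)"

definition tri :: "nat \<times> nat \<times> bool \<Rightarrow> (real \<times> real) set" where
  "tri c = {pt (node c 0), pt (node c 1), pt (node c 2)}"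

lemma leg_nonzero: "legx c \<noteq> 0" "legy c \<noteq> 0"
  using wid_pos h_pos by (cases c; auto simp: less_le)+

lemma unchart_chart [simp]: "unchart c (chart c p) = p"
  using leg_nonzero[of c] by (simp add: chart_def unchart_def)

lemma chart_unchart [simp]: "chart c (unchart c z) = z"
  using leg_nonzero[of c] by (simp add: chart_def unchart_def)

lemma node_diff:
  "fst (pt (node c 1)) = fst (pt (node c 0)) + legx c" "snd (pt (node c 1)) = snd (pt (node c 0))"
  "fst (pt (node c 2)) = fst (pt (node c 0))" "snd (pt (node c 2)) = snd (pt (node c 0)) + legy c"
  by (cases c; auto simp: pt_def X_Suc Y_Suc)+

lemma chart_bary: "chart c p = bary 0 p *\<^sub>R pt (node c 0) + bary 1 p *\<^sub>R pt (node c 1) + bary 2 p *\<^sub>R pt (node c 2)"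
  unfolding chart_def by (simp add: prod_eq_iff node_diff bary_def algebra_simps)

lemma node_distinct: "node c 0 \<noteq> node c 1" "node c 1 \<noteq> node c 2" "node c 0 \<noteq> node c 2"
  by (cases c; simp)+

lemma triangulation_eq: "triangulation N = tri ` cells"
proof -
  have l: "lower_tri N j m = tri (j, m, False)" and u: "upper_tri N j m = tri (j, m, True)" for j m
    unfolding lower_tri_def upper_tri_def tri_def by (auto simp: pt_def)
  show ?thesis
  proof
    show "triangulation N \<subseteq> tri ` cells"
      unfolding triangulation_def l u cells_def by blast
    show "tri ` cells \<subseteq> triangulation N"
    proof
      fix T assume "T \<in> tri ` cells"
      then obtain j m b where "T = tri (j, m, b)" "j < N" "m < M" by (auto simp: cells_def)
      then have T: "T = lower_tri N j m \<or> T = upper_tri N j m" using l u by (cases b) simp_all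
      have "\<exists>j<N. \<exists>m<M. T = lower_tri N j m \<or> T = upper_tri N j m"
        by (rule exI[of _ j], rule conjI[OF \<open>j < N\<close>], rule exI[of _ m], rule conjI[OF \<open>m < M\<close> T])
      then show "T \<in> triangulation N" unfolding triangulation_def by (rule CollectI)
    qed
  qed
qed

lemma bary_coords:
  assumes "u + v + w = 1"
  shows "u = bary 0 (v, w)" "v = bary 1 (v, w)" "w = bary 2 (v, w)"
  using assms by (auto simp: bary_def)

lemma hull_tri: "convex hull (tri c) = chart c ` ref_tri"
proof -
  have "z \<in> chart c ` ref_tri \<longleftrightarrow> (\<exists>u v w. 0 \<le> u \<and> 0 \<le> v \<and> 0 \<le> w \<and> u + v + w = 1 \<and>
     z = u *\<^sub>R pt (node c 0) + v *\<^sub>R pt (node c 1) + w *\<^sub>R pt (node c 2))" (is "_ \<longleftrightarrow> ?E") for z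
  proof
    assume "z \<in> chart c ` ref_tri"
    then obtain p where "p \<in> ref_tri" "z = chart c p" by blast
    then show ?E using bary_sum[of p]
      by (intro exI[of _ "bary 0 p"] exI[of _ "bary 1 p"] exI[of _ "bary 2 p"])
        (auto simp: chart_bary ref_tri_def)
  next
    assume ?E
    then obtain u v w where z: "0 \<le> u" "0 \<le> v" "0 \<le> w" "u + v + w = 1"
      "z = u *\<^sub>R pt (node c 0) + v *\<^sub>R pt (node c 1) + w *\<^sub>R pt (node c 2)" by blast
    have b: "bary 0 (v, w) = u" "bary 1 (v, w) = v" "bary 2 (v, w) = w"
      using bary_coords[OF z(4)] by simp_all
    have "z = chart c (v, w)" unfolding chart_bary b by (rule z(5))
    moreover have "(v, w) \<in> ref_tri" unfolding ref_tri_def all_lt_3 mem_Collect_eq b using z by blast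
    ultimately show "z \<in> chart c ` ref_tri" by blast
  qed
  then show ?thesis unfolding tri_def convex_hull_3 by blast
qed

lemma tri_part_chart:
  assumes "i < 3"
  shows "tri_part (tri c) (pt (node c i)) = chart c ` ref_part i"
proof -
  define P where "P k = pt (node c k)" for k
  have d: "P 0 \<noteq> P 1" "P 1 \<noteq> P 2" "P 0 \<noteq> P 2" using node_distinct[of c] by (simp_all add: P_def pt_inj)
  have char: "z \<in> chart c ` ref_part i \<longleftrightarrow> (\<exists>p. (\<forall>j<3. 0 \<le> bary j p) \<and> (\<forall>j<3. bary j p \<le> bary i p) \<and>
     z = bary 0 p *\<^sub>R P 0 + bary 1 p *\<^sub>R P 1 + bary 2 p *\<^sub>R P 2)" for z
    unfolding ref_part_def ref_tri_def P_def chart_bary[symmetric] by blast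
  have key: "(\<exists>p. Q (bary 0 p) (bary 1 p) (bary 2 p)) \<longleftrightarrow> (\<exists>u v w. u + v + w = 1 \<and> Q u v w)" for Q
  proof
    assume "\<exists>p. Q (bary 0 p) (bary 1 p) (bary 2 p)"
    then show "\<exists>u v w. u + v + w = 1 \<and> Q u v w" using bary_sum by blast
  next
    assume "\<exists>u v w. u + v + w = 1 \<and> Q u v w"
    then obtain u v w where "u + v + w = 1" "Q u v w" by blast
    then show "\<exists>p. Q (bary 0 p) (bary 1 p) (bary 2 p)" using bary_coords[of u v w] by (intro exI[of _ "(v, w)"]) simp
  qed
  consider "i = 0" | "i = 1" | "i = 2" using assms by linarith
  then show ?thesis
  proof cases
    case 1
    have "tri c = {P 0, P 1, P 2}" by (simp add: tri_def P_def)
    then have "tri_part (tri c) (pt (node c i)) = tri_part {P 0, P 1, P 2} (P 0)" using 1 by (simp add: P_def)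
    also have "\<dots> = chart c ` ref_part i"
      unfolding tri_part_eq[OF d] set_eq_iff char unfolding all_lt_3 1
      by (subst key[where Q="\<lambda>u v w. (0 \<le> u \<and> 0 \<le> v \<and> 0 \<le> w) \<and> (u \<le> u \<and> v \<le> u \<and> w \<le> u) \<and>
        _ = u *\<^sub>R P 0 + v *\<^sub>R P 1 + w *\<^sub>R P 2"]) force
    finally show ?thesis .
  next
    case 2
    have "tri c = {P 1, P 0, P 2}" by (auto simp add: tri_def P_def)
    then have "tri_part (tri c) (pt (node c i)) = tri_part {P 1, P 0, P 2} (P 1)" using 2 by (simp add: P_def)
    also have "\<dots> = chart c ` ref_part i"
      unfolding tri_part_eq[OF d(1)[symmetric] d(3) d(2)] set_eq_iff char unfolding all_lt_3 2
      apply (subst key[where Q="\<lambda>u v w. (0 \<le> u \<and> 0 \<le> v \<and> 0 \<le> w) \<and> (u \<le> v \<and> v \<le> v \<and> w \<le> v) \<and>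
        _ = u *\<^sub>R P 0 + v *\<^sub>R P 1 + w *\<^sub>R P 2"])
      apply (intro allI iffI; clarsimp)
      subgoal for x y u v w by (rule exI[of _ v], rule exI[of _ u], rule exI[of _ w]) auto
      subgoal for x y u v w by (rule exI[of _ v], rule exI[of _ u], rule exI[of _ w]) auto
      done
    finally show ?thesis .
  next
    case 3
    have "tri c = {P 2, P 0, P 1}" by (auto simp add: tri_def P_def)
    then have "tri_part (tri c) (pt (node c i)) = tri_part {P 2, P 0, P 1} (P 2)" using 3 by (simp add: P_def)
    also have "\<dots> = chart c ` ref_part i"
      unfolding tri_part_eq[OF d(3)[symmetric] d(1) d(2)[symmetric]] set_eq_iff char unfolding all_lt_3 3
      apply (subst key[where Q="\<lambda>u v w. (0 \<le> u \<and> 0 \<le> v \<and> 0 \<le> w) \<and> (u \<le> w \<and> v \<le> w \<and> w \<le> w) \<and>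
        _ = u *\<^sub>R P 0 + v *\<^sub>R P 1 + w *\<^sub>R P 2"])
      apply (intro allI iffI; clarsimp)
      subgoal for x y u v w by (rule exI[of _ v], rule exI[of _ w], rule exI[of _ u]) auto
      subgoal for x y u v w by (rule exI[of _ w], rule exI[of _ u], rule exI[of _ v]) auto
      done
    finally show ?thesis .
  qed
qed

lemma chart_in_column:
  assumes "p \<in> ref_tri" "c = (j, m, b)"
  shows "X j \<le> fst (chart c p)" "fst (chart c p) \<le> X (Suc j)" "Y m \<le> snd (chart c p)" "snd (chart c p) \<le> Y (Suc m)"
proof -
  have p: "0 \<le> fst p" "fst p \<le> 1" "0 \<le> snd p" "snd p \<le> 1" using assms by (auto simp: ref_tri_iff)
  have "wid j * fst p \<le> wid j" "h * snd p \<le> h" "0 \<le> wid j * fst p" "0 \<le> h * snd p"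
    using p wid_pos[of j] h_pos by (auto simp: mult_left_le)
  then show "X j \<le> fst (chart c p)" "fst (chart c p) \<le> X (Suc j)" "Y m \<le> snd (chart c p)" "snd (chart c p) \<le> Y (Suc m)"
    using assms(2) by (auto simp: chart_def pt_def X_Suc Y_Suc)
qed

lemma chart_in_open_column:
  assumes "p \<in> ref_int" "c = (j, m, b)"
  shows "X j < fst (chart c p)" "fst (chart c p) < X (Suc j)" "Y m < snd (chart c p)" "snd (chart c p) < Y (Suc m)"
proof -
  have p: "0 < fst p" "fst p < 1" "0 < snd p" "snd p < 1"
    using assms by (auto simp: ref_int_def all_lt_3 bary_def)
  have "wid j * fst p < wid j" "h * snd p < h" "0 < wid j * fst p" "0 < h * snd p"
    using p wid_pos[of j] h_pos by auto
  then show "X j < fst (chart c p)" "fst (chart c p) < X (Suc j)" "Y m < snd (chart c p)" "snd (chart c p) < Y (Suc m)"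
    using assms(2) by (auto simp: chart_def pt_def X_Suc Y_Suc)
qed

lemma strict_mono_bracket:
  fixes f :: "nat \<Rightarrow> real"
  assumes "strict_mono f" "f j < x" "x < f (Suc j)" "f j' \<le> x" "x \<le> f (Suc j')"
  shows "j = j'"
proof -
  have "f j < f (Suc j')" "f j' < f (Suc j)" using assms by linarith+
  then have "j < Suc j'" "j' < Suc j" using strict_mono_less[OF assms(1)] by blast+
  then show ?thesis by simp
qed

text \<open>Strict monotonicity of the mesh lines tells different rectangles apart. In one rectangle, a common
  point of the two triangles lies on the diagonal, since its two pairs of local coordinates add up to
  \<open>(1, 1)\<close>.\<close>

lemma chart_overlap:
  assumes "p \<in> ref_int" "q \<in> ref_tri" "chart c p = chart c' q"
  shows "c = c'"
proof -
  obtain j m b j' m' b' where c: "c = (j, m, b)" "c' = (j', m', b')" by (metis surj_pair)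
  note P = chart_in_open_column[OF assms(1) c(1)]
  note Q = chart_in_column[OF assms(2) c(2)]
  have jm: "j = j'" "m = m'"
    using strict_mono_bracket[OF X_strict_mono P(1,2)] strict_mono_bracket[OF Y_strict_mono P(3,4)] Q assms(3)
    by auto
  have "b = b'"
  proof (rule ccontr)
    assume "b \<noteq> b'"
    then have "wid j' * (fst p + fst q - 1) = 0" "h * (snd p + snd q - 1) = 0"
      using assms(3) c jm
      by (cases b; cases b'; simp add: chart_def pt_def X_Suc Y_Suc algebra_simps)+
    then have "fst p + fst q = 1 \<and> snd p + snd q = 1" using wid_pos[of j'] h_pos by simp
    then show False using assms(1,2) by (auto simp: ref_tri_iff ref_int_def all_lt_3 bary_def)
  qed
  then show ?thesis using c jm by simp
qed

lemma bracket:
  fixes f :: "nat \<Rightarrow> real"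
  assumes "f 0 \<le> x" "x \<le> f n" "0 < n"
  shows "\<exists>j<n. f j \<le> x \<and> x \<le> f (Suc j)"
  using assms(2,3)
proof (induction n)
  case (Suc n)
  show ?case
  proof (cases "x \<le> f n \<and> 0 < n")
    case True
    then show ?thesis using Suc.IH by (auto intro: less_SucI)
  next
    case False
    then show ?thesis using Suc.prems assms(1) by (intro exI[of _ n]) auto
  qed
qed simp

lemma cells_cover:
  assumes "z \<in> {0..1} \<times> {0..1}"
  shows "\<exists>c\<in>cells. \<exists>p\<in>ref_tri. z = chart c p"
proof -
  obtain j where j: "j < N" "X j \<le> fst z" "fst z \<le> X (Suc j)"
    using bracket[of X "fst z" N] assms X_0 X_N N_pos by auto
  obtain m where m: "m < M" "Y m \<le> snd z" "snd z \<le> Y (Suc m)"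
    using bracket[of Y "snd z" M] assms Y_0 Y_M M_pos by auto
  define s where "s = (fst z - X j) / wid j"
  define t where "t = (snd z - Y m) / h"
  have st: "0 \<le> s" "s \<le> 1" "0 \<le> t" "t \<le> 1"
    using j m wid_pos[of j] h_pos by (auto simp: s_def t_def X_Suc Y_Suc field_simps)
  have z: "fst z = X j + wid j * s" "snd z = Y m + h * t"
    using wid_pos[of j] h_pos by (auto simp: s_def t_def)
  show ?thesis
  proof (cases "s + t \<le> 1")
    case True
    then show ?thesis using st z j m
      by (intro bexI[of _ "(j, m, False)"] bexI[of _ "(s, t)"])
        (auto simp: cells_def ref_tri_iff chart_def pt_def prod_eq_iff)
  next
    case False
    then show ?thesis using st z j m
      by (intro bexI[of _ "(j, m, True)"] bexI[of _ "(1 - s, 1 - t)"])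
        (auto simp: cells_def ref_tri_iff chart_def pt_def prod_eq_iff X_Suc Y_Suc algebra_simps)
  qed
qed

lemma X_range: "j \<le> N \<Longrightarrow> 0 \<le> X j \<and> X j \<le> 1" and Y_range: "m \<le> M \<Longrightarrow> 0 \<le> Y m \<and> Y m \<le> 1"
  using strict_mono_leD[OF X_strict_mono, of 0 j] strict_mono_leD[OF X_strict_mono, of j N]
    strict_mono_leD[OF Y_strict_mono, of 0 m] strict_mono_leD[OF Y_strict_mono, of m M] X_0 Y_0 X_N Y_M
  by auto

lemma chart_in_Omega:
  assumes "c \<in> cells" "p \<in> ref_int" shows "chart c p \<in> Omega"
proof -
  obtain j m b where c: "c = (j, m, b)" by (metis surj_pair)
  then have "j < N" "m < M" using assms by (auto simp: cells_def)
  then show ?thesis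
    using chart_in_open_column[OF assms(2) c] X_range[of j] X_range[of "Suc j"] Y_range[of m] Y_range[of "Suc m"]
    by (auto simp: Omega_def mem_Times_iff)
qed

definition edge_lines :: "(real \<times> real) set" where
  "edge_lines = (\<Union>c\<in>cells. \<Union>i<3. {z. bary i (unchart c z) = 0})"

lemma edge_lines_negligible: "negligible edge_lines"
proof -
  have "negligible {z. bary i (unchart c z) = 0}" for i c
  proof -
    define \<alpha> \<beta> x0 y0 where d: "\<alpha> = legx c" "\<beta> = legy c" "x0 = fst (pt (node c 0))" "y0 = snd (pt (node c 0))"
    have nz: "\<alpha> \<noteq> 0" "\<beta> \<noteq> 0" using leg_nonzero by (auto simp: d)
    consider "i = 0" | "i = 1" | "i \<noteq> 0" "i \<noteq> 1" by blast
    then obtain v r where "v \<noteq> 0" "{z. bary i (unchart c z) = 0} = {z. v \<bullet> z = r}"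
    proof cases
      case 1
      show ?thesis by (rule that[of "(1 / \<alpha>, 1 / \<beta>)" "1 + x0 / \<alpha> + y0 / \<beta>"])
        (use 1 nz in \<open>auto simp: bary_def unchart_def d(1,2,3,4)[symmetric] diff_divide_distrib zero_prod_def\<close>)
    next
      case 2
      show ?thesis by (rule that[of "(1 / \<alpha>, 0)" "x0 / \<alpha>"])
        (use 2 nz in \<open>auto simp: bary_def unchart_def d(1,2,3,4)[symmetric] diff_divide_distrib zero_prod_def\<close>)
    next
      case 3
      show ?thesis by (rule that[of "(0, 1 / \<beta>)" "y0 / \<beta>"])
        (use 3 nz in \<open>auto simp: bary_def unchart_def d(1,2,3,4)[symmetric] diff_divide_distrib zero_prod_def\<close>)
    qed
    then show ?thesis using negligible_hyperplane by metis
  qed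
  then show ?thesis unfolding edge_lines_def
    by (intro negligible_Union ballI) (auto simp: finite_cells intro!: negligible_Union)
qed

lemma off_edge_lines:
  assumes "c \<in> cells" "p \<in> ref_tri" "chart c p \<notin> edge_lines"
  shows "p \<in> ref_int"
proof -
  have "bary i p \<noteq> 0" if "i < 3" for i
    using assms(1,3) that unchart_chart[of c p] unfolding edge_lines_def by (metis (mono_tags, lifting) UN_I lessThan_iff mem_Collect_eq)
  then show ?thesis using assms(2) by (auto simp: ref_tri_def ref_int_def less_le)
qed

text \<open>An integrand over the square only has to be known in the charts of the open triangles, since
  the edges form a null set.\<close>

lemma integral_over_cells:
  assumes int: "\<And>c. c \<in> cells \<Longrightarrow> integrable lborel (k c)"
    and supp: "\<And>c p. c \<in> cells \<Longrightarrow> p \<notin> ref_tri \<Longrightarrow> k c p = 0"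
    and f: "\<And>c p. c \<in> cells \<Longrightarrow> p \<in> ref_int \<Longrightarrow> f (chart c p) = k c p"
  shows "(LINT z:Omega|lebesgue. f z) = (\<Sum>c\<in>cells. \<bar>legx c * legy c\<bar> * (\<integral>p. k c p \<partial>lborel))"
proof -
  define G where "G z = (\<Sum>c\<in>cells. k c (unchart c z))" for z
  have kc: "integrable lborel (\<lambda>z. k c (unchart c z))"
    "(\<integral>z. k c (unchart c z) \<partial>lborel) = \<bar>legx c * legy c\<bar> * (\<integral>p. k c p \<partial>lborel)" if "c \<in> cells" for c
    unfolding unchart_def using lborel_affine_plane[OF leg_nonzero int[OF that]] by blast+
  have G: "integrable lborel G" unfolding G_def by (intro Bochner_Integration.integrable_sum kc)
  have GI: "(\<integral>z. G z \<partial>lborel) = (\<Sum>c\<in>cells. \<bar>legx c * legy c\<bar> * (\<integral>p. k c p \<partial>lborel))"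
    unfolding G_def by (subst Bochner_Integration.integral_sum) (auto simp: kc)
  have eq: "indicator Omega z *\<^sub>R f z = G z" if z: "z \<notin> edge_lines" for z
  proof (cases "\<exists>c\<in>cells. unchart c z \<in> ref_tri")
    case True
    then obtain c where c: "c \<in> cells" "unchart c z \<in> ref_tri" by blast
    have int: "unchart c z \<in> ref_int" using off_edge_lines[OF c] z by simp
    have "k c' (unchart c' z) = 0" if "c' \<in> cells - {c}" for c'
      using chart_overlap[OF int, of "unchart c' z" c c'] supp[of c' "unchart c' z"] that by auto
    then have "G z = k c (unchart c z)" unfolding G_def using c finite_cells
      by (subst sum.remove[of _ c]) auto
    then show ?thesis using chart_in_Omega[OF c(1) int] f[OF c(1) int] by simp
  next
    case False
    have "z \<notin> Omega"
    proof
      assume "z \<in> Omega"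
      then have "z \<in> {0..1} \<times> {0..1}" by (auto simp: Omega_def)
      then show False using cells_cover False by force
    qed
    then show ?thesis using False supp by (simp add: G_def)
  qed
  have LG: "integrable lebesgue G" using G by (simp add: integrable_completion)
  have "G absolutely_integrable_on UNIV" using LG by (simp add: set_integrable_def)
  then have F: "(\<lambda>z. indicator Omega z *\<^sub>R f z) absolutely_integrable_on UNIV"
    by (rule absolutely_integrable_spike[OF _ edge_lines_negligible]) (use eq in auto)
  have "(LINT z:Omega|lebesgue. f z) = (LINT z:UNIV|lebesgue. indicator Omega z *\<^sub>R f z)"
    by (simp add: set_lebesgue_integral_def)
  also have "\<dots> = integral UNIV (\<lambda>z. indicator Omega z *\<^sub>R f z)"
    by (rule set_lebesgue_integral_eq_integral(2)[OF F])
  also have "\<dots> = integral UNIV G"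
    by (rule integral_spike[OF edge_lines_negligible]) (use eq in auto)
  also have "\<dots> = (\<integral>z. G z \<partial>lborel)"
    using has_integral_integral_real[OF G] by (rule integral_unique)
  finally show ?thesis using GI by simp
qed

end

section \<open>The finite element space and its forms\<close>

lemma GDERIV_unique:
  assumes "GDERIV f z :> D" "GDERIV f z :> D'" shows "D = D'"
proof -
  have "(\<lambda>k. inner k D) = (\<lambda>k. inner k D')"
    using assms unfolding gderiv_def by (rule has_derivative_unique)
  then have "inner (D - D') D = inner (D - D') D'" by meson
  then have "inner (D - D') (D - D') = 0" by (simp only: inner_diff_right diff_self)
  then show ?thesis by simp
qed

lemma grad_eqI:
  assumes "GDERIV f z :> D" shows "grad f z = D"
  unfolding grad_def by (rule the_equality, rule assms, rule GDERIV_unique[OF _ assms])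

lemma integral_double_sum:
  fixes K :: "nat \<Rightarrow> nat \<Rightarrow> 'b \<Rightarrow> real"
  assumes "\<And>i j. i < n \<Longrightarrow> j < n \<Longrightarrow> integrable \<mu> (K i j)"
  shows "(\<integral>p. (\<Sum>i<n. \<Sum>j<n. r i j * K i j p) \<partial>\<mu>) = (\<Sum>i<n. \<Sum>j<n. r i j * (\<integral>p. K i j p \<partial>\<mu>))"
proof -
  have "(\<integral>p. (\<Sum>i<n. \<Sum>j<n. r i j * K i j p) \<partial>\<mu>) = (\<Sum>i<n. \<integral>p. (\<Sum>j<n. r i j * K i j p) \<partial>\<mu>)"
    by (rule Bochner_Integration.integral_sum)
      (intro Bochner_Integration.integrable_sum integrable_mult_right assms; simp)
  also have "\<dots> = (\<Sum>i<n. \<Sum>j<n. \<integral>p. r i j * K i j p \<partial>\<mu>)"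
    by (intro sum.cong refl Bochner_Integration.integral_sum integrable_mult_right assms; simp)
  finally show ?thesis by simp
qed

context mesh
begin

abbreviation val :: "(real \<times> real \<Rightarrow> real) \<Rightarrow> nat \<times> nat \<times> bool \<Rightarrow> nat \<Rightarrow> real" where
  "val f c i \<equiv> f (pt (node c i))"

definition inner_nodes :: "(nat \<times> nat) set" where
  "inner_nodes = {0<..<N} \<times> {0<..<M}"

lemma tri_image: "tri c = (\<lambda>i. pt (node c i)) ` {..<3}"
proof -
  have "{..<3} = {0, 1, 2 :: nat}" by auto
  then show ?thesis by (simp add: tri_def)
qed

lemma node_inj: "i < 3 \<Longrightarrow> j < 3 \<Longrightarrow> node c i = node c j \<Longrightarrow> i = j"
  using less_3_cases[of i] less_3_cases[of j] node_distinct[of c] by metis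

lemma node_range:
  assumes "c \<in> cells" shows "node c i \<in> {..N} \<times> {..M}"
  using assms by (cases c) (auto simp: cells_def)

lemma vertices_eq: "vertices N = pt ` ({..N} \<times> {..M})"
proof
  show "vertices N \<subseteq> pt ` ({..N} \<times> {..M})"
    unfolding vertices_def triangulation_eq tri_def using node_range by blast
  show "pt ` ({..N} \<times> {..M}) \<subseteq> vertices N"
  proof (rule image_subsetI)
    fix n assume n: "n \<in> {..N} \<times> {..M}"
    define j where "j = min (fst n) (N - 1)"
    define m where "m = min (snd n) (M - 1)"
    define b where "b \<longleftrightarrow> fst n = Suc j \<and> snd n = Suc m"
    have c: "(j, m, b) \<in> cells" using N_pos M_pos by (auto simp: cells_def j_def m_def)
    have "(fst n = j \<or> fst n = Suc j) \<and> (snd n = m \<or> snd n = Suc m)"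
      using n N_pos M_pos by (auto simp: j_def m_def min_def)
    then have "n = node (j, m, b) 0 \<or> n = node (j, m, b) 1 \<or> n = node (j, m, b) 2"
      by (cases n) (auto simp: b_def)
    then have "pt n \<in> tri (j, m, b)" by (auto simp: tri_def)
    then show "pt n \<in> vertices N" unfolding vertices_def triangulation_eq using c by blast
  qed
qed

lemma pt_in_Omega: "n \<in> {..N} \<times> {..M} \<Longrightarrow> pt n \<in> Omega \<longleftrightarrow> n \<in> inner_nodes"
  using strict_mono_less[OF X_strict_mono, of 0 "fst n"] strict_mono_less[OF X_strict_mono, of "fst n" N]
    strict_mono_less[OF Y_strict_mono, of 0 "snd n"] strict_mono_less[OF Y_strict_mono, of "snd n" M]
  by (auto simp: pt_def Omega_def inner_nodes_def mem_Times_iff X_0 X_N Y_0 Y_M)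

lemma interior_vertices_eq: "interior_vertices N = pt ` inner_nodes"
proof -
  have "inner_nodes \<subseteq> {..N} \<times> {..M}" by (auto simp: inner_nodes_def)
  then show ?thesis unfolding interior_vertices_def vertices_eq using pt_in_Omega by blast
qed

lemma pt_node_chart: "pt (node c 0) = chart c (0, 0)" "pt (node c 1) = chart c (1, 0)" "pt (node c 2) = chart c (0, 1)"
  by (simp_all add: chart_def prod_eq_iff node_diff)

lemma S_h_value:
  assumes f: "f \<in> S_h N" and c: "c \<in> cells" and p: "p \<in> ref_tri"
  shows "f (chart c p) = (\<Sum>i<3. bary i p * val f c i)"
proof -
  have "tri c \<in> triangulation N" using c triangulation_eq by blast
  then obtain a b d where "\<forall>(x, y)\<in>convex hull tri c. f (x, y) = a + b * x + d * y"
    using f unfolding S_h_def by blast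
  then have v: "f (chart c q) = a + b * fst (chart c q) + d * snd (chart c q)" if "q \<in> ref_tri" for q
    using that unfolding hull_tri by (auto simp: case_prod_beta)
  have e: "(0, 0) \<in> ref_tri" "(1, 0) \<in> ref_tri" "(0, 1) \<in> ref_tri" by (simp_all add: ref_tri_iff)
  show ?thesis
    unfolding sum_lt_3 pt_node_chart v[OF p] v[OF e(1)] v[OF e(2)] v[OF e(3)]
    by (simp add: chart_def bary_def algebra_simps)
qed

lemma S_h_zero: "f \<in> S_h N \<Longrightarrow> z \<notin> Omega \<Longrightarrow> f z = 0"
  unfolding S_h_def by blast

lemma S_hI:
  assumes cont: "continuous_on UNIV f" and zero: "\<And>z. z \<notin> Omega \<Longrightarrow> f z = 0"
    and v: "\<And>c p. c \<in> cells \<Longrightarrow> p \<in> ref_tri \<Longrightarrow> f (chart c p) = (\<Sum>i<3. bary i p * v c i)"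
  shows "f \<in> S_h N"
  unfolding S_h_def
proof (intro CollectI conjI ballI allI impI)
  show "continuous_on (closure Omega) f" using cont continuous_on_subset by blast
next
  fix T assume "T \<in> triangulation N"
  then obtain c where c: "c \<in> cells" "T = tri c" using triangulation_eq by blast
  define x0 y0 \<alpha> \<beta> where d: "x0 = fst (pt (node c 0))" "y0 = snd (pt (node c 0))" "\<alpha> = legx c" "\<beta> = legy c"
  define b where "b = (v c 1 - v c 0) / \<alpha>"
  define e where "e = (v c 2 - v c 0) / \<beta>"
  have nz: "\<alpha> \<noteq> 0" "\<beta> \<noteq> 0" using leg_nonzero by (auto simp: d)
  have "f (x, y) = (v c 0 - b * x0 - e * y0) + b * x + e * y" if xyT: "(x, y) \<in> convex hull T" for x y
  proof -
    obtain p where p: "p \<in> ref_tri" "(x, y) = chart c p" using xyT unfolding c(2) hull_tri by blast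
    then have xy: "x = x0 + \<alpha> * fst p" "y = y0 + \<beta> * snd p" by (auto simp: chart_def d)
    have "f (x, y) = v c 0 + fst p * (v c 1 - v c 0) + snd p * (v c 2 - v c 0)"
      unfolding p(2) v[OF c(1) p(1)] sum_lt_3 by (simp add: bary_def algebra_simps)
    moreover have "v c 1 - v c 0 = b * \<alpha>" "v c 2 - v c 0 = e * \<beta>" using nz by (simp_all add: b_def e_def)
    ultimately show ?thesis unfolding xy by (simp add: algebra_simps)
  qed
  then show "\<exists>a b c. \<forall>(x, y)\<in>convex hull T. f (x, y) = a + b * x + c * y"
    by (intro exI[of _ "v c 0 - b * x0 - e * y0"] exI[of _ b] exI[of _ e]) auto
qed (rule zero)

lemma S_h_comb:
  assumes f: "f \<in> S_h N" and g: "g \<in> S_h N"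
  shows "(\<lambda>p. f p + r * g p) \<in> S_h N"
  unfolding S_h_def
proof (intro CollectI conjI ballI allI impI)
  show "continuous_on (closure Omega) (\<lambda>p. f p + r * g p)"
    using f g unfolding S_h_def by (auto intro!: continuous_intros)
next
  fix T assume T: "T \<in> triangulation N"
  obtain a b c a' b' c' where
    F: "\<forall>(x, y)\<in>convex hull T. f (x, y) = a + b * x + c * y" and
    G: "\<forall>(x, y)\<in>convex hull T. g (x, y) = a' + b' * x + c' * y"
    using f g T unfolding S_h_def by blast
  have "f (x, y) + r * g (x, y) = (a + r * a') + (b + r * b') * x + (c + r * c') * y"
    if "(x, y) \<in> convex hull T" for x y
  proof -
    have "f (x, y) = a + b * x + c * y" "g (x, y) = a' + b' * x + c' * y" using F G that by blast+
    then show ?thesis by (simp add: algebra_simps)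
  qed
  then have "\<forall>(x, y)\<in>convex hull T. f (x, y) + r * g (x, y) = (a + r * a') + (b + r * b') * x + (c + r * c') * y"
    by blast
  then show "\<exists>a b c. \<forall>(x, y)\<in>convex hull T. f (x, y) + r * g (x, y) = a + b * x + c * y"
    by (intro exI[of _ "a + r * a'"] exI[of _ "b + r * b'"] exI[of _ "c + r * c'"])
next
  fix z assume "z \<notin> Omega" then show "f z + r * g z = 0" using S_h_zero[OF f] S_h_zero[OF g] by simp
qed

lemma S_h_null: "(\<lambda>p. 0) \<in> S_h N"
  by (rule S_hI[where v="\<lambda>_ _. 0"]) auto

lemma S_h_eqI:
  assumes f: "f \<in> S_h N" and g: "g \<in> S_h N" and eq: "\<And>n. n \<in> inner_nodes \<Longrightarrow> f (pt n) = g (pt n)"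
  shows "f = g"
proof
  fix z
  have node: "val f c i = val g c i" if "c \<in> cells" for c i
  proof (cases "node c i \<in> inner_nodes")
    case False
    then have "pt (node c i) \<notin> Omega" using pt_in_Omega node_range[OF that] by blast
    then show ?thesis using S_h_zero[OF f] S_h_zero[OF g] by simp
  qed (rule eq)
  show "f z = g z"
  proof (cases "z \<in> Omega")
    case True
    then have "z \<in> {0..1} \<times> {0..1}" by (auto simp: Omega_def)
    then obtain c p where "c \<in> cells" "p \<in> ref_tri" "z = chart c p" using cells_cover by blast
    then show ?thesis using S_h_value[OF f] S_h_value[OF g] node by simp
  qed (use S_h_zero[OF f] S_h_zero[OF g] in simp)
qed

text \<open>In coordinates that make the mesh uniform with unit spacing, the nodal basis function at the
  origin is \<open>1 - max (\<bar>s\<bar>, \<bar>t\<bar>, \<bar>s + t\<bar>)\<close>, cut off at zero: the diagonals are parallel to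
  \<open>(1, -1)\<close>, along which \<open>s + t\<close> is constant. The abscissa only has to be straightened on the two
  columns next to the node.\<close>

definition straight :: "nat \<Rightarrow> real \<Rightarrow> real" where
  "straight i x = min 0 ((x - X i) / wid (i - 1)) + max 0 ((x - X i) / wid i)"

definition hat :: "nat \<times> nat \<Rightarrow> real \<times> real \<Rightarrow> real" where
  "hat n z = (let s = straight (fst n) (fst z); t = (snd z - Y (snd n)) / h
    in max 0 (1 - max (max \<bar>s\<bar> \<bar>t\<bar>) \<bar>s + t\<bar>))"

lemma min_max_far:
  "1 \<le> b \<Longrightarrow> 0 \<le> a \<Longrightarrow> 1 \<le> \<bar>min 0 a + max 0 (b :: real)\<bar>"
  "a \<le> - 1 \<Longrightarrow> b \<le> 0 \<Longrightarrow> 1 \<le> \<bar>min 0 a + max 0 (b :: real)\<bar>"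
  by auto

lemma straight_column:
  assumes S: "0 \<le> S" "S \<le> 1" and i: "0 < i"
  shows "j = i \<Longrightarrow> straight i (X j + wid j * S) = S"
    and "Suc j = i \<Longrightarrow> straight i (X j + wid j * S) = S - 1"
    and "j \<noteq> i \<Longrightarrow> Suc j \<noteq> i \<Longrightarrow> 1 \<le> \<bar>straight i (X j + wid j * S)\<bar>"
proof -
  have w: "0 < wid j" "0 < wid i" "0 < wid (i - 1)" using wid_pos by auto
  show "straight i (X j + wid j * S) = S" if "j = i"
    using S w that by (auto simp: straight_def min_def max_def divide_le_0_iff mult_le_0_iff)
  show "straight i (X j + wid j * S) = S - 1" if "Suc j = i"
  proof -
    have "X j + wid j * S - X i = wid j * (S - 1)" using that by (auto simp: X_Suc algebra_simps)
    moreover have "wid j * (S - 1) / wid i \<le> 0" using S w by (simp add: divide_le_0_iff mult_le_0_iff)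
    ultimately show ?thesis using S w that by (auto simp: straight_def min_def max_def)
  qed
  assume ne: "j \<noteq> i" "Suc j \<noteq> i"
  have wS: "0 \<le> wid j * S" "wid j * S \<le> wid j" using S w by (auto simp: mult_left_le)
  show "1 \<le> \<bar>straight i (X j + wid j * S)\<bar>"
  proof (cases "i < j")
    case True
    then have "X i + wid i \<le> X j" using strict_mono_leD[OF X_strict_mono, of "Suc i" j] by (simp add: X_Suc)
    then have "wid i \<le> X j + wid j * S - X i" using wS by linarith
    then have "1 \<le> (X j + wid j * S - X i) / wid i" "0 \<le> (X j + wid j * S - X i) / wid (i - 1)"
      using w by (auto simp: le_divide_eq)
    then show ?thesis unfolding straight_def by (intro min_max_far)
  next
    case False
    then have "Suc j \<le> i - 1" using ne by linarith
    then have "X j + wid j \<le> X (i - 1)" using strict_mono_leD[OF X_strict_mono, of "Suc j" "i - 1"] by (simp add: X_Suc)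
    moreover have "X i = X (i - 1) + wid (i - 1)" using X_Suc[of "i - 1"] i by simp
    ultimately have "X j + wid j * S - X i \<le> - wid (i - 1)" using wS by linarith
    then have "(X j + wid j * S - X i) / wid (i - 1) \<le> - 1" "(X j + wid j * S - X i) / wid i \<le> 0"
      using w by (auto simp: divide_le_eq divide_le_0_iff)
    then show ?thesis unfolding straight_def by (intro min_max_far)
  qed
qed

lemma hat_far: "1 \<le> \<bar>s\<bar> \<or> 1 \<le> \<bar>t\<bar> \<Longrightarrow> max 0 (1 - max (max \<bar>s\<bar> \<bar>t\<bar>) \<bar>s + t\<bar>) = (0 :: real)"
  by (auto simp: max_def)

text \<open>Only the eight cells of the four rectangles around the node need computing; on every other cell one
  of the straightened coordinates is at least 1 in absolute value.\<close>

lemma hat_chart: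
  assumes n: "n \<in> inner_nodes" and p: "p \<in> ref_tri"
  shows "hat n (chart c p) = (\<Sum>i<3. bary i p * (if node c i = n then 1 else 0))"
proof -
  obtain i k where ik: "n = (i, k)" by fastforce
  obtain j m b where c: "c = (j, m, b)" by (metis surj_pair)
  define S where "S = (if b then 1 - fst p else fst p)"
  define T where "T = (if b then 1 - snd p else snd p)"
  have P: "0 \<le> fst p" "0 \<le> snd p" "fst p + snd p \<le> 1" using p by (auto simp: ref_tri_iff)
  then have ST: "0 \<le> S" "S \<le> 1" "0 \<le> T" "T \<le> 1" by (auto simp: S_def T_def)
  have i: "0 < i" using n ik by (auto simp: inner_nodes_def)
  have z: "fst (chart c p) = X j + wid j * S" "snd (chart c p) = Y m + h * T"
    unfolding c S_def T_def by (auto simp: chart_def pt_def X_Suc Y_Suc algebra_simps)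
  define s where "s = straight i (fst (chart c p))"
  define t where "t = (snd (chart c p) - Y k) / h"
  have t: "t = real m - real k + T" using h_pos by (simp add: t_def z mesh_y_def field_simps)
  have hat: "hat n (chart c p) = max 0 (1 - max (max \<bar>s\<bar> \<bar>t\<bar>) \<bar>s + t\<bar>)"
    unfolding hat_def ik s_def t_def Let_def fst_conv snd_conv by (rule refl)
  note sc = straight_column[OF ST(1,2) i, of j, folded z(1), folded s_def]
  show ?thesis
  proof (cases "(j = i \<or> Suc j = i) \<and> (m = k \<or> Suc m = k)")
    case False
    have "1 \<le> \<bar>t\<bar>" if "\<not> (m = k \<or> Suc m = k)"
    proof -
      have "m \<ge> Suc k \<or> Suc (Suc m) \<le> k" using that by linarith
      then have "real m \<ge> real (Suc k) \<or> real (Suc (Suc m)) \<le> real k" using of_nat_mono by blast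
      then show ?thesis unfolding t using ST by auto
    qed
    then have "1 \<le> \<bar>s\<bar> \<or> 1 \<le> \<bar>t\<bar>" using False sc(3) by blast
    then have "hat n (chart c p) = 0" using hat hat_far by simp
    moreover have "node c l \<noteq> n" for l using False unfolding c ik by auto
    ultimately show ?thesis by simp
  next
    case True
    have nd: "(node c 0 = n) = (if b then Suc j = i \<and> Suc m = k else j = i \<and> m = k)"
      "(node c 1 = n) = (if b then j = i \<and> Suc m = k else Suc j = i \<and> m = k)"
      "(node c 2 = n) = (if b then Suc j = i \<and> m = k else j = i \<and> Suc m = k)"
      unfolding c ik by auto
    have s': "s = (if j = i then S else S - 1)" using True sc(1,2) by auto
    have t': "t = (if m = k then T else T - 1)" using True by (auto simp: t)
    consider "j = i" "m = k" | "j = i" "Suc m = k" | "Suc j = i" "m = k" | "Suc j = i" "Suc m = k" using True by blast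
    then show ?thesis
      unfolding hat s' t' sum_lt_3 nd bary_def
      by cases (cases b; use P in \<open>auto simp: S_def T_def max_def abs_if\<close>)+
  qed
qed

lemma hat_outside:
  assumes n: "n \<in> inner_nodes" and z: "z \<notin> Omega" shows "hat n z = 0"
proof -
  obtain i k where ik: "n = (i, k)" by fastforce
  have b: "0 < i" "i < N" "0 < k" "k < M" using n ik by (auto simp: inner_nodes_def)
  have w: "0 < wid i" "0 < wid (i - 1)" using wid_pos by auto
  have lo: "wid (i - 1) \<le> X i"
    using X_Suc[of "i - 1"] X_range[of "i - 1"] b by simp
  have hi: "X i + wid i \<le> 1" using X_Suc[of i] X_range[of "Suc i"] b by simp
  have ylo: "h \<le> Y k" using Y_Suc[of "k - 1"] Y_range[of "k - 1"] b by simp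
  have yhi: "Y k + h \<le> 1" using Y_Suc[of k] Y_range[of "Suc k"] b by simp
  define s where "s = straight i (fst z)"
  define t where "t = (snd z - Y k) / h"
  consider "fst z \<le> 0" | "1 \<le> fst z" | "snd z \<le> 0" | "1 \<le> snd z"
    using z by (force simp: Omega_def mem_Times_iff)
  then have "1 \<le> \<bar>s\<bar> \<or> 1 \<le> \<bar>t\<bar>"
  proof cases
    case 1
    then have "(fst z - X i) / wid (i - 1) \<le> - 1" "(fst z - X i) / wid i \<le> 0"
      using w lo by (auto simp: divide_le_eq divide_le_0_iff)
    then show ?thesis unfolding s_def straight_def by (intro disjI1 min_max_far)
  next
    case 2
    then have "1 \<le> (fst z - X i) / wid i" "0 \<le> (fst z - X i) / wid (i - 1)"
      using w hi by (auto simp: le_divide_eq)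
    then show ?thesis unfolding s_def straight_def by (intro disjI1 min_max_far)
  next
    case 3
    then have "t \<le> - 1" using ylo h_pos by (auto simp: t_def divide_le_eq)
    then show ?thesis by auto
  next
    case 4
    then have "1 \<le> t" using yhi h_pos by (auto simp: t_def le_divide_eq)
    then show ?thesis by auto
  qed
  then show ?thesis unfolding hat_def ik s_def t_def Let_def fst_conv snd_conv by (rule hat_far)
qed

lemma hat_in_S_h: "n \<in> inner_nodes \<Longrightarrow> hat n \<in> S_h N"
proof (rule S_hI[where v="\<lambda>c i. if node c i = n then 1 else 0"])
  assume n: "n \<in> inner_nodes"
  have "wid j \<noteq> 0" "h \<noteq> 0" for j using wid_pos[of j] h_pos by auto
  then show "continuous_on UNIV (hat n)"
    unfolding hat_def straight_def Let_def by (intro continuous_intros) auto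
qed (auto simp: hat_chart hat_outside)

lemma hat_pt:
  assumes n: "n \<in> inner_nodes" and n': "n' \<in> {..N} \<times> {..M}"
  shows "hat n (pt n') = (if n' = n then 1 else 0)"
proof -
  have "pt n' \<in> \<Union> (triangulation N)" using n' vertices_eq unfolding vertices_def by blast
  then obtain c where c: "c \<in> cells" "pt n' \<in> tri c" unfolding triangulation_eq by blast
  then consider "n' = node c 0" | "n' = node c 1" | "n' = node c 2" by (auto simp: tri_def pt_inj)
  moreover have "(0, 0) \<in> ref_tri" "(1, 0) \<in> ref_tri" "(0, 1) \<in> ref_tri" by (simp_all add: ref_tri_iff)
  moreover note hc = calculation(2-4)[THEN hat_chart[OF n], of c, unfolded sum_lt_3]
  ultimately show ?thesis
  proof cases
    case 1
    show ?thesis unfolding 1 pt_node_chart hc(1) by (simp add: bary_def)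
  next
    case 2
    show ?thesis unfolding 2 pt_node_chart hc(2) by (simp add: bary_def)
  next
    case 3
    show ?thesis unfolding 3 pt_node_chart hc(3) by (simp add: bary_def)
  qed
qed

lemma inner_nodes_subset: "inner_nodes \<subseteq> {..N} \<times> {..M}"
  by (auto simp: inner_nodes_def)

lemma nodal_basis_eq:
  assumes n: "n \<in> inner_nodes" shows "nodal_basis N (pt n) = hat n"
  unfolding nodal_basis_def
proof (rule the_equality)
  show "hat n \<in> S_h N \<and> hat n (pt n) = 1 \<and> (\<forall>w\<in>vertices N - {pt n}. hat n w = 0)"
  proof (intro conjI ballI)
    show "hat n \<in> S_h N" by (rule hat_in_S_h[OF n])
    show "hat n (pt n) = 1" using hat_pt[OF n] n inner_nodes_subset by auto
    fix w assume "w \<in> vertices N - {pt n}"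
    then obtain n' where "n' \<in> {..N} \<times> {..M}" "w = pt n'" "n' \<noteq> n" unfolding vertices_eq by blast
    then show "hat n w = 0" using hat_pt[OF n, of n'] by simp
  qed
next
  fix f assume f: "f \<in> S_h N \<and> f (pt n) = 1 \<and> (\<forall>w\<in>vertices N - {pt n}. f w = 0)"
  show "f = hat n"
  proof (rule S_h_eqI)
    fix n' assume n': "n' \<in> inner_nodes"
    then have r: "n' \<in> {..N} \<times> {..M}" using inner_nodes_subset by blast
    show "f (pt n') = hat n (pt n')"
    proof (cases "n' = n")
      case False
      then have "pt n' \<in> vertices N - {pt n}" using r vertices_eq pt_inj by blast
      then show ?thesis using f hat_pt[OF n r] False by simp
    qed (use f hat_pt[OF n r] in simp)
  qed (use f hat_in_S_h[OF n] in auto)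
qed

lemma finite_interior_vertices: "finite (interior_vertices N)"
  by (simp add: interior_vertices_eq inner_nodes_def)

lemma S_h_sum:
  assumes "finite I" "\<And>i. i \<in> I \<Longrightarrow> g i \<in> S_h N"
  shows "(\<lambda>p. \<Sum>i\<in>I. c i * g i p) \<in> S_h N"
  using assms
proof (induction I rule: finite_induct)
  case (insert x I)
  have "(\<lambda>p. (\<Sum>i\<in>I. c i * g i p) + c x * g x p) \<in> S_h N"
    using insert by (intro S_h_comb) auto
  then show ?case using insert by (simp add: add.commute)
qed (simp add: S_h_null)

sublocale nodal_space "S_h N" "interior_vertices N" "nodal_basis N"
proof
  fix z assume "z \<in> interior_vertices N"
  then show "nodal_basis N z \<in> S_h N" using interior_vertices_eq nodal_basis_eq hat_in_S_h by force
next
  fix f p assume f: "f \<in> S_h N"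
  define g where "g = (\<lambda>p. \<Sum>n\<in>inner_nodes. f (pt n) * hat n p)"
  have fin: "finite inner_nodes" by (simp add: inner_nodes_def)
  have "f = g"
  proof (rule S_h_eqI[OF f])
    show "g \<in> S_h N" unfolding g_def by (rule S_h_sum[OF fin hat_in_S_h])
    fix n assume n: "n \<in> inner_nodes"
    then have r: "n \<in> {..N} \<times> {..M}" using inner_nodes_subset by blast
    have "g (pt n) = (\<Sum>n'\<in>inner_nodes. f (pt n') * (if n = n' then 1 else 0))"
      unfolding g_def by (intro sum.cong refl) (use hat_pt r in simp)
    also have "\<dots> = f (pt n)" using fin n by (simp add: if_distrib cong: if_cong)
    finally show "f (pt n) = g (pt n)" by simp
  qed
  moreover have "g p = (\<Sum>z\<in>interior_vertices N. f z * nodal_basis N z p)"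
    unfolding g_def interior_vertices_eq
    by (subst sum.reindex) (auto simp: inj_on_def pt_inj nodal_basis_eq)
  ultimately show "f p = (\<Sum>z\<in>interior_vertices N. f z * nodal_basis N z p)" by simp
qed (use finite_interior_vertices S_h_null S_h_comb in auto)

definition area :: "nat \<times> nat \<times> bool \<Rightarrow> real" where "area c = \<bar>legx c * legy c\<bar> / 2"

lemma L2_inner_cells:
  assumes f: "f \<in> S_h N" and g: "g \<in> S_h N"
  shows "L2_inner f g = (\<Sum>c\<in>cells. 2 * area c *
    (\<Sum>i<3. \<Sum>j<3. val f c i * val g c j * (if i = j then 1 / 12 else 1 / 24)))"
proof -
  define k where "k c p = (\<Sum>i<3. \<Sum>j<3. val f c i * val g c j *
    (indicator ref_tri p * (bary i p * bary j p)))" for c p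
  have "L2_inner f g = (\<Sum>c\<in>cells. \<bar>legx c * legy c\<bar> * (\<integral>p. k c p \<partial>lborel))"
    unfolding L2_inner_def
  proof (rule integral_over_cells)
    show "integrable lborel (k c)" for c
      unfolding k_def by (intro Bochner_Integration.integrable_sum integrable_mult_right) (auto intro!: bary_mult_integral(1))
    show "k c p = 0" if "p \<notin> ref_tri" for c p using that by (simp add: k_def)
    fix c p assume c: "c \<in> cells" and "p \<in> ref_int"
    then have p: "p \<in> ref_tri" by (simp add: ref_int_subset)
    show "f (chart c p) * g (chart c p) = k c p"
      unfolding S_h_value[OF f c p] S_h_value[OF g c p] k_def sum_product using p
      by (intro sum.cong refl) simp
  qed
  moreover have "(\<integral>p. k c p \<partial>lborel) = (\<Sum>i<3. \<Sum>j<3. val f c i * val g c j * (if i = j then 1 / 12 else 1 / 24))" for c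
    unfolding k_def
    by (subst integral_double_sum) (simp_all add: bary_mult_integral cong: if_cong)
  ultimately show ?thesis by (simp add: area_def)
qed

text \<open>Inside a cell only the part cut from that very cell contributes to a control volume, because the
  parts from other cells lie in closed triangles that the interior does not meet.\<close>

lemma control_volume_chart:
  assumes c: "c \<in> cells" and p: "p \<in> ref_int"
  shows "chart c p \<in> control_volume N z \<longleftrightarrow> (\<exists>i<3. z = pt (node c i) \<and> p \<in> ref_part i)"
proof
  assume "chart c p \<in> control_volume N z"
  then obtain c' where c': "c' \<in> cells" "z \<in> tri c'" "chart c p \<in> tri_part (tri c') z"
    unfolding control_volume_def triangulation_eq by blast
  obtain i where i: "i < 3" "z = pt (node c' i)" using c'(2) unfolding tri_image by blast
  then obtain q where q: "q \<in> ref_part i" "chart c p = chart c' q" using c'(3) tri_part_chart by auto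
  then have "q \<in> ref_tri" by (simp add: ref_part_def)
  then have "c = c'" using chart_overlap p q by blast
  moreover from this have "p = q" using q(2) unchart_chart by metis
  ultimately show "\<exists>i<3. z = pt (node c i) \<and> p \<in> ref_part i" using i q by blast
next
  assume "\<exists>i<3. z = pt (node c i) \<and> p \<in> ref_part i"
  then obtain i where i: "i < 3" "z = pt (node c i)" "p \<in> ref_part i" by blast
  then have "z \<in> tri c" unfolding tri_image by blast
  then show "chart c p \<in> control_volume N z"
    unfolding control_volume_def triangulation_eq using tri_part_chart[OF i(1), of c] i c by blast
qed

lemma J_h_chart:
  assumes g: "g \<in> S_h N" and c: "c \<in> cells" and p: "p \<in> ref_int"
  shows "J_h N g (chart c p) = (\<Sum>i<3. val g c i * indicator (ref_part i) p)"
proof -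
  have ind: "indicator (control_volume N z) (chart c p)
      = (\<Sum>i<3. if z = pt (node c i) then indicator (ref_part i) p else 0 :: real)" for z
  proof (cases "\<exists>i<3. z = pt (node c i)")
    case True
    then obtain i where i: "i < 3" "z = pt (node c i)" by blast
    have inj: "z = pt (node c j) \<longleftrightarrow> j = i" if "j < 3" for j
      unfolding i(2) pt_inj using node_inj[OF that i(1), of c] by auto
    have "chart c p \<in> control_volume N z \<longleftrightarrow> p \<in> ref_part i"
      unfolding control_volume_chart[OF c p] using inj i by blast
    moreover have "(\<Sum>j<3. if z = pt (node c j) then indicator (ref_part j) p else 0 :: real)
        = (\<Sum>j<3. if j = i then indicator (ref_part j) p else 0)"
      by (intro sum.cong refl) (simp add: inj)
    ultimately show ?thesis using i(1) by (simp add: indicator_def)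
  next
    case False
    then have "chart c p \<notin> control_volume N z" unfolding control_volume_chart[OF c p] by blast
    then show ?thesis using False by (simp add: sum.neutral)
  qed
  have "J_h N g (chart c p) = (\<Sum>z\<in>interior_vertices N. \<Sum>i<3.
      if z = pt (node c i) then g z * indicator (ref_part i) p else 0)"
    unfolding J_h_def ind by (simp add: sum_distrib_left if_distrib cong: if_cong)
  also have "\<dots> = (\<Sum>i<3. \<Sum>z\<in>interior_vertices N.
      if z = pt (node c i) then g z * indicator (ref_part i) p else 0)"
    by (rule sum.swap)
  also have "\<dots> = (\<Sum>i<3. val g c i * indicator (ref_part i) p)"
  proof (rule sum.cong[OF refl])
    fix i :: nat
    show "(\<Sum>z\<in>interior_vertices N. if z = pt (node c i) then g z * indicator (ref_part i) p else 0)
        = val g c i * indicator (ref_part i) p"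
    proof (cases "pt (node c i) \<in> interior_vertices N")
      case False
      then have "pt (node c i) \<notin> Omega"
        using pt_in_Omega[OF node_range[OF c], of i] interior_vertices_eq by (metis imageI)
      then have "val g c i = 0" using S_h_zero[OF g] by blast
      then show ?thesis by (simp add: sum.neutral)
    qed (simp add: finite_interior_vertices)
  qed
  finally show ?thesis .
qed

lemma lumped_cells:
  assumes f: "f \<in> S_h N" and g: "g \<in> S_h N"
  shows "L2_inner f (J_h N g) = (\<Sum>c\<in>cells. 2 * area c *
    (\<Sum>i<3. \<Sum>j<3. val f c j * val g c i * (if i = j then 22 / 216 else 7 / 216)))"
proof -
  define k where "k c p = (\<Sum>i<3. \<Sum>j<3. val f c j * val g c i *
    (indicator (ref_part i) p * bary j p))" for c p
  have "L2_inner f (J_h N g) = (\<Sum>c\<in>cells. \<bar>legx c * legy c\<bar> * (\<integral>p. k c p \<partial>lborel))"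
    unfolding L2_inner_def
  proof (rule integral_over_cells)
    show "integrable lborel (k c)" for c
      unfolding k_def by (intro Bochner_Integration.integrable_sum integrable_mult_right) (auto intro!: bary_part_integral(1))
    show "k c p = 0" if "p \<notin> ref_tri" for c p using that by (simp add: k_def ref_part_def)
    fix c p assume c: "c \<in> cells" and pi: "p \<in> ref_int"
    then have p: "p \<in> ref_tri" by (simp add: ref_int_subset)
    show "f (chart c p) * J_h N g (chart c p) = k c p"
      unfolding S_h_value[OF f c p] J_h_chart[OF g c pi] k_def
      by (subst mult.commute, unfold sum_product) (intro sum.cong refl, simp)
  qed
  moreover have "(\<integral>p. k c p \<partial>lborel) = (\<Sum>i<3. \<Sum>j<3. val f c j * val g c i * (if i = j then 22 / 216 else 7 / 216))" for c
    unfolding k_def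
    by (subst integral_double_sum) (simp_all add: bary_part_integral cong: if_cong)
  ultimately show ?thesis by (simp add: area_def)
qed

lemma grad_chart:
  assumes f: "f \<in> S_h N" and c: "c \<in> cells" and p: "p \<in> ref_int"
  shows "grad f (chart c p) = ((val f c 1 - val f c 0) / legx c,
    (val f c 2 - val f c 0) / legy c)"
proof (rule grad_eqI)
  define v where "v i = val f c i" for i
  define D where "D = ((v 1 - v 0) / legx c, (v 2 - v 0) / legy c)"
  define g where "g z = v 0 + inner (z - pt (node c 0)) D" for z
  define U where "U = {z. unchart c z \<in> ref_int}"
  have "U = {z. 0 < bary 0 (unchart c z)} \<inter> {z. 0 < bary 1 (unchart c z)} \<inter> {z. 0 < bary 2 (unchart c z)}"
    unfolding U_def ref_int_def all_lt_3 by auto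
  moreover have "continuous_on UNIV (\<lambda>z. bary i (unchart c z))" for i
    unfolding unchart_def
    by (rule continuous_on_compose2[OF continuous_on_bary[of UNIV]]) (auto intro!: continuous_intros simp: leg_nonzero)
  ultimately have U: "open U" by (auto intro!: open_Int open_Collect_less continuous_intros)
  have g: "GDERIV g (chart c p) :> D"
    unfolding gderiv_def g_def by (auto intro!: derivative_eq_intros)
  have fg: "g z = f z" if "z \<in> U" for z
  proof -
    define q where "q = unchart c z"
    have q: "q \<in> ref_tri" "z = chart c q" using that by (auto simp: U_def q_def ref_int_subset)
    have "inner (chart c q - pt (node c 0)) D = fst q * (v 1 - v 0) + snd q * (v 2 - v 0)"
      using leg_nonzero[of c] by (simp add: chart_def D_def inner_prod_def)
    then show ?thesis unfolding q(2) S_h_value[OF f c q(1)] sum_lt_3 g_def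
      by (simp add: v_def[symmetric] bary_def algebra_simps)
  qed
  show "GDERIV f (chart c p) :> ((val f c 1 - val f c 0) / legx c,
    (val f c 2 - val f c 0) / legy c)"
    using has_derivative_transform_within_open[OF g[unfolded gderiv_def] U, of f] fg p
    unfolding gderiv_def D_def v_def by (simp add: U_def)
qed

lemma grad_inner_cells:
  assumes f: "f \<in> S_h N" and g: "g \<in> S_h N"
  shows "grad_inner f g = (\<Sum>c\<in>cells. area c *
    ((val f c 1 - val f c 0) * (val g c 1 - val g c 0) / (legx c)\<^sup>2
      + (val f c 2 - val f c 0) * (val g c 2 - val g c 0) / (legy c)\<^sup>2))"
proof -
  define s where "s c = (val f c 1 - val f c 0) * (val g c 1 - val g c 0) / (legx c)\<^sup>2
      + (val f c 2 - val f c 0) * (val g c 2 - val g c 0) / (legy c)\<^sup>2" for c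
  have one: "integrable lborel (\<lambda>p. indicator ref_tri p * r)" "(\<integral>p. indicator ref_tri p * r \<partial>lborel) = r / 2" for r :: real
    using ref_tri_quadratic[of r 0 0 0 0 0] by simp_all
  have "grad_inner f g = (\<Sum>c\<in>cells. \<bar>legx c * legy c\<bar> * (\<integral>p. indicator ref_tri p * s c \<partial>lborel))"
    unfolding grad_inner_def
  proof (rule integral_over_cells)
    fix c p assume c: "c \<in> cells" and p: "p \<in> ref_int"
    show "inner (grad f (chart c p)) (grad g (chart c p)) = indicator ref_tri p * s c"
      unfolding grad_chart[OF f c p] grad_chart[OF g c p] s_def using ref_int_subset[OF p]
      by (simp add: inner_prod_def power2_eq_square)
  qed (rule one(1), simp)
  then show ?thesis unfolding one by (simp add: s_def area_def)
qed

end

section \<open>The discrete operators\<close>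

context mesh
begin

lemma area_pos: "0 < area c"
  using leg_nonzero[of c] by (simp add: area_def)

lemma lumped_inner_cells:
  assumes "f \<in> S_h N" "g \<in> S_h N"
  shows "lumped_inner N f g = (\<Sum>c\<in>cells. area c / 108 *
    (15 * (\<Sum>i<3. val f c i * val g c i) + 7 * (\<Sum>i<3. val f c i) * (\<Sum>i<3. val g c i)))"
  unfolding lumped_inner_def lumped_cells[OF assms]
  by (intro sum.cong refl) (simp add: sum_lt_3 algebra_simps)

lemma L2_inner_cells':
  assumes "f \<in> S_h N" "g \<in> S_h N"
  shows "L2_inner f g = (\<Sum>c\<in>cells. area c / 12 *
    ((\<Sum>i<3. val f c i * val g c i) + (\<Sum>i<3. val f c i) * (\<Sum>i<3. val g c i)))"
  unfolding L2_inner_cells[OF assms]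
  by (intro sum.cong refl) (simp add: sum_lt_3 algebra_simps)

definition quad_error :: "(real \<times> real \<Rightarrow> real) \<Rightarrow> (real \<times> real \<Rightarrow> real) \<Rightarrow> real" where
  "quad_error f g = L2_inner f (J_h N g) - L2_inner f g"

text \<open>The local coefficients of the lumped product are \<open>15 / 108\<close> and \<open>7 / 108\<close>, those of the exact one
  \<open>9 / 108\<close> each. Their difference annihilates constants, so it is a form in the differences.\<close>

lemma quad_error_cells:
  assumes "f \<in> S_h N" "g \<in> S_h N"
  shows "quad_error f g = (\<Sum>c\<in>cells. area c / 54 *
    ((val f c 1 - val f c 0) * (val g c 1 - val g c 0) + (val f c 2 - val f c 0) * (val g c 2 - val g c 0)
      + (val f c 1 - val f c 2) * (val g c 1 - val g c 2)))"
  using lumped_inner_cells[OF assms]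
  unfolding quad_error_def L2_inner_cells'[OF assms] lumped_inner_def
  by (simp only: sum_subtractf[symmetric]) (intro sum.cong refl, simp add: sum_lt_3 algebra_simps)

lemma symmetric_form_cellsI:
  assumes b: "\<And>f g. f \<in> S_h N \<Longrightarrow> g \<in> S_h N \<Longrightarrow> b f g = (\<Sum>c\<in>cells. B c (val f c) (val g c))"
    and s: "\<And>c u v. B c u v = B c v u"
    and l: "\<And>c u v w r. B c (\<lambda>i. u i + r * v i) w = B c u w + r * B c v w"
  shows "symmetric_form_on (S_h N) b"
  unfolding symmetric_form_on_def linear_on_def
proof (intro conjI ballI allI)
  fix f g assume "f \<in> S_h N" "g \<in> S_h N"
  then show "b f g = b g f" using b s by simp
next
  fix k f g r assume m: "k \<in> S_h N" "f \<in> S_h N" "g \<in> S_h N"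
  show "b (\<lambda>p. f p + r * g p) k = b f k + r * b g k"
    unfolding b[OF S_h_comb[OF m(2,3)] m(1)] b[OF m(2,1)] b[OF m(3,1)]
    by (simp add: l sum.distrib sum_distrib_left)
qed

lemma lumped_symmetric: "symmetric_form_on (S_h N) (lumped_inner N)"
  by (rule symmetric_form_cellsI[OF lumped_inner_cells]) (simp_all add: sum_lt_3 algebra_simps)

lemma L2_symmetric: "symmetric_form_on (S_h N) L2_inner"
  by (rule symmetric_form_cellsI[OF L2_inner_cells']) (simp_all add: sum_lt_3 algebra_simps)

lemma grad_inner_symmetric: "symmetric_form_on (S_h N) grad_inner"
proof (rule symmetric_form_cellsI[OF grad_inner_cells])
  show "area c * ((u 1 - u 0) * (v 1 - v 0) / (legx c)\<^sup>2 + (u 2 - u 0) * (v 2 - v 0) / (legy c)\<^sup>2)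
      = area c * ((v 1 - v 0) * (u 1 - u 0) / (legx c)\<^sup>2 + (v 2 - v 0) * (u 2 - u 0) / (legy c)\<^sup>2)" for c u v
    by (simp add: mult.commute)
  show "area c * ((u 1 + r * v 1 - (u 0 + r * v 0)) * (w 1 - w 0) / (legx c)\<^sup>2
        + (u 2 + r * v 2 - (u 0 + r * v 0)) * (w 2 - w 0) / (legy c)\<^sup>2)
      = area c * ((u 1 - u 0) * (w 1 - w 0) / (legx c)\<^sup>2 + (u 2 - u 0) * (w 2 - w 0) / (legy c)\<^sup>2)
        + r * (area c * ((v 1 - v 0) * (w 1 - w 0) / (legx c)\<^sup>2 + (v 2 - v 0) * (w 2 - w 0) / (legy c)\<^sup>2))" for c u v w r
    using leg_nonzero[of c] by (simp add: field_simps)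
qed

lemma quad_error_linear:
  assumes "f \<in> S_h N" shows "linear_on (S_h N) (quad_error f)"
  using form_linear2[OF lumped_symmetric assms] form_linear2[OF L2_symmetric assms]
  unfolding quad_error_def linear_on_def lumped_inner_def by (simp add: algebra_simps)

lemma quad_error_linear1:
  assumes "g \<in> S_h N" shows "linear_on (S_h N) (\<lambda>f. quad_error f g)"
  using form_linear1[OF lumped_symmetric assms] form_linear1[OF L2_symmetric assms]
  unfolding quad_error_def linear_on_def lumped_inner_def by (simp add: algebra_simps)

lemma lumped_lower_bound:
  assumes f: "f \<in> S_h N"
  shows "(\<Sum>c\<in>cells. area c * 15 / 108 * (\<Sum>i<3. (val f c i)\<^sup>2)) \<le> lumped_inner N f f"
  unfolding lumped_inner_cells[OF f f]
proof (rule sum_mono)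
  fix c
  have "area c / 108 * (15 * (\<Sum>i<3. val f c i * val f c i)) \<le> area c / 108 *
      (15 * (\<Sum>i<3. val f c i * val f c i) + 7 * ((\<Sum>i<3. val f c i) * (\<Sum>i<3. val f c i)))"
    using area_pos[of c] by (intro mult_left_mono) auto
  then show "area c * 15 / 108 * (\<Sum>i<3. (val f c i)\<^sup>2) \<le> area c / 108 *
      (15 * (\<Sum>i<3. val f c i * val f c i) + 7 * (\<Sum>i<3. val f c i) * (\<Sum>i<3. val f c i))"
    by (simp add: power2_eq_square mult.assoc)
qed

lemma inner_node_in_cell:
  assumes "n \<in> inner_nodes" shows "(fst n, snd n, False) \<in> cells" "node (fst n, snd n, False) 0 = n"
  using assms by (auto simp: inner_nodes_def cells_def)

lemma lumped_inner_product: "inner_product_on (S_h N) (lumped_inner N)"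
  unfolding inner_product_on_def
proof (intro conjI ballI impI)
  fix f assume f: "f \<in> S_h N"
  have nn: "0 \<le> area c * 15 / 108 * (\<Sum>i<3. (val f c i)\<^sup>2)" for c
    using area_pos[of c] by (simp add: sum_nonneg)
  have s: "0 \<le> (\<Sum>c\<in>cells. area c * 15 / 108 * (\<Sum>i<3. (val f c i)\<^sup>2))" using nn by (simp add: sum_nonneg)
  then show "0 \<le> lumped_inner N f f" using lumped_lower_bound[OF f] by linarith
  assume "lumped_inner N f f = 0"
  then have "(\<Sum>c\<in>cells. area c * 15 / 108 * (\<Sum>i<3. (val f c i)\<^sup>2)) = 0"
    using s lumped_lower_bound[OF f] by linarith
  then have z: "area c * 15 / 108 * (\<Sum>i<3. (val f c i)\<^sup>2) = 0" if "c \<in> cells" for c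
    using sum_nonneg_eq_0_iff[OF finite_cells, of "\<lambda>c. area c * 15 / 108 * (\<Sum>i<3. (val f c i)\<^sup>2)"] nn that
    by blast
  show "f = (\<lambda>p. 0)"
  proof (rule S_h_eqI[OF f S_h_null])
    fix n assume n: "n \<in> inner_nodes"
    note c = inner_node_in_cell[OF n]
    have "(\<Sum>i<3. (val f (fst n, snd n, False) i)\<^sup>2) = 0"
      using z[OF c(1)] area_pos[of "(fst n, snd n, False)"] by simp
    then have "(val f (fst n, snd n, False) 0)\<^sup>2 = 0"
      using sum_nonneg_eq_0_iff[of "{..<3::nat}" "\<lambda>i. (val f (fst n, snd n, False) i)\<^sup>2"]
      by (metis finite_lessThan lessThan_iff zero_le_power2 zero_less_numeral)
    then show "f (pt n) = 0" using c(2) by simp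
  qed
qed (rule lumped_symmetric)

lemma grad_inner_product: "inner_product_on (S_h N) grad_inner"
  unfolding inner_product_on_def
proof (intro conjI ballI impI)
  fix f assume f: "f \<in> S_h N"
  define T where "T c = area c * ((val f c 1 - val f c 0) * (val f c 1 - val f c 0) / (legx c)\<^sup>2
      + (val f c 2 - val f c 0) * (val f c 2 - val f c 0) / (legy c)\<^sup>2)" for c
  have nn: "0 \<le> T c" for c unfolding T_def using area_pos[of c] by simp
  have e: "grad_inner f f = (\<Sum>c\<in>cells. T c)" unfolding grad_inner_cells[OF f f] T_def ..
  show "0 \<le> grad_inner f f" unfolding e using nn by (simp add: sum_nonneg)
  assume "grad_inner f f = 0"
  then have z: "T c = 0" if "c \<in> cells" for c
    unfolding e using sum_nonneg_eq_0_iff[OF finite_cells, of T] nn that by simp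
  have d: "val f c 1 = val f c 0" if "c \<in> cells" for c
  proof -
    have "(val f c 1 - val f c 0) * (val f c 1 - val f c 0) / (legx c)\<^sup>2
      + (val f c 2 - val f c 0) * (val f c 2 - val f c 0) / (legy c)\<^sup>2 = 0"
      using z[OF that] area_pos[of c] by (simp add: T_def)
    moreover have "0 \<le> (val f c 1 - val f c 0) * (val f c 1 - val f c 0) / (legx c)\<^sup>2"
      "0 \<le> (val f c 2 - val f c 0) * (val f c 2 - val f c 0) / (legy c)\<^sup>2" by simp_all
    ultimately have "(val f c 1 - val f c 0) * (val f c 1 - val f c 0) / (legx c)\<^sup>2 = 0" by linarith
    then show ?thesis using leg_nonzero[of c] by simp
  qed
  show "f = (\<lambda>p. 0)"
  proof (rule S_h_eqI[OF f S_h_null])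
    fix n assume n: "n \<in> inner_nodes"
    have "f (pt (j, m)) = 0" if "j \<le> N" "m < M" for j m
      using that
    proof (induction j)
      case 0
      have "pt (0, m) \<notin> Omega" by (simp add: pt_def Omega_def X_0)
      then show ?case using S_h_zero[OF f] by blast
    next
      case (Suc j)
      then have "(j, m, False) \<in> cells" by (simp add: cells_def)
      from d[OF this] show ?case using Suc by simp
    qed
    then show "f (pt n) = 0" using n by (cases n) (auto simp: inner_nodes_def)
  qed
qed (rule grad_inner_symmetric)

lemma Laplace_h_unique:
  assumes f: "f \<in> S_h N"
  shows "\<exists>!w. w \<in> S_h N \<and> (\<forall>\<eta>\<in>S_h N. - lumped_inner N w \<eta> = grad_inner f \<eta>)"
proof -
  have "linear_on (S_h N) (\<lambda>\<eta>. - grad_inner f \<eta>)"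
    using form_linear2[OF grad_inner_symmetric f] by (simp add: linear_on_def)
  from riesz_unique[OF lumped_inner_product this] show ?thesis
    by (simp only: minus_equation_iff[of "lumped_inner N _ _"] eq_commute[of "- grad_inner _ _"])
qed

lemma Laplace_h_mem: "f \<in> S_h N \<Longrightarrow> Laplace_h N f \<in> S_h N"
  and Laplace_h_form: "f \<in> S_h N \<Longrightarrow> \<eta> \<in> S_h N \<Longrightarrow> - lumped_inner N (Laplace_h N f) \<eta> = grad_inner f \<eta>"
  using theI'[OF Laplace_h_unique] unfolding Laplace_h_def by blast+

lemma Q_h_unique:
  assumes f: "f \<in> S_h N"
  shows "\<exists>!w. w \<in> S_h N \<and> (\<forall>\<eta>\<in>S_h N. grad_inner w \<eta> = L2_inner f (J_h N \<eta>) - L2_inner f \<eta>)"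
  using riesz_unique[OF grad_inner_product quad_error_linear[OF f]] unfolding quad_error_def .

lemma Q_h_mem: "f \<in> S_h N \<Longrightarrow> Q_h N f \<in> S_h N"
  and Q_h_form: "f \<in> S_h N \<Longrightarrow> \<eta> \<in> S_h N \<Longrightarrow> grad_inner (Q_h N f) \<eta> = quad_error f \<eta>"
  using theI'[OF Q_h_unique] unfolding Q_h_def quad_error_def by blast+

sublocale nodal_operator "S_h N" "interior_vertices N" "nodal_basis N" "Laplace_h N"
proof
  fix f g c assume f: "f \<in> S_h N" and g: "g \<in> S_h N"
  note fg = S_h_comb[OF f g, of c] S_h_comb[OF Laplace_h_mem[OF f] Laplace_h_mem[OF g], of c]
  have "- lumped_inner N (\<lambda>p. Laplace_h N f p + c * Laplace_h N g p) \<eta> = grad_inner (\<lambda>p. f p + c * g p) \<eta>"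
    if \<eta>: "\<eta> \<in> S_h N" for \<eta>
    using linear_onD[OF form_linear1[OF lumped_symmetric \<eta>] Laplace_h_mem[OF f] Laplace_h_mem[OF g], of c]
      linear_onD[OF form_linear1[OF grad_inner_symmetric \<eta>] f g, of c]
    by (simp add: Laplace_h_form[OF f \<eta>, symmetric] Laplace_h_form[OF g \<eta>, symmetric])
  then show "Laplace_h N (\<lambda>p. f p + c * g p) = (\<lambda>p. Laplace_h N f p + c * Laplace_h N g p)"
    unfolding Laplace_h_def[of N "\<lambda>p. f p + c * g p"]
    using fg Laplace_h_unique[OF fg(1)] by (intro the1_equality) auto
qed (rule Laplace_h_mem)

lemma E_h_eq: "E_h N t f = expD t f"
  by (simp add: E_h_def expD_def)

lemma lumped_le_L2:
  assumes f: "f \<in> S_h N" shows "lumped_inner N f f \<le> 2 * L2_inner f f"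
  unfolding lumped_inner_cells[OF f f] L2_inner_cells'[OF f f] sum_distrib_left[of 2]
proof (rule sum_mono)
  fix c
  define s where "s = (\<Sum>i<3. val f c i * val f c i)"
  define r where "r = (\<Sum>i<3. val f c i) * (\<Sum>i<3. val f c i)"
  have "0 \<le> s" "0 \<le> r" unfolding s_def r_def by (auto intro: sum_nonneg)
  then have "area c * (15 / 108 * s + 7 / 108 * r) \<le> area c * (1 / 6 * s + 1 / 6 * r)"
    using area_pos[of c] by (intro mult_left_mono) auto
  then show "area c / 108 * (15 * (\<Sum>i<3. val f c i * val f c i) + 7 * (\<Sum>i<3. val f c i) * (\<Sum>i<3. val f c i))
     \<le> 2 * (area c / 12 * ((\<Sum>i<3. val f c i * val f c i) + (\<Sum>i<3. val f c i) * (\<Sum>i<3. val f c i)))"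
    unfolding s_def[symmetric] mult.assoc r_def[symmetric] by (simp add: algebra_simps)
qed

lemma sum_cells: "(\<Sum>c\<in>cells. F c) = (\<Sum>j<N. \<Sum>m<M. F (j, m, False) + F (j, m, True))"
proof -
  have "(\<Sum>c\<in>cells. F c) = (\<Sum>j<N. \<Sum>q\<in>{..<M} \<times> UNIV. F (j, q))"
    unfolding cells_def by (simp add: sum.cartesian_product)
  also have "\<dots> = (\<Sum>j<N. \<Sum>m<M. \<Sum>b\<in>UNIV. F (j, m, b))"
    by (intro sum.cong refl) (simp add: sum.cartesian_product)
  finally show ?thesis by (simp add: UNIV_bool add.commute)
qed

lemma area_eq: "area (j, m, b) = wid j * h / 2"
  using wid_pos[of j] h_pos by (simp add: area_def abs_mult)

lemma sum_wid: "(\<Sum>j<n. wid j) = X n"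
  by (induction n) (auto simp: X_Suc X_0)

lemma total_area: "(\<Sum>c\<in>cells. area c) = 1"
proof -
  have "(\<Sum>c\<in>cells. area c) = (\<Sum>j<N. wid j * (real M * h))"
    unfolding sum_cells by (intro sum.cong refl) (simp add: area_eq)
  also have "\<dots> = X N * Y M" unfolding sum_distrib_right[symmetric] sum_wid by (simp add: mesh_y_def)
  finally show ?thesis by (simp add: X_N Y_M)
qed

text \<open>Along an edge, \<^term>\<open>v\<close> changes by at most 1, while the change of \<open>q = Q_h N v\<close> is of the order of
  \<^term>\<open>h\<close> times its gradient. Young's inequality, weighted by \<^term>\<open>h\<close>, therefore lets half of the energy of
  \<open>q\<close> absorb its own contribution to \<open>grad_inner q q = quad_error v q\<close>.\<close>

lemma Q_h_energy:
  assumes v: "v \<in> S_h N" and v01: "\<And>n. n \<in> {..N} \<times> {..M} \<Longrightarrow> 0 \<le> v (pt n) \<and> v (pt n) \<le> 1"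
  shows "grad_inner (Q_h N v) (Q_h N v) \<le> h\<^sup>2"
proof -
  define q where "q = Q_h N v"
  let ?A = "\<lambda>c. area c * ((val q c 1 - val q c 0) * (val q c 1 - val q c 0) / (legx c)\<^sup>2
      + (val q c 2 - val q c 0) * (val q c 2 - val q c 0) / (legy c)\<^sup>2)"
  have q: "q \<in> S_h N" unfolding q_def by (rule Q_h_mem[OF v])
  have young: "x * y \<le> h\<^sup>2 + y\<^sup>2 / (4 * h\<^sup>2)" if "\<bar>x\<bar> \<le> 1" for x y :: real
  proof -
    have "0 \<le> (h * \<bar>x\<bar> - \<bar>y\<bar> / (2 * h))\<^sup>2" by simp
    also have "\<dots> = h\<^sup>2 * x\<^sup>2 - \<bar>x\<bar> * \<bar>y\<bar> + y\<^sup>2 / (4 * h\<^sup>2)"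
      using h_pos by (simp add: power2_eq_square field_simps)
    finally have "\<bar>x * y\<bar> \<le> h\<^sup>2 * x\<^sup>2 + y\<^sup>2 / (4 * h\<^sup>2)" by (simp add: abs_mult)
    moreover have "x\<^sup>2 \<le> 1" using that by (simp add: abs_square_le_1)
    then have "h\<^sup>2 * x\<^sup>2 \<le> h\<^sup>2" by (simp add: mult_left_le)
    ultimately show ?thesis by linarith
  qed
  have cell: "area c / 54 * ((val v c 1 - val v c 0) * (val q c 1 - val q c 0)
      + (val v c 2 - val v c 0) * (val q c 2 - val q c 0) + (val v c 1 - val v c 2) * (val q c 1 - val q c 2))
    \<le> area c * (h\<^sup>2 / 2) + 1 / 2 * ?A c"
    if c: "c \<in> cells" for c
  proof -
    define x y where "x = val q c 1 - val q c 0" and "y = val q c 2 - val q c 0"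
    let ?D = "(val v c 1 - val v c 0) * x + (val v c 2 - val v c 0) * y + (val v c 1 - val v c 2) * (x - y)"
    have xy: "val q c 1 - val q c 2 = x - y" by (simp add: x_def y_def)
    have b: "\<bar>val v c i - val v c j\<bar> \<le> 1" for i j
      using v01[OF node_range[OF c, of i]] v01[OF node_range[OF c, of j]] by linarith
    have leg: "(legx c)\<^sup>2 \<le> h\<^sup>2" "(legy c)\<^sup>2 \<le> h\<^sup>2"
    proof -
      obtain j m f where "c = (j, m, f)" by (metis surj_pair)
      then show "(legx c)\<^sup>2 \<le> h\<^sup>2" "(legy c)\<^sup>2 \<le> h\<^sup>2" using wid_le[of j] wid_pos[of j] h_pos by (auto intro!: power_mono)
    qed
    have sx: "x\<^sup>2 / h\<^sup>2 \<le> x * x / (legx c)\<^sup>2" "y\<^sup>2 / h\<^sup>2 \<le> y * y / (legy c)\<^sup>2"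
      using leg leg_nonzero[of c] h_pos by (auto simp: power2_eq_square[of x] power2_eq_square[of y] intro!: divide_left_mono)
    have "(x - y)\<^sup>2 \<le> 2 * x\<^sup>2 + 2 * y\<^sup>2"
      using zero_le_power2[of "x + y"] by (simp add: power2_eq_square algebra_simps)
    then have "(x - y)\<^sup>2 / (4 * h\<^sup>2) \<le> (2 * x\<^sup>2 + 2 * y\<^sup>2) / (4 * h\<^sup>2)" by (intro divide_right_mono) auto
    then have "?D
        \<le> 3 * h\<^sup>2 + 3 / 4 * (x\<^sup>2 / h\<^sup>2) + 3 / 4 * (y\<^sup>2 / h\<^sup>2)"
      using young[OF b, of 1 0 x] young[OF b, of 2 0 y] young[OF b, of 1 2 "x - y"]
      by (simp add: add_divide_distrib)
    also have "\<dots> \<le> 54 * (h\<^sup>2 / 2 + 1 / 2 * (x * x / (legx c)\<^sup>2 + y * y / (legy c)\<^sup>2))"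
    proof -
      have "3 * e + 3 / 4 * A + 3 / 4 * B \<le> 54 * (e / 2 + 1 / 2 * (A' + B'))"
        if "0 \<le> e" "0 \<le> A" "A \<le> A'" "0 \<le> B" "B \<le> B'" for e A A' B B' :: real
        unfolding distrib_left using that by (simp add: field_simps)
      then show ?thesis using sx by (meson zero_le_power2 divide_nonneg_nonneg)
    qed
    finally have *: "?D
      \<le> 54 * (h\<^sup>2 / 2 + 1 / 2 * (x * x / (legx c)\<^sup>2 + y * y / (legy c)\<^sup>2))" .
    have "0 \<le> area c / 54" using area_pos[of c] by simp
    from mult_left_mono[OF * this] show ?thesis
      unfolding xy x_def[symmetric] y_def[symmetric] by (simp add: algebra_simps)
  qed
  have "grad_inner q q = quad_error v q" using Q_h_form[OF v q] by (simp add: q_def)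
  also have "\<dots> \<le> (\<Sum>c\<in>cells. area c * (h\<^sup>2 / 2) + 1 / 2 * ?A c)"
    unfolding quad_error_cells[OF v q] by (rule sum_mono) (rule cell)
  also have "\<dots> = (\<Sum>c\<in>cells. area c) * (h\<^sup>2 / 2) + 1 / 2 * grad_inner q q"
    unfolding grad_inner_cells[OF q q] by (simp only: sum.distrib sum_distrib_left sum_distrib_right)
  finally show ?thesis by (simp add: total_area q_def)
qed

end

section \<open>Consistency of the two forms\<close>

lemma sin_taylor:
  "\<bar>sin (x + t) - (\<Sum>m<n. sin (x + real m * pi / 2) / fact m * t ^ m)\<bar> \<le> \<bar>t\<bar> ^ n / fact n"
proof -
  define d where "d m t = sin (x + t + real m * pi / 2)" for m t
  have "(d m has_real_derivative d (Suc m) t) (at t)" for m t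
  proof -
    have "d (Suc m) t = sin ((x + t + real m * pi / 2) + pi / 2)"
      by (simp add: d_def distrib_right add_divide_distrib add_ac)
    also have "\<dots> = cos (x + t + real m * pi / 2)" by (simp add: sin_add)
    finally show ?thesis unfolding d_def by (auto intro!: derivative_eq_intros)
  qed
  then obtain s where "d 0 t = (\<Sum>m<n. d m 0 / fact m * t ^ m) + d n s / fact n * t ^ n"
    using Maclaurin_all_le[of d "d 0" t n] by auto
  then have "sin (x + t) - (\<Sum>m<n. sin (x + real m * pi / 2) / fact m * t ^ m) = d n s / fact n * t ^ n"
    by (simp add: d_def)
  moreover have "\<bar>d n s\<bar> * (\<bar>t\<bar> ^ n / fact n) \<le> 1 * (\<bar>t\<bar> ^ n / fact n)"
    by (rule mult_right_mono) (auto simp: d_def)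
  ultimately show ?thesis by (simp add: abs_mult power_abs)
qed

lemma sin_taylor_1: "\<bar>sin (x + t) - sin x\<bar> \<le> \<bar>t :: real\<bar>"
  using sin_taylor[of x t 1] by simp

lemma sin_taylor_2: "\<bar>sin (x + t) - sin x - t * cos x\<bar> \<le> t\<^sup>2 / 2" for x t :: real
  using sin_taylor[of x t 2] by (simp add: numeral_2_eq_2 sin_add algebra_simps power2_eq_square)

lemma sin_taylor_3: "\<bar>sin (x + t) - sin x - t * cos x + t\<^sup>2 / 2 * sin x\<bar> \<le> \<bar>t\<bar> ^ 3 / 6" for x t :: real
proof -
  have "sin (x + 2 * pi / 2) = - sin x" by simp
  then have eq: "(\<Sum>m<3. sin (x + real m * pi / 2) / fact m * t ^ m) = sin x + t * cos x - t\<^sup>2 / 2 * sin x"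
    by (simp add: sum_lt_3 sin_add fact_numeral power2_eq_square)
  show ?thesis using sin_taylor[of x t 3, unfolded eq] by (simp add: fact_numeral algebra_simps)
qed

lemma sum_shift:
  fixes A :: "nat \<Rightarrow> real"
  assumes "A 0 = A n" shows "(\<Sum>j<n. A (Suc j)) = (\<Sum>j<n. A j)"
  using sum.lessThan_Suc_shift[of A n] sum.lessThan_Suc[of A n] assms by simp

lemma summation_by_parts:
  fixes d C :: "nat \<Rightarrow> real"
  assumes "C 0 = 0"
  shows "(\<Sum>j<n. d j * (C (Suc j) - C j)) = d n * C n - (\<Sum>j<n. C (Suc j) * (d (Suc j) - d j))"
  by (induction n) (auto simp: assms algebra_simps)

text \<open>In the two Taylor expansions about the middle point the first-order terms cancel, and the
  second-order terms give the weight in the statement. The third-order terms would cancel for equal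
  widths only, so the error is quadratic in the width.\<close>

lemma second_difference_sin:
  fixes x w :: "nat \<Rightarrow> real"
  assumes x: "\<And>j. x (Suc j) = x j + w j" and w: "\<And>j. 0 < w j" "\<And>j. w j \<le> e"
  defines "S \<equiv> \<lambda>j. sin (pi * x j)"
  shows "\<bar>(S (Suc (Suc j)) - S (Suc j)) / w (Suc j) - (S (Suc j) - S j) / w j
    + pi\<^sup>2 * ((w j + w (Suc j)) / 2 * S (Suc j))\<bar> \<le> pi ^ 3 * e\<^sup>2 / 3"
proof -
  define u c s where "u = pi * x (Suc j)" and "c = cos u" and "s = sin u"
  define b a where "b = w (Suc j)" and "a = w j"
  have ab: "0 < a" "0 < b" "a \<le> e" "b \<le> e" using w by (auto simp: a_def b_def)
  define R1 where "R1 = sin (u + pi * b) - s - pi * b * c + (pi * b)\<^sup>2 / 2 * s"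
  define R2 where "R2 = sin (u + - (pi * a)) - s - - (pi * a) * c + (- (pi * a))\<^sup>2 / 2 * s"
  have R: "\<bar>R1\<bar> \<le> (pi * b) ^ 3 / 6" "\<bar>R2\<bar> \<le> (pi * a) ^ 3 / 6"
    unfolding R1_def R2_def s_def c_def
    using sin_taylor_3[of u "pi * b"] sin_taylor_3[of u "- (pi * a)"] ab by (auto simp: abs_mult)
  have S: "S (Suc (Suc j)) = sin (u + pi * b)" "S (Suc j) = s" "S j = sin (u + - (pi * a))"
    using x[of j] x[of "Suc j"] by (simp_all add: S_def u_def s_def a_def b_def algebra_simps)
  have "(S (Suc (Suc j)) - S (Suc j)) / b - (S (Suc j) - S j) / a + pi\<^sup>2 * ((a + b) / 2 * S (Suc j)) = R1 / b + R2 / a"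
    unfolding S R1_def R2_def using ab by (simp add: field_simps power2_eq_square)
  moreover have "\<bar>r / l\<bar> \<le> pi ^ 3 * e\<^sup>2 / 6" if "\<bar>r\<bar> \<le> (pi * l) ^ 3 / 6" "0 < l" "l \<le> e" for r l
  proof -
    have "\<bar>r / l\<bar> = \<bar>r\<bar> / l" using that by simp
    also have "\<dots> \<le> ((pi * l) ^ 3 / 6) / l" using that by (intro divide_right_mono) auto
    also have "\<dots> = pi ^ 3 * l\<^sup>2 / 6" using that by (simp add: power3_eq_cube power2_eq_square)
    also have "\<dots> \<le> pi ^ 3 * e\<^sup>2 / 6" using that by (intro divide_right_mono mult_left_mono power_mono) auto
    finally show ?thesis .
  qed
  note this[OF R(1) ab(2,4)] this[OF R(2) ab(1,3)]
  ultimately show ?thesis unfolding a_def[symmetric] b_def[symmetric] by linarith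
qed

text \<open>Summation by parts puts the second difference on the sine. Per unit of length the error of
  \<open>second_difference_sin\<close> is then of first order.\<close>

lemma dirichlet_form_1d:
  fixes x w C :: "nat \<Rightarrow> real"
  assumes x: "\<And>j. x (Suc j) = x j + w j" and w: "\<And>j. 0 < w j" "\<And>j. w j \<le> e"
    and C: "C 0 = 0" "C n = 0"
  defines "S \<equiv> \<lambda>j. sin (pi * x j)"
  shows "\<bar>(\<Sum>j<n. (S (Suc j) - S j) * (C (Suc j) - C j) / w j)
      - pi\<^sup>2 * (\<Sum>j<n. w j / 2 * (S j * C j + S (Suc j) * C (Suc j)))\<bar>
    \<le> pi ^ 3 * e\<^sup>2 / 3 * (\<Sum>j<n. \<bar>C j\<bar>)"
proof -
  define d where "d j = (S (Suc j) - S j) / w j" for j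
  have a: "(\<Sum>j<n. (S (Suc j) - S j) * (C (Suc j) - C j) / w j) = - (\<Sum>j<n. C (Suc j) * (d (Suc j) - d j))"
    using summation_by_parts[of C d n, OF C(1)] C(2) by (simp add: d_def)
  have sh: "(\<Sum>j<n. w j / 2 * (S j * C j)) = (\<Sum>j<n. w (Suc j) / 2 * (S (Suc j) * C (Suc j)))"
    using sum_shift[of "\<lambda>j. w j / 2 * (S j * C j)" n] C by simp
  have b: "(\<Sum>j<n. w j / 2 * (S j * C j + S (Suc j) * C (Suc j)))
      = (\<Sum>j<n. C (Suc j) * ((w j + w (Suc j)) / 2 * S (Suc j)))"
    unfolding distrib_left[of "w _ / 2"] sum.distrib sh unfolding sum.distrib[symmetric]
    by (intro sum.cong refl) (simp add: field_simps)
  have "(\<Sum>j<n. (S (Suc j) - S j) * (C (Suc j) - C j) / w j)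
      - pi\<^sup>2 * (\<Sum>j<n. w j / 2 * (S j * C j + S (Suc j) * C (Suc j)))
      = - (\<Sum>j<n. C (Suc j) * (d (Suc j) - d j + pi\<^sup>2 * ((w j + w (Suc j)) / 2 * S (Suc j))))"
    unfolding a b by (simp add: sum_distrib_left sum.distrib[symmetric] algebra_simps)
  also have "\<bar>\<dots>\<bar> \<le> (\<Sum>j<n. \<bar>C (Suc j)\<bar> * (pi ^ 3 * e\<^sup>2 / 3))"
    unfolding abs_minus_cancel
  proof (intro order_trans[OF sum_abs] sum_mono)
    fix j
    show "\<bar>C (Suc j) * (d (Suc j) - d j + pi\<^sup>2 * ((w j + w (Suc j)) / 2 * S (Suc j)))\<bar> \<le> \<bar>C (Suc j)\<bar> * (pi ^ 3 * e\<^sup>2 / 3)"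
      unfolding abs_mult[of "C (Suc j)"] d_def S_def
      by (intro mult_left_mono second_difference_sin x w) auto
  qed
  also have "\<dots> = pi ^ 3 * e\<^sup>2 / 3 * (\<Sum>j<n. \<bar>C j\<bar>)"
    unfolding sum_distrib_right[symmetric] using sum_shift[of "\<lambda>j. \<bar>C j\<bar>" n] C by (simp add: mult.commute)
  finally show ?thesis .
qed

context mesh
begin

lemma basis_val:
  assumes "n \<in> inner_nodes" "n' \<in> {..N} \<times> {..M}"
  shows "nodal_basis N (pt n) (pt n') = (if n' = n then 1 else 0)"
  unfolding nodal_basis_eq[OF assms(1)] by (rule hat_pt[OF assms])

lemma phi1_pt: "phi1 (pt (j, m)) = 2 * sin (pi * X j) * sin (pi * Y m)"
  by (simp add: phi1_def pt_def)

definition phi_h :: "real \<times> real \<Rightarrow> real" where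
  "phi_h = (\<lambda>p. \<Sum>z\<in>interior_vertices N. phi1 z * nodal_basis N z p)"

lemma phi_h_mem: "phi_h \<in> S_h N"
  unfolding phi_h_def by (rule sum_mem[OF finite_nodes subset_refl])

lemma phi_h_val:
  assumes n: "n \<in> {..N} \<times> {..M}" shows "phi_h (pt n) = phi1 (pt n)"
proof (cases "n \<in> inner_nodes")
  case True
  have fin: "finite inner_nodes" by (simp add: inner_nodes_def)
  have "phi_h (pt n) = (\<Sum>n'\<in>inner_nodes. phi1 (pt n') * nodal_basis N (pt n') (pt n))"
    unfolding phi_h_def interior_vertices_eq by (subst sum.reindex) (auto simp: inj_on_def pt_inj)
  also have "\<dots> = (\<Sum>n'\<in>inner_nodes. if n = n' then phi1 (pt n') else 0)"
    by (intro sum.cong refl) (simp add: basis_val[OF _ n])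
  finally show ?thesis using fin True by simp
next
  case False
  then have "fst n = 0 \<or> fst n = N \<or> snd n = 0 \<or> snd n = M" using n by (auto simp: inner_nodes_def)
  then have "phi1 (pt n) = 0" by (cases n) (auto simp: phi1_pt X_0 X_N Y_0 Y_M)
  then show ?thesis using S_h_zero[OF phi_h_mem] pt_in_Omega[OF n] False by simp
qed

lemma boundary_val:
  assumes "f \<in> S_h N"
  shows "f (pt (0, m)) = 0" "f (pt (N, m)) = 0" "f (pt (j, 0)) = 0" "f (pt (j, M)) = 0"
  by (rule S_h_zero[OF assms], simp add: pt_def Omega_def X_0 X_N Y_0 Y_M)+

text \<open>A discrete \<open>L\<^sub>1\<close> norm, against which the consistency errors are of first order.\<close>

definition l1_mass :: "(real \<times> real \<Rightarrow> real) \<Rightarrow> real" where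
  "l1_mass f = (\<Sum>j<N. \<Sum>m<M. h\<^sup>2 * \<bar>f (pt (j, m))\<bar>)"

lemma sum_shift_column:
  assumes "\<And>m. A 0 m = (0 :: real)" "\<And>m. A N m = 0"
  shows "(\<Sum>j<N. \<Sum>m<M. A (Suc j) m) = (\<Sum>j<N. \<Sum>m<M. A j m)"
  by (rule sum_shift[of "\<lambda>j. \<Sum>m<M. A j m"]) (simp add: assms)

lemma sum_shift_row:
  assumes "\<And>j. A j 0 = (0 :: real)" "\<And>j. A j M = 0"
  shows "(\<Sum>j<N. \<Sum>m<M. A j (Suc m)) = (\<Sum>j<N. \<Sum>m<M. A j m)"
  by (intro sum.cong refl sum_shift) (simp add: assms)

lemma sum_abs_values_le_l1_mass:
  assumes f: "f \<in> S_h N"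
  shows "(\<Sum>c\<in>cells. area c * (\<Sum>i<3. \<bar>val f c i\<bar>)) \<le> 3 * l1_mass f"
proof -
  define A where "A j m = \<bar>f (pt (j, m))\<bar>" for j m
  note z = boundary_val[OF f]
  have s1: "(\<Sum>j<N. \<Sum>m<M. A (Suc j) m) = (\<Sum>j<N. \<Sum>m<M. A j m)"
    by (rule sum_shift_column) (simp_all add: A_def z)
  have s2: "(\<Sum>j<N. \<Sum>m<M. A j (Suc m)) = (\<Sum>j<N. \<Sum>m<M. A j m)"
    by (rule sum_shift_row) (simp_all add: A_def z)
  have s3: "(\<Sum>j<N. \<Sum>m<M. A (Suc j) (Suc m)) = (\<Sum>j<N. \<Sum>m<M. A j m)"
    using sum_shift_row[of "\<lambda>j m. A (Suc j) m"] s1 by (simp add: A_def z)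
  have "(\<Sum>c\<in>cells. area c * (\<Sum>i<3. \<bar>val f c i\<bar>)) = (\<Sum>j<N. \<Sum>m<M. wid j * h / 2 *
      (A j m + 2 * A (Suc j) m + 2 * A j (Suc m) + A (Suc j) (Suc m)))"
    unfolding sum_cells by (intro sum.cong refl) (simp add: area_eq sum_lt_3 A_def algebra_simps)
  also have "\<dots> \<le> (\<Sum>j<N. \<Sum>m<M. h\<^sup>2 / 2 * (A j m + 2 * A (Suc j) m + 2 * A j (Suc m) + A (Suc j) (Suc m)))"
    using wid_le h_pos by (intro sum_mono mult_right_mono) (auto simp: A_def power2_eq_square)
  also have "\<dots> = h\<^sup>2 / 2 * ((\<Sum>j<N. \<Sum>m<M. A j m) + 2 * (\<Sum>j<N. \<Sum>m<M. A (Suc j) m)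
      + 2 * (\<Sum>j<N. \<Sum>m<M. A j (Suc m)) + (\<Sum>j<N. \<Sum>m<M. A (Suc j) (Suc m)))"
    by (simp only: sum_distrib_left sum.distrib distrib_left)
  also have "\<dots> = 3 * l1_mass f" unfolding s1 s2 s3 by (simp add: l1_mass_def A_def sum_distrib_left[symmetric])
  finally show ?thesis .
qed

lemma phi_h_lipschitz:
  assumes c: "c \<in> cells" shows "\<bar>val phi_h c i - val phi_h c k\<bar> \<le> 4 * pi * h"
proof -
  obtain j m b where c': "c = (j, m, b)" by (metis surj_pair)
  have X: "\<bar>X (fst (node c i)) - X (fst (node c k))\<bar> \<le> h"
    using wid_le[of j] wid_pos[of j] by (auto simp: c' X_Suc)
  have Y: "\<bar>Y (snd (node c i)) - Y (snd (node c k))\<bar> \<le> h" using h_pos by (auto simp: c' Y_Suc)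
  define s t s' t' where "s = sin (pi * X (fst (node c i)))" and "t = sin (pi * Y (snd (node c i)))"
    and "s' = sin (pi * X (fst (node c k)))" and "t' = sin (pi * Y (snd (node c k)))"
  have lip: "\<bar>sin (pi * x) - sin (pi * y)\<bar> \<le> pi * h" if "\<bar>x - y\<bar> \<le> h" for x y
  proof -
    have "\<bar>sin (pi * x) - sin (pi * y)\<bar> \<le> \<bar>pi * (x - y)\<bar>"
      using sin_taylor_1[of "pi * y" "pi * (x - y)"] by (simp add: right_diff_distrib)
    also have "\<dots> = pi * \<bar>x - y\<bar>" by (simp add: abs_mult)
    also have "\<dots> \<le> pi * h" using that by simp
    finally show ?thesis .
  qed
  have v: "val phi_h c l = 2 * sin (pi * X (fst (node c l))) * sin (pi * Y (snd (node c l)))" for l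
    unfolding phi_h_val[OF node_range[OF c]] phi1_pt[symmetric] by simp
  have "\<bar>s - s'\<bar> * \<bar>t\<bar> \<le> (pi * h) * 1" using lip[OF X] h_pos by (intro mult_mono) (auto simp: s_def s'_def t_def)
  moreover have "\<bar>s'\<bar> * \<bar>t - t'\<bar> \<le> 1 * (pi * h)" using lip[OF Y] h_pos by (intro mult_mono) (auto simp: t_def s'_def t'_def)
  moreover have "s * t - s' * t' = (s - s') * t + s' * (t - t')" by (simp add: algebra_simps)
  then have "\<bar>s * t - s' * t'\<bar> \<le> \<bar>s - s'\<bar> * \<bar>t\<bar> + \<bar>s'\<bar> * \<bar>t - t'\<bar>"
    by (metis abs_mult abs_triangle_ineq)
  ultimately have "\<bar>2 * (s * t - s' * t')\<bar> \<le> 4 * pi * h" by (simp only: abs_mult) simp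
  then show ?thesis unfolding v s_def t_def s'_def t'_def by (simp add: algebra_simps)
qed

definition nodal_product :: "(real \<times> real \<Rightarrow> real) \<Rightarrow> (real \<times> real \<Rightarrow> real) \<Rightarrow> real" where
  "nodal_product f g = (\<Sum>c\<in>cells. area c / 3 * (\<Sum>i<3. val f c i * val g c i))"

text \<open>The exact weights of the lumped product spread each nodal value over its neighbours. As the
  interpolated eigenfunction is Lipschitz, replacing them by the vertex rule costs one order of
  \<^term>\<open>h\<close>.\<close>

lemma lumped_phi_h:
  assumes f: "f \<in> S_h N"
  shows "\<bar>lumped_inner N phi_h f - nodal_product phi_h f\<bar> \<le> 7 / 3 * pi * h * l1_mass f"
proof -
  have cell: "\<bar>area c / 108 * (15 * (\<Sum>i<3. val phi_h c i * val f c i) + 7 * (\<Sum>i<3. val phi_h c i) * (\<Sum>i<3. val f c i))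
      - area c / 3 * (\<Sum>i<3. val phi_h c i * val f c i)\<bar> \<le> 7 / 9 * pi * h * (area c * (\<Sum>i<3. \<bar>val f c i\<bar>))"
    if c: "c \<in> cells" for c
  proof -
    define D where "D i = (\<Sum>k<3. val phi_h c k - val phi_h c i)" for i
    have D: "\<bar>D i\<bar> \<le> 12 * pi * h" for i
    proof -
      have "\<bar>D i\<bar> \<le> (\<Sum>k<3::nat. 4 * pi * h)"
        unfolding D_def by (intro order_trans[OF sum_abs] sum_mono phi_h_lipschitz[OF c])
      then show ?thesis by simp
    qed
    have "area c / 108 * (15 * (\<Sum>i<3. val phi_h c i * val f c i) + 7 * (\<Sum>i<3. val phi_h c i) * (\<Sum>i<3. val f c i))
      - area c / 3 * (\<Sum>i<3. val phi_h c i * val f c i) = 7 / 108 * area c * (\<Sum>i<3. val f c i * D i)"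
      by (simp add: sum_lt_3 D_def algebra_simps)
    also have "\<bar>\<dots>\<bar> = 7 / 108 * area c * \<bar>\<Sum>i<3. val f c i * D i\<bar>" using area_pos[of c] by (simp add: abs_mult)
    also have "\<dots> \<le> 7 / 108 * area c * (\<Sum>i<3. \<bar>val f c i\<bar> * (12 * pi * h))"
      using area_pos[of c]
      by (intro mult_left_mono order_trans[OF sum_abs] sum_mono) (auto simp: abs_mult intro!: mult_left_mono D)
    also have "\<dots> = 7 / 9 * pi * h * (area c * (\<Sum>i<3. \<bar>val f c i\<bar>))"
      by (simp add: sum_lt_3 algebra_simps)
    finally show ?thesis .
  qed
  have "\<bar>lumped_inner N phi_h f - nodal_product phi_h f\<bar> \<le> (\<Sum>c\<in>cells. 7 / 9 * pi * h * (area c * (\<Sum>i<3. \<bar>val f c i\<bar>)))"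
    unfolding lumped_inner_cells[OF phi_h_mem f] nodal_product_def sum_subtractf[symmetric]
    by (intro order_trans[OF sum_abs] sum_mono cell)
  also have "\<dots> = 7 / 9 * pi * h * (\<Sum>c\<in>cells. area c * (\<Sum>i<3. \<bar>val f c i\<bar>))"
    by (simp add: sum_distrib_left)
  also have "\<dots> \<le> 7 / 9 * pi * h * (3 * l1_mass f)"
    using h_pos by (intro mult_left_mono sum_abs_values_le_l1_mass[OF f]) auto
  finally show ?thesis by simp
qed

text \<open>On right triangles the Dirichlet form has no coupling along the diagonals, so it splits into
  one-dimensional forms along the rows and the columns of the mesh. Each of the two families gives
  \<open>pi\<^sup>2\<close> times the vertex rule, by \<open>dirichlet_form_1d\<close>.\<close>

lemma grad_phi_h:
  assumes f: "f \<in> S_h N"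
  shows "\<bar>grad_inner phi_h f - 2 * pi\<^sup>2 * nodal_product phi_h f\<bar> \<le> 4 / 3 * pi ^ 3 * h * l1_mass f"
proof -
  define C where "C j m = f (pt (j, m))" for j m
  define S where "S j = sin (pi * X j)" for j
  define T where "T m = sin (pi * Y m)" for m
  note z = boundary_val[OF f, folded C_def]
  have G: "phi_h (pt (j, m)) = 2 * S j * T m" if "j \<le> N" "m \<le> M" for j m
    using that by (simp add: phi_h_val phi1_pt S_def T_def)
  define DX where "DX m = (\<Sum>j<N. (S (Suc j) - S j) * (C (Suc j) m - C j m) / wid j)" for m
  define LX where "LX m = (\<Sum>j<N. wid j / 2 * (S j * C j m + S (Suc j) * C (Suc j) m))" for m
  define DY where "DY j = (\<Sum>m<M. (T (Suc m) - T m) * (C j (Suc m) - C j m) / h)" for j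
  define LY where "LY j = (\<Sum>m<M. h / 2 * (T m * C j m + T (Suc m) * C j (Suc m)))" for j
  define e where "e = pi ^ 3 * h\<^sup>2 / 3"
  have dx: "\<bar>DX m - pi\<^sup>2 * LX m\<bar> \<le> e * (\<Sum>j<N. \<bar>C j m\<bar>)" for m
    unfolding DX_def LX_def e_def S_def
    by (rule dirichlet_form_1d[where x=X and w=wid]) (simp_all add: X_Suc wid_pos wid_le z)
  have dy: "\<bar>DY j - pi\<^sup>2 * LY j\<bar> \<le> e * (\<Sum>m<M. \<bar>C j m\<bar>)" for j
    unfolding DY_def LY_def e_def T_def
    by (rule dirichlet_form_1d[where x=Y and w="\<lambda>_. h"]) (simp_all add: Y_Suc h_pos z)
  have LY: "LY j = (\<Sum>m<M. h * (T m * C j m))" for j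
  proof -
    have "(\<Sum>m<M. h / 2 * (T (Suc m) * C j (Suc m))) = (\<Sum>m<M. h / 2 * (T m * C j m))"
      by (rule sum_shift[of "\<lambda>m. h / 2 * (T m * C j m)"]) (simp add: z)
    then show ?thesis unfolding LY_def by (simp add: distrib_left sum.distrib) (simp add: sum_distrib_left)
  qed
  define P where "P j m = S j * T m * C j m" for j m
  define B where "B = (\<Sum>j<N. \<Sum>m<M. wid j * h * (P j m + P (Suc j) m))"
  have Bx: "(\<Sum>m<M. 2 * h * T m * LX m) = B"
    unfolding B_def LX_def P_def sum_distrib_left by (subst sum.swap) (intro sum.cong refl, simp add: algebra_simps)
  have By: "(\<Sum>j<N. wid j * (S j * LY j + S (Suc j) * LY (Suc j))) = B"
    unfolding B_def LY P_def sum_distrib_left sum.distrib[symmetric]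
    by (intro sum.cong refl) (simp add: algebra_simps)
  have Bn: "nodal_product phi_h f = B"
  proof -
    have "nodal_product phi_h f = (\<Sum>j<N. \<Sum>m<M. wid j * h / 3 *
       (P j m + 2 * P (Suc j) m + 2 * P j (Suc m) + P (Suc j) (Suc m)))"
      unfolding nodal_product_def sum_cells
      by (intro sum.cong refl) (simp add: area_eq sum_lt_3 G C_def[symmetric] P_def algebra_simps)
    also have "\<dots> = (\<Sum>j<N. wid j * h / 3 * ((\<Sum>m<M. P j m) + 2 * (\<Sum>m<M. P (Suc j) m) +
        2 * (\<Sum>m<M. P j (Suc m)) + (\<Sum>m<M. P (Suc j) (Suc m))))"
      by (simp only: sum_distrib_left sum.distrib distrib_left)
    also have "\<dots> = (\<Sum>j<N. wid j * h * ((\<Sum>m<M. P j m) + (\<Sum>m<M. P (Suc j) m)))"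
    proof (intro sum.cong refl)
      fix j
      have s: "(\<Sum>m<M. P j (Suc m)) = (\<Sum>m<M. P j m)" for j by (rule sum_shift) (simp add: P_def z)
      show "wid j * h / 3 * ((\<Sum>m<M. P j m) + 2 * (\<Sum>m<M. P (Suc j) m) +
        2 * (\<Sum>m<M. P j (Suc m)) + (\<Sum>m<M. P (Suc j) (Suc m))) = wid j * h * ((\<Sum>m<M. P j m) + (\<Sum>m<M. P (Suc j) m))"
        unfolding s by (simp add: algebra_simps)
    qed
    finally show ?thesis unfolding B_def by (simp only: sum_distrib_left sum.distrib distrib_left)
  qed
  have a: "grad_inner phi_h f = (\<Sum>m<M. 2 * h * T m * DX m) + (\<Sum>j<N. wid j * (S j * DY j + S (Suc j) * DY (Suc j)))"
  proof -
    let ?E = "\<lambda>c. area c * ((val phi_h c 1 - val phi_h c 0) * (val f c 1 - val f c 0) / (legx c)\<^sup>2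
      + (val phi_h c 2 - val phi_h c 0) * (val f c 2 - val f c 0) / (legy c)\<^sup>2)"
    define dx where "dx j m = (S (Suc j) - S j) * (C (Suc j) m - C j m) / wid j" for j m
    define dy where "dy j m = (T (Suc m) - T m) * (C j (Suc m) - C j m) / h" for j m
    have "grad_inner phi_h f = (\<Sum>j<N. \<Sum>m<M. (h * (T m * dx j m) + h * (T (Suc m) * dx j (Suc m)))
        + wid j * (S j * dy j m + S (Suc j) * dy (Suc j) m))"
      unfolding grad_inner_cells[OF phi_h_mem f] sum_cells
    proof (intro sum.cong refl)
      fix j m assume "j \<in> {..<N}" "m \<in> {..<M}"
      then have jm: "j \<le> N" "Suc j \<le> N" "m \<le> M" "Suc m \<le> M" by auto
      define w where "w = wid j"
      have w: "0 < w" "0 < h" by (simp_all add: w_def wid_pos h_pos)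
      have gx: "w * h / 2 * ((2 * a * t - 2 * b * t) * e / w\<^sup>2) = h * (t * ((a - b) * e / w))" for a b t e
        using w by (simp add: power2_eq_square field_simps)
      have gy: "w * h / 2 * ((2 * t * a - 2 * t * b) * e / h\<^sup>2) = w * (t * ((a - b) * e / h))" for a b t e
        using w by (simp add: power2_eq_square field_simps)
      have swap: "(a - b) * (c - d) = (b - a) * (d - c)" for a b c d :: real by (simp add: algebra_simps)
      show "?E (j, m, False) + ?E (j, m, True)
        = (h * (T m * dx j m) + h * (T (Suc m) * dx j (Suc m))) + wid j * (S j * dy j m + S (Suc j) * dy (Suc j) m)"
        using w
        by (simp add: area_eq G jm C_def[symmetric] w_def[symmetric] distrib_left gx gy dx_def dy_def
            del: times_divide_eq_left times_divide_eq_right)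
          (simp add: swap[of "S j" "S (Suc j)"] swap[of "T m" "T (Suc m)"])
    qed
    also have "\<dots> = (\<Sum>j<N. \<Sum>m<M. h * (T m * dx j m)) + (\<Sum>j<N. \<Sum>m<M. h * (T (Suc m) * dx j (Suc m)))
        + (\<Sum>j<N. \<Sum>m<M. wid j * (S j * dy j m + S (Suc j) * dy (Suc j) m))"
      by (simp only: sum.distrib)
    also have "(\<Sum>j<N. \<Sum>m<M. h * (T (Suc m) * dx j (Suc m))) = (\<Sum>j<N. \<Sum>m<M. h * (T m * dx j m))"
      by (rule sum_shift_row) (simp_all add: dx_def z)
    also have "(\<Sum>j<N. \<Sum>m<M. h * (T m * dx j m)) + (\<Sum>j<N. \<Sum>m<M. h * (T m * dx j m)) = (\<Sum>m<M. 2 * h * T m * DX m)"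
      unfolding DX_def dx_def[symmetric] sum_distrib_left sum.distrib[symmetric]
      by (subst sum.swap) (intro sum.cong refl, simp)
    also have "(\<Sum>j<N. \<Sum>m<M. wid j * (S j * dy j m + S (Suc j) * dy (Suc j) m)) = (\<Sum>j<N. wid j * (S j * DY j + S (Suc j) * DY (Suc j)))"
      unfolding DY_def dy_def[symmetric] by (simp only: sum_distrib_left sum.distrib distrib_left)
    finally show ?thesis .
  qed
  have ST: "\<bar>S j\<bar> \<le> 1" "\<bar>T j\<bar> \<le> 1" for j by (simp_all add: S_def T_def)
  have e0: "0 \<le> e" using h_pos by (simp add: e_def)
  let ?x = "\<lambda>m. DX m - pi\<^sup>2 * LX m" and ?z = "\<lambda>j. S j * (DY j - pi\<^sup>2 * LY j) + S (Suc j) * (DY (Suc j) - pi\<^sup>2 * LY (Suc j))" and ?C = "\<Sum>j<N. \<Sum>m<M. \<bar>C j m\<bar>"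
  have split: "grad_inner phi_h f - 2 * pi\<^sup>2 * nodal_product phi_h f
      = (\<Sum>m<M. 2 * h * T m * ?x m)
        + (\<Sum>j<N. wid j * ?z j)"
  proof -
    have "(\<Sum>m<M. 2 * h * T m * ?x m) = (\<Sum>m<M. 2 * h * T m * DX m) - pi\<^sup>2 * B"
      unfolding Bx[symmetric] sum_distrib_left sum_subtractf[symmetric] by (intro sum.cong refl) (simp add: algebra_simps)
    moreover have "(\<Sum>j<N. wid j * ?z j)
        = (\<Sum>j<N. wid j * (S j * DY j + S (Suc j) * DY (Suc j))) - pi\<^sup>2 * B"
      unfolding By[symmetric] sum_distrib_left sum_subtractf[symmetric] by (intro sum.cong refl) (simp add: algebra_simps)
    ultimately show ?thesis unfolding a Bn by simp
  qed
  have "\<bar>grad_inner phi_h f - 2 * pi\<^sup>2 * nodal_product phi_h f\<bar> \<le> (\<Sum>m<M. 2 * h * (e * (\<Sum>j<N. \<bar>C j m\<bar>)))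
      + (\<Sum>j<N. h * (e * (\<Sum>m<M. \<bar>C j m\<bar>) + e * (\<Sum>m<M. \<bar>C (Suc j) m\<bar>)))"
    unfolding split
  proof (rule order_trans[OF abs_triangle_ineq], intro add_mono order_trans[OF sum_abs] sum_mono)
    fix m
    have "\<bar>T m\<bar> * \<bar>DX m - pi\<^sup>2 * LX m\<bar> \<le> 1 * (e * (\<Sum>j<N. \<bar>C j m\<bar>))"
      by (intro mult_mono ST dx) auto
    then show "\<bar>2 * h * T m * ?x m\<bar> \<le> 2 * h * (e * (\<Sum>j<N. \<bar>C j m\<bar>))"
      using h_pos by (simp add: abs_mult mult.assoc)
  next
    fix j
    have "\<bar>S j\<bar> * \<bar>DY j - pi\<^sup>2 * LY j\<bar> \<le> 1 * (e * (\<Sum>m<M. \<bar>C j m\<bar>))" for j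
      by (intro mult_mono ST dy) auto
    from add_mono[OF this[of j] this[of "Suc j"]]
    have "\<bar>?z j\<bar>
        \<le> e * (\<Sum>m<M. \<bar>C j m\<bar>) + e * (\<Sum>m<M. \<bar>C (Suc j) m\<bar>)"
      using abs_triangle_ineq[of "S j * (DY j - pi\<^sup>2 * LY j)" "S (Suc j) * (DY (Suc j) - pi\<^sup>2 * LY (Suc j))"]
      by (simp add: abs_mult)
    then show "\<bar>wid j * ?z j\<bar>
        \<le> h * (e * (\<Sum>m<M. \<bar>C j m\<bar>) + e * (\<Sum>m<M. \<bar>C (Suc j) m\<bar>))"
      unfolding abs_mult[of "wid j"] using wid_pos[of j] wid_le[of j] h_pos by (intro mult_mono) auto
  qed
  also have "\<dots> = 4 * h * e * ?C"
  proof -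
    have "(\<Sum>m<M. 2 * h * (e * (\<Sum>j<N. \<bar>C j m\<bar>))) = 2 * h * e * ?C"
      by (subst sum.swap) (simp add: sum_distrib_left mult.assoc)
    moreover have "(\<Sum>j<N. h * (e * (\<Sum>m<M. \<bar>C j m\<bar>) + e * (\<Sum>m<M. \<bar>C (Suc j) m\<bar>)))
      = h * e * ?C + h * e * (\<Sum>j<N. \<Sum>m<M. \<bar>C (Suc j) m\<bar>)"
      by (simp only: sum_distrib_left distrib_left sum.distrib mult.assoc)
    moreover have "(\<Sum>j<N. \<Sum>m<M. \<bar>C (Suc j) m\<bar>) = ?C"
      by (rule sum_shift_column) (simp_all add: z)
    ultimately show ?thesis by simp
  qed
  also have "\<dots> = 4 / 3 * pi ^ 3 * h * l1_mass f"
    unfolding e_def l1_mass_def C_def sum_distrib_left[symmetric] by simp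
  finally show ?thesis .
qed

lemma eigen_residual:
  assumes f: "f \<in> S_h N"
  shows "\<bar>grad_inner phi_h f - 2 * pi\<^sup>2 * lumped_inner N phi_h f\<bar> \<le> 6 * pi ^ 3 * h * l1_mass f"
proof -
  have "\<bar>2 * pi\<^sup>2 * (lumped_inner N phi_h f - nodal_product phi_h f)\<bar> \<le> 2 * pi\<^sup>2 * (7 / 3 * pi * h * l1_mass f)"
    unfolding abs_mult using lumped_phi_h[OF f] by (intro mult_mono) auto
  also have "\<dots> = 14 / 3 * pi ^ 3 * h * l1_mass f" by (simp add: power2_eq_square power3_eq_cube)
  finally have "\<bar>2 * pi\<^sup>2 * lumped_inner N phi_h f - 2 * pi\<^sup>2 * nodal_product phi_h f\<bar> \<le> 14 / 3 * pi ^ 3 * h * l1_mass f"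
    by (simp add: right_diff_distrib)
  moreover have "14 / 3 * pi ^ 3 * h * l1_mass f + 4 / 3 * pi ^ 3 * h * l1_mass f = 6 * pi ^ 3 * h * l1_mass f" by simp
  ultimately show ?thesis using grad_phi_h[OF f] by linarith
qed

text \<open>The lumped norm controls the nodal values in a discrete \<open>L\<^sub>2\<close> norm, and the measure of the square is
  finite. So a bound of first order against \<^const>\<open>l1_mass\<close> bounds the residual tested with itself, again
  by Young's inequality.\<close>

lemma residual_energy:
  defines "r \<equiv> \<lambda>p. - Laplace_h N phi_h p - 2 * pi\<^sup>2 * phi_h p"
  shows "lumped_inner N r r \<le> 39 * (6 * pi ^ 3)\<^sup>2 * h\<^sup>2"
proof -
  define K where "K = 6 * pi ^ 3"
  note g = phi_h_mem and L = Laplace_h_mem[OF phi_h_mem]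
  have r: "r \<in> S_h N"
    using S_h_comb[OF S_h_comb[OF S_h_null L, of "-1"] g, of "- 2 * pi\<^sup>2"] by (simp add: r_def)
  have form: "lumped_inner N r f = grad_inner phi_h f - 2 * pi\<^sup>2 * lumped_inner N phi_h f" if f: "f \<in> S_h N" for f
  proof -
    note lin = linear_onD[OF form_linear1[OF lumped_symmetric f]]
    have "lumped_inner N (\<lambda>p. (0 + (-1) * Laplace_h N phi_h p) + (- 2 * pi\<^sup>2) * phi_h p) f
       = lumped_inner N (\<lambda>p. 0 + (-1) * Laplace_h N phi_h p) f + (- 2 * pi\<^sup>2) * lumped_inner N phi_h f"
      by (rule lin[OF S_h_comb[OF S_h_null L] g])
    also have "lumped_inner N (\<lambda>p. 0 + (-1) * Laplace_h N phi_h p) f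
       = lumped_inner N (\<lambda>p. 0) f + (-1) * lumped_inner N (Laplace_h N phi_h) f"
      by (rule lin[OF S_h_null L])
    also have "lumped_inner N (\<lambda>p. 0) f = 0" by (rule linear_on_zero[OF form_linear1[OF lumped_symmetric f]])
    finally show ?thesis using Laplace_h_form[OF g f] by (simp add: r_def)
  qed
  let ?S = "\<Sum>j<N. \<Sum>m<M. h\<^sup>2 * (r (pt (j, m)))\<^sup>2" and ?k = "72 / 5 * (K\<^sup>2 * h\<^sup>2)"
  have lower: "?S * (5 / 144) \<le> lumped_inner N r r"
  proof -
    let ?A = "\<lambda>c. area c * 15 / 108 * (\<Sum>i<3. (val r c i)\<^sup>2)"
    have "?S * (5 / 144) = (\<Sum>j<N. \<Sum>m<M. h\<^sup>2 / 4 * (15 / 108) * (r (pt (j, m)))\<^sup>2)"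
      unfolding sum_distrib_right by (intro sum.cong refl) simp
    also have "\<dots> \<le> (\<Sum>j<N. \<Sum>m<M. ?A (j, m, False) + ?A (j, m, True))"
    proof (intro sum_mono)
      fix j m
      have "h\<^sup>2 / 4 \<le> area (j, m, False)"
        using mult_right_mono[OF wid_ge[of j], of h] h_pos by (simp add: area_eq power2_eq_square)
      then have "h\<^sup>2 / 4 * (15 / 108) * (r (pt (j, m)))\<^sup>2 \<le> area (j, m, False) * (15 / 108) * (r (pt (j, m)))\<^sup>2"
        by (intro mult_right_mono) auto
      also have "\<dots> \<le> area (j, m, False) * (15 / 108) * (\<Sum>i<3. (val r (j, m, False) i)\<^sup>2)"
        using area_pos[of "(j, m, False)"] by (intro mult_left_mono) (auto simp: sum_lt_3)
      finally show "h\<^sup>2 / 4 * (15 / 108) * (r (pt (j, m)))\<^sup>2 \<le> ?A (j, m, False) + ?A (j, m, True)"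
        using area_pos[of "(j, m, True)"] by (simp add: sum_nonneg add_increasing2)
    qed
    also have "\<dots> = (\<Sum>c\<in>cells. ?A c)" by (rule sum_cells[symmetric])
    finally show ?thesis using lumped_lower_bound[OF r] by linarith
  qed
  have "lumped_inner N r r \<le> K * h * l1_mass r"
    using form[OF r] eigen_residual[OF r] by (simp add: K_def)
  also have "\<dots> = (\<Sum>j<N. \<Sum>m<M. h\<^sup>2 * (K * h * \<bar>r (pt (j, m))\<bar>))"
    unfolding l1_mass_def sum_distrib_left by (simp add: mult_ac)
  also have "\<dots> \<le> (\<Sum>j<N. \<Sum>m<M. h\<^sup>2 * (?k + 5 / 288 * (r (pt (j, m)))\<^sup>2))"
  proof (intro sum_mono mult_left_mono)
    fix j m
    \<comment> \<open>The weight \<open>5 / 288\<close> is half of the constant in \<open>lower\<close>, so half of the left-hand side absorbs it.\<close>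
    have "0 \<le> (72 / 5) * (K * h - 5 / 144 * \<bar>r (pt (j, m))\<bar>)\<^sup>2" by simp
    also have "\<dots> = ?k - K * h * \<bar>r (pt (j, m))\<bar> + 5 / 288 * (r (pt (j, m)))\<^sup>2"
      by (simp add: power2_eq_square algebra_simps)
    finally show "K * h * \<bar>r (pt (j, m))\<bar> \<le> ?k + 5 / 288 * (r (pt (j, m)))\<^sup>2" by simp
  qed auto
  also have "\<dots> = (\<Sum>j<N. \<Sum>m<M. h\<^sup>2 * ?k) + ?S * (5 / 288)"
    unfolding distrib_left sum.distrib sum_distrib_right by (simp add: mult_ac)
  also have "(\<Sum>j<N. \<Sum>m<M. h\<^sup>2 * ?k) = (real N * h) * (real M * h) * ?k"
    by (simp add: power2_eq_square)
  also have "real N * h = 4 / 3" using N_pos by (simp add: mesh_h_def)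
  also have "real M * h = 1" using Y_M by (simp add: mesh_y_def)
  finally have "lumped_inner N r r \<le> 2 * (4 / 3 * 1 * ?k)" using lower by linarith
  also have "\<dots> \<le> 39 * K\<^sup>2 * h\<^sup>2" by simp
  finally show ?thesis by (simp add: K_def)
qed

end

section \<open>The lumping error against the eigenfunction\<close>

text \<open>\<^const>\<open>phi1\<close> is the difference of two cosines in \<open>x - y\<close> and \<open>x + y\<close>.\<close>

lemma phi1_taylor:
  "\<bar>phi1 (x + s, y + t) - phi1 (x, y)
      - s * (2 * pi * cos (pi * x) * sin (pi * y)) - t * (2 * pi * sin (pi * x) * cos (pi * y))\<bar>
    \<le> pi\<^sup>2 * (s\<^sup>2 + t\<^sup>2)"
proof -
  define R where "R u v = sin (u + v) - sin u - v * cos u" for u v :: real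
  have R: "\<bar>R u v\<bar> \<le> v\<^sup>2 / 2" for u v unfolding R_def by (rule sin_taylor_2)
  define u1 u2 where "u1 = pi * (x - y) + pi / 2" and "u2 = pi * (x + y) + pi / 2"
  have c: "cos z = sin (z + pi / 2)" "- sin z = cos (z + pi / 2)" for z :: real
    by (simp_all add: sin_add cos_add)
  have p: "phi1 (a, b) = cos (pi * (a - b)) - cos (pi * (a + b))" for a b
    by (simp add: phi1_def right_diff_distrib distrib_left cos_diff cos_add)
  have e1: "pi * (x + s - (y + t)) = pi * (x - y) + pi * (s - t)" "pi * (x + s + (y + t)) = pi * (x + y) + pi * (s + t)"
    by (simp_all add: algebra_simps)
  have dx: "2 * pi * cos (pi * x) * sin (pi * y) = pi * (cos u1 - cos u2)"
    unfolding u1_def u2_def c(2)[symmetric]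
    by (simp add: right_diff_distrib distrib_left sin_diff sin_add)
  have dy: "2 * pi * sin (pi * x) * cos (pi * y) = pi * (- cos u1 - cos u2)"
    unfolding u1_def u2_def c(2)[symmetric]
    by (simp add: right_diff_distrib distrib_left sin_diff sin_add)
  have "phi1 (x + s, y + t) - phi1 (x, y)
      - s * (2 * pi * cos (pi * x) * sin (pi * y)) - t * (2 * pi * sin (pi * x) * cos (pi * y))
      = R u1 (pi * (s - t)) - R u2 (pi * (s + t))"
    unfolding dx dy p e1 R_def unfolding c(1) u1_def[symmetric] u2_def[symmetric]
    by (simp add: u1_def u2_def algebra_simps)
  also have "\<bar>\<dots>\<bar> \<le> (pi * (s - t))\<^sup>2 / 2 + (pi * (s + t))\<^sup>2 / 2"
    using R[of u1 "pi * (s - t)"] R[of u2 "pi * (s + t)"] by linarith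
  also have "\<dots> = pi\<^sup>2 * (s\<^sup>2 + t\<^sup>2)" by (simp add: power2_eq_square field_simps)
  finally show ?thesis .
qed

lemma grad_phi1:
  "grad phi1 (x, y) = (2 * pi * cos (pi * x) * sin (pi * y), 2 * pi * sin (pi * x) * cos (pi * y))"
proof (rule grad_eqI)
  show "GDERIV phi1 (x, y) :> (2 * pi * cos (pi * x) * sin (pi * y), 2 * pi * sin (pi * x) * cos (pi * y))"
    unfolding gderiv_def phi1_def case_prod_beta
    by (auto intro!: derivative_eq_intros simp: inner_prod_def algebra_simps)
qed

context mesh
begin

text \<open>Only the six triangles that contain the vertex contribute; they form the set \<open>K\<close> of the proof.\<close>

lemma quad_error_basis:
  assumes n: "(Suc j, Suc m) \<in> inner_nodes" and g: "g \<in> S_h N"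
  defines "G \<equiv> \<lambda>j m. g (pt (j, m))"
  shows "54 * quad_error (nodal_basis N (pt (Suc j, Suc m))) g
    = wid (Suc j) * h / 2 * (6 * G (Suc j) (Suc m) - 2 * G (Suc (Suc j)) (Suc m) - G (Suc j) (Suc (Suc m))
        - 2 * G (Suc (Suc j)) m - G (Suc j) m)
      + wid j * h / 2 * (6 * G (Suc j) (Suc m) - 2 * G j (Suc m) - 2 * G j (Suc (Suc m))
        - G (Suc j) m - G (Suc j) (Suc (Suc m)))"
proof -
  define n where "n = (Suc j, Suc m)"
  note n = n[folded n_def]
  have jm: "Suc j < N" "Suc m < M" using n by (auto simp: inner_nodes_def n_def)
  define f where "f = nodal_basis N (pt n)"
  have f: "f \<in> S_h N" unfolding f_def by (rule basis_mem) (use n interior_vertices_eq in blast)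
  have fv: "val f c i = (if node c i = n then 1 else 0)" if "c \<in> cells" for c i
    unfolding f_def by (rule basis_val[OF n node_range[OF that]])
  define E where "E c = area c * ((val f c 1 - val f c 0) * (val g c 1 - val g c 0) + (val f c 2 - val f c 0) * (val g c 2 - val g c 0)
      + (val f c 1 - val f c 2) * (val g c 1 - val g c 2))" for c
  define K where "K = {(Suc j, Suc m, False), (j, Suc m, False), (Suc j, m, False), (j, m, True), (Suc j, m, True), (j, Suc m, True)}"
  have K: "K \<subseteq> cells" unfolding K_def cells_def using jm by auto
  define \<delta> where "\<delta> c i = (if node c i = n then 1 else 0 :: real)" for c i
  have EK: "E c = area c * ((\<delta> c 1 - \<delta> c 0) * (val g c 1 - val g c 0) + (\<delta> c 2 - \<delta> c 0) * (val g c 2 - val g c 0)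
      + (\<delta> c 1 - \<delta> c 2) * (val g c 1 - val g c 2))" if "c \<in> K" for c
    using fv subsetD[OF K that] by (simp only: E_def \<delta>_def)
  have "E c = 0" if c: "c \<in> cells - K" for c
  proof -
    have "node c i \<noteq> n" for i
      using c unfolding K_def n_def by (cases c) (auto split: if_splits)
    then show ?thesis using c by (simp add: E_def fv)
  qed
  then have eK: "(\<Sum>c\<in>cells. E c) = (\<Sum>c\<in>K. E c)"
    by (intro sum.mono_neutral_right finite_cells K) auto
  have e0: "54 * quad_error f g = (\<Sum>c\<in>cells. E c)"
    unfolding quad_error_cells[OF f g] E_def sum_distrib_left by simp
  have e1: "E (Suc j, Suc m, False) = wid (Suc j) * h / 2 * (2 * G (Suc j) (Suc m) - G (Suc (Suc j)) (Suc m) - G (Suc j) (Suc (Suc m)))"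
    by (subst EK) (simp_all add: K_def \<delta>_def n_def G_def area_eq algebra_simps)
  have e2: "E (j, Suc m, False) = wid j * h / 2 * (2 * G (Suc j) (Suc m) - G j (Suc m) - G j (Suc (Suc m)))"
    by (subst EK) (simp_all add: K_def \<delta>_def n_def G_def area_eq algebra_simps)
  have e3: "E (Suc j, m, False) = wid (Suc j) * h / 2 * (2 * G (Suc j) (Suc m) - G (Suc j) m - G (Suc (Suc j)) m)"
    by (subst EK) (simp_all add: K_def \<delta>_def n_def G_def area_eq algebra_simps)
  have e4: "E (j, m, True) = wid j * h / 2 * (2 * G (Suc j) (Suc m) - G j (Suc m) - G (Suc j) m)"
    by (subst EK) (simp_all add: K_def \<delta>_def n_def G_def area_eq algebra_simps)
  have e5: "E (Suc j, m, True) = wid (Suc j) * h / 2 * (2 * G (Suc j) (Suc m) - G (Suc (Suc j)) (Suc m) - G (Suc (Suc j)) m)"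
    by (subst EK) (simp_all add: K_def \<delta>_def n_def G_def area_eq algebra_simps)
  have e6: "E (j, Suc m, True) = wid j * h / 2 * (2 * G (Suc j) (Suc m) - G (Suc j) (Suc (Suc m)) - G j (Suc (Suc m)))"
    by (subst EK) (simp_all add: K_def \<delta>_def n_def G_def area_eq algebra_simps)
  have e7: "(\<Sum>c\<in>K. E c) = E (Suc j, Suc m, False) + E (j, Suc m, False) + E (Suc j, m, False)
      + E (j, m, True) + E (Suc j, m, True) + E (j, Suc m, True)"
    unfolding K_def by simp
  show ?thesis
    unfolding f_def[symmetric] n_def[symmetric] e0 eK e7 e1 e2 e3 e4 e5 e6
    by (simp add: n_def field_simps)
qed

text \<open>The value and the second-order remainder aside, the stencil of \<open>quad_error_basis\<close> maps the slopes \<open>p\<close>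
  in \<open>x\<close> and \<open>q\<close> in \<open>y\<close> to \<open>h\<^sup>3 (3 p - q) / 2\<close>: the contribution \<open>h\<^sup>3 (q - p) / 2\<close> of the narrow column
  on the right fails to balance \<open>h\<^sup>3 (2 p - q)\<close> from the wide column on the left. The remainders amount to
  at most half of this.\<close>

lemma quad_error_at_even_node:
  assumes n: "(Suc j, Suc m) \<in> inner_nodes" and odd: "odd j"
    and g: "1 \<le> inner (grad phi1 (pt (Suc j, Suc m))) (3, -1)" and small: "h \<le> 1 / (36 * pi\<^sup>2)"
  shows "h ^ 3 / 216 \<le> quad_error (nodal_basis N (pt (Suc j, Suc m))) phi_h"
proof -
  let ?q = "quad_error (nodal_basis N (pt (Suc j, Suc m))) phi_h"
  define x y where "x = X (Suc j)" and "y = Y (Suc m)"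
  define p q where "p = 2 * pi * cos (pi * x) * sin (pi * y)" and "q = 2 * pi * sin (pi * x) * cos (pi * y)"
  have w: "wid j = h" "wid (Suc j) = h / 2" using odd by (simp_all add: wid_eq)
  have xs: "X (Suc (Suc j)) = x + h / 2" "X j = x + - h" using w by (simp_all add: x_def X_Suc)
  have ys: "Y (Suc (Suc m)) = y + h" "Y m = y + - h" by (simp_all add: y_def Y_Suc)
  have jm: "Suc j < N" "Suc m < M" using n by (auto simp: inner_nodes_def)
  define R where "R s t = phi1 (x + s, y + t) - phi1 (x, y) - s * p - t * q" for s t
  have R: "\<bar>R s t\<bar> \<le> pi\<^sup>2 * (s\<^sup>2 + t\<^sup>2)" for s t unfolding R_def p_def q_def by (rule phi1_taylor)
  have R2: "\<bar>R s t\<bar> \<le> 2 * pi\<^sup>2 * h\<^sup>2" if "s\<^sup>2 \<le> h\<^sup>2" "t\<^sup>2 \<le> h\<^sup>2" for s t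
  proof -
    have "pi\<^sup>2 * (s\<^sup>2 + t\<^sup>2) \<le> pi\<^sup>2 * (2 * h\<^sup>2)" using that by (intro mult_left_mono) auto
    also have "\<dots> = 2 * pi\<^sup>2 * h\<^sup>2" by simp
    finally show ?thesis using R[of s t] by linarith
  qed
  have g': "1 \<le> 3 * p - q" using g by (simp add: pt_def x_def[symmetric] y_def[symmetric] grad_phi1 p_def q_def inner_prod_def)
  have v: "phi_h (pt (i, k)) = phi1 (X i, Y k)" if "i \<le> N" "k \<le> M" for i k
    using phi_h_val[of "(i, k)"] that by (simp add: pt_def)
  have "54 * ?q
      = h\<^sup>2 / 4 * (6 * phi1 (x, y) - 2 * phi1 (x + h / 2, y + 0) - phi1 (x + 0, y + h) - 2 * phi1 (x + h / 2, y + - h) - phi1 (x + 0, y + - h))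
      + h\<^sup>2 / 2 * (6 * phi1 (x, y) - 2 * phi1 (x + - h, y + 0) - 2 * phi1 (x + - h, y + h) - phi1 (x + 0, y + - h) - phi1 (x + 0, y + h))"
    unfolding quad_error_basis[OF n phi_h_mem] w using jm
    by (simp add: v xs ys x_def[symmetric] y_def[symmetric] power2_eq_square)
  also have "\<dots> = h ^ 3 / 2 * (3 * p - q)
      - (h\<^sup>2 / 4 * (2 * R (h / 2) 0 + R 0 h + 2 * R (h / 2) (- h) + R 0 (- h))
        + h\<^sup>2 / 2 * (2 * R (- h) 0 + 2 * R (- h) h + R 0 (- h) + R 0 h))"
    unfolding R_def by (simp add: power2_eq_square power3_eq_cube field_simps)
  finally have eq: "54 * ?q = \<dots>" .
  define B where "B = 2 * pi\<^sup>2 * h\<^sup>2"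
  have r: "R (h / 2) 0 \<le> B" "R 0 h \<le> B" "R (h / 2) (- h) \<le> B" "R 0 (- h) \<le> B" "R (- h) 0 \<le> B" "R (- h) h \<le> B"
    using R2[of "h / 2" 0] R2[of 0 h] R2[of "h / 2" "- h"] R2[of 0 "- h"] R2[of "- h" 0] R2[of "- h" h]
    by (simp_all add: B_def power_divide)
  have "h\<^sup>2 / 4 * (2 * R (h / 2) 0 + R 0 h + 2 * R (h / 2) (- h) + R 0 (- h)) \<le> h\<^sup>2 / 4 * (6 * B)"
    using r by (intro mult_left_mono) auto
  moreover have "h\<^sup>2 / 2 * (2 * R (- h) 0 + 2 * R (- h) h + R 0 (- h) + R 0 h) \<le> h\<^sup>2 / 2 * (6 * B)"
    using r by (intro mult_left_mono) auto
  moreover have "h ^ 3 / 2 * 1 \<le> h ^ 3 / 2 * (3 * p - q)" using g' h_pos by (intro mult_left_mono) auto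
  ultimately have "h ^ 3 / 2 - h\<^sup>2 * (9 / 2 * B) \<le> 54 * ?q"
    unfolding eq by (simp add: algebra_simps)
  moreover have "h\<^sup>2 * (9 / 2 * B) \<le> h ^ 3 / 4"
  proof -
    have "h\<^sup>2 * (9 / 2 * B) = h ^ 3 * (9 * pi\<^sup>2 * h)" by (simp add: B_def power2_eq_square power3_eq_cube)
    also have "\<dots> \<le> h ^ 3 * (1 / 4)"
      using small h_pos by (intro mult_left_mono) (auto simp: field_simps)
    finally show ?thesis by simp
  qed
  ultimately show ?thesis by linarith
qed

lemma card_multiples:
  fixes s l u :: real
  defines "A \<equiv> {j::nat. l \<le> s * real j \<and> s * real j \<le> u}"
  assumes "0 < s" "0 \<le> l" "l \<le> u"
  shows "finite A" "(u - l) / s - 1 \<le> real (card A)"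
proof -
  define a b where "a = nat \<lceil>l / s\<rceil>" and "b = nat \<lfloor>u / s\<rfloor>"
  have ls: "0 \<le> l / s" "0 \<le> u / s" using assms by auto
  have "A = {a..b}"
  proof (intro set_eqI iffI)
    fix j assume "j \<in> A"
    then have "l / s \<le> real j" "real j \<le> u / s" using assms by (auto simp: A_def field_simps)
    then show "j \<in> {a..b}" by (auto simp: a_def b_def ceiling_le_iff le_nat_iff le_floor_iff nat_le_iff)
  next
    fix j assume "j \<in> {a..b}"
    then have "l / s \<le> real j" "real j \<le> u / s" using ls
      by (auto simp: a_def b_def ceiling_le_iff le_nat_iff le_floor_iff nat_le_iff)
    then show "j \<in> A" using assms by (auto simp: A_def field_simps)
  qed
  moreover have "real a < l / s + 1" "u / s - 1 < real b"
    using ls by (simp_all add: a_def b_def; linarith)+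
  ultimately show "finite A" "(u - l) / s - 1 \<le> real (card A)"
    by (auto simp: diff_divide_distrib)
qed

lemma P_h_inner:
  assumes d: "0 < d" "d < 1 / 4" and z: "z \<in> P_h N d"
  shows "\<exists>j m. odd j \<and> (Suc j, Suc m) \<in> inner_nodes \<and> z = pt (Suc j, Suc m)"
proof -
  obtain i k where ik: "z = (X (2 * i), Y k)" "2 * i \<le> N" "k \<le> M" "z \<in> square_P d"
    using z unfolding P_h_def by blast
  then have "z = pt (2 * i, k)" by (simp add: pt_def)
  moreover have "z \<in> Omega" using ik(4) d by (auto simp: square_P_def Omega_def)
  ultimately have n: "(2 * i, k) \<in> inner_nodes" using pt_in_Omega[of "(2 * i, k)"] ik by simp
  then have "0 < i" "0 < k" by (auto simp: inner_nodes_def)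
  then have "2 * i = Suc (2 * (i - 1) + 1)" "k = Suc (k - 1)" by auto
  then show ?thesis using n \<open>z = pt (2 * i, k)\<close> by (intro exI[of _ "2 * (i - 1) + 1"] exI[of _ "k - 1"]) auto
qed

lemma P_h_subset:
  assumes "0 < d" "d < 1 / 4" shows "P_h N d \<subseteq> interior_vertices N"
  using P_h_inner[OF assms] interior_vertices_eq by force

text \<open>Even columns are \<open>3 h / 2\<close> apart and rows are \<open>h\<close> apart, while the square has side \<open>2 d\<close>.\<close>

lemma P_h_card:
  assumes d: "0 < d" "d < 1 / 4" and small: "h \<le> d"
  shows "d\<^sup>2 / (3 * h\<^sup>2) \<le> real (card (P_h N d))"
proof -
  define l u where "l = 1 / 4 - d" and "u = 1 / 4 + d"
  define A where "A = {j::nat. l \<le> (3 / 2 * h) * real j \<and> (3 / 2 * h) * real j \<le> u}"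
  define B where "B = {m::nat. l \<le> h * real m \<and> h * real m \<le> u}"
  have lu: "0 \<le> l" "l \<le> u" "u < 1" "u - l = 2 * d" using d by (auto simp: l_def u_def)
  have A: "finite A" "2 * d / (3 / 2 * h) - 1 \<le> real (card A)"
    using card_multiples[of "3 / 2 * h" l u] lu h_pos by (auto simp: A_def)
  have B: "finite B" "2 * d / h - 1 \<le> real (card B)"
    using card_multiples[of h l u] lu h_pos by (auto simp: B_def)
  have t: "1 \<le> d / h" using small h_pos by simp
  have A': "d / (3 * h) \<le> real (card A)" using A(2) t h_pos by (simp add: field_simps)
  have B': "d / h \<le> real (card B)" using B(2) t by simp
  define \<iota> where "\<iota> = (\<lambda>(j, m). pt (2 * j, m))"
  have "\<iota> ` (A \<times> B) \<subseteq> P_h N d"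
  proof
    fix z assume "z \<in> \<iota> ` (A \<times> B)"
    then obtain j m where jm: "j \<in> A" "m \<in> B" "z = pt (2 * j, m)" by (auto simp: \<iota>_def)
    have x: "l \<le> X (2 * j)" "X (2 * j) \<le> u" using jm(1) by (auto simp: A_def X_even)
    have y: "l \<le> Y m" "Y m \<le> u" using jm(2) by (auto simp: B_def mesh_y_def mult.commute)
    have "2 * j \<le> N"
      using x(2) lu X_N strict_mono_leD[OF X_strict_mono, of N "2 * j"] by linarith
    moreover have "m \<le> M"
      using y(2) lu Y_M strict_mono_leD[OF Y_strict_mono, of M m] by linarith
    ultimately show "z \<in> P_h N d"
      unfolding P_h_def jm(3) square_P_def pt_def using x y by (auto simp: l_def u_def)
  qed
  then have "card (\<iota> ` (A \<times> B)) \<le> card (P_h N d)"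
    by (intro card_mono finite_subset[OF P_h_subset[OF d] finite_interior_vertices])
  moreover have "inj_on \<iota> (A \<times> B)" by (auto simp: inj_on_def \<iota>_def pt_inj)
  ultimately have "card A * card B \<le> card (P_h N d)" by (simp add: card_image card_cartesian_product)
  then have "real (card A) * real (card B) \<le> real (card (P_h N d))" by (metis of_nat_le_iff of_nat_mult)
  moreover have "d / (3 * h) * (d / h) \<le> real (card A) * real (card B)"
    using A' B' d h_pos by (intro mult_mono) auto
  moreover have "d / (3 * h) * (d / h) = d\<^sup>2 / (3 * h\<^sup>2)" by (simp add: power2_eq_square)
  ultimately show ?thesis by linarith
qed

lemma finite_P_h: "0 < d \<Longrightarrow> d < 1 / 4 \<Longrightarrow> finite (P_h N d)"
  using P_h_subset finite_interior_vertices finite_subset by blast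

lemma v_h_mem:
  assumes "0 < d" "d < 1 / 4" shows "v_h N d \<in> S_h N"
  using sum_mem[OF finite_P_h[OF assms] P_h_subset[OF assms], of "\<lambda>_. 1"] by (simp add: v_h_def)

lemma v_h_val:
  assumes d: "0 < d" "d < 1 / 4" and n: "n \<in> {..N} \<times> {..M}"
  shows "v_h N d (pt n) = (if pt n \<in> P_h N d then 1 else 0)"
proof -
  have "v_h N d (pt n) = (\<Sum>z\<in>P_h N d. if pt n = z then 1 else 0)"
    unfolding v_h_def
  proof (intro sum.cong refl)
    fix z assume "z \<in> P_h N d"
    then obtain n' where "n' \<in> inner_nodes" "z = pt n'" using P_h_subset[OF d] interior_vertices_eq by blast
    then show "nodal_basis N z (pt n) = (if pt n = z then 1 else 0)" using basis_val n by (simp add: pt_inj)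
  qed
  then show ?thesis using finite_P_h[OF d] by simp
qed

lemma quad_error_v_h:
  assumes d: "0 < d" "d < 1 / 4" and g: "\<forall>z\<in>square_P d. 1 \<le> inner (grad phi1 z) (3, -1)"
    and small: "h \<le> d" "h \<le> 1 / (36 * pi\<^sup>2)"
  shows "d\<^sup>2 / 648 * h \<le> quad_error (v_h N d) phi_h"
proof -
  have "quad_error (v_h N d) phi_h = (\<Sum>z\<in>P_h N d. quad_error (nodal_basis N z) phi_h)"
    using linear_on_sum[OF quad_error_linear1[OF phi_h_mem] finite_P_h[OF d] P_h_subset[OF d], of "\<lambda>_. 1"]
    by (simp add: v_h_def)
  moreover have "h ^ 3 / 216 \<le> quad_error (nodal_basis N z) phi_h" if z: "z \<in> P_h N d" for z
  proof -
    have "z \<in> square_P d" using z by (simp add: P_h_def)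
    moreover obtain j m where "odd j" "(Suc j, Suc m) \<in> inner_nodes" "z = pt (Suc j, Suc m)"
      using P_h_inner[OF d z] by blast
    ultimately show ?thesis using quad_error_at_even_node[of j m] g small(2) by blast
  qed
  ultimately have "real (card (P_h N d)) * (h ^ 3 / 216) \<le> quad_error (v_h N d) phi_h"
    using sum_bounded_below[of "P_h N d" "h ^ 3 / 216"] by simp
  moreover have "d\<^sup>2 / (3 * h\<^sup>2) * (h ^ 3 / 216) \<le> real (card (P_h N d)) * (h ^ 3 / 216)"
    using h_pos by (intro mult_right_mono P_h_card[OF d small(1)]) auto
  moreover have "d\<^sup>2 / (3 * h\<^sup>2) * (h ^ 3 / 216) = d\<^sup>2 / 648 * h"
    using h_pos by (simp add: power2_eq_square power3_eq_cube)
  ultimately show ?thesis by linarith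
qed

lemma sum_three_bounded:
  fixes a :: "nat \<Rightarrow> real"
  assumes "\<And>i. \<bar>a i\<bar> \<le> b"
  shows "(\<Sum>i<3. a i * a i) \<le> 3 * b\<^sup>2" "(\<Sum>i<3. a i) * (\<Sum>i<3. a i) \<le> 9 * b\<^sup>2"
proof -
  have b: "0 \<le> b" using assms[of 0] by linarith
  have "a i * a i \<le> b\<^sup>2" for i
    using power_mono[OF assms[of i], of 2] by (simp add: power2_eq_square)
  then show "(\<Sum>i<3. a i * a i) \<le> 3 * b\<^sup>2" using sum_bounded_above[of "{..<3::nat}" "\<lambda>i. a i * a i" "b\<^sup>2"] by simp
  have "\<bar>\<Sum>i<3. a i\<bar> \<le> 3 * b" using order_trans[OF sum_abs sum_bounded_above[of "{..<3::nat}" "\<lambda>i. \<bar>a i\<bar>" b]] assms by simp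
  from power_mono[OF this, of 2] show "(\<Sum>i<3. a i) * (\<Sum>i<3. a i) \<le> 9 * b\<^sup>2"
    by (simp add: power2_eq_square)
qed

lemma v_h_norm:
  assumes d: "0 < d" "d < 1 / 4" shows "L2_norm_Omega (v_h N d) \<le> 1"
proof -
  note v = v_h_mem[OF d]
  let ?S = "\<lambda>c. \<Sum>i<3. val (v_h N d) c i * val (v_h N d) c i" and ?R = "\<lambda>c. (\<Sum>i<3. val (v_h N d) c i) * (\<Sum>i<3. val (v_h N d) c i)"
  have "L2_inner (v_h N d) (v_h N d) \<le> (\<Sum>c\<in>cells. area c)"
    unfolding L2_inner_cells'[OF v v]
  proof (rule sum_mono)
    fix c assume c: "c \<in> cells"
    have "\<bar>val (v_h N d) c i\<bar> \<le> 1" for i using v_h_val[OF d node_range[OF c]] by simp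
    from sum_three_bounded[of "val (v_h N d) c", OF this]
    have "?S c + ?R c \<le> 12"
      by simp
    then have "area c / 12 * (?S c + ?R c) \<le> area c / 12 * 12"
      using area_pos[of c] by (intro mult_left_mono) auto
    then show "area c / 12 * (?S c + ?R c) \<le> area c"
      by simp
  qed
  then show ?thesis by (simp add: L2_norm_Omega_def total_area)
qed

lemma phi_h_lumped_norm: "lumped_inner N phi_h phi_h \<le> 4"
proof -
  let ?S = "\<lambda>c. \<Sum>i<3. val phi_h c i * val phi_h c i" and ?R = "\<lambda>c. (\<Sum>i<3. val phi_h c i) * (\<Sum>i<3. val phi_h c i)"
  have "lumped_inner N phi_h phi_h \<le> (\<Sum>c\<in>cells. area c * 4)"
    unfolding lumped_inner_cells[OF phi_h_mem phi_h_mem]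
  proof (rule sum_mono)
    fix c assume c: "c \<in> cells"
    have "\<bar>val phi_h c i\<bar> \<le> 2" for i
    proof -
      have "val phi_h c i = 2 * sin (pi * X (fst (node c i))) * sin (pi * Y (snd (node c i)))"
        unfolding phi_h_val[OF node_range[OF c]] phi1_pt[symmetric] by simp
      moreover have "\<bar>sin (pi * X (fst (node c i)))\<bar> * \<bar>sin (pi * Y (snd (node c i)))\<bar> \<le> 1 * 1"
        by (intro mult_mono) auto
      ultimately show ?thesis by (simp add: abs_mult)
    qed
    from sum_three_bounded[of "val phi_h c", OF this]
    have "15 * ?S c + 7 * ?R c \<le> 432"
      by simp
    then have "area c / 108 * (15 * ?S c + 7 * ?R c) \<le> area c / 108 * 432"
      using area_pos[of c] by (intro mult_left_mono) auto
    then show "area c / 108 * (15 * ?S c + 7 * (\<Sum>i<3. val phi_h c i) * (\<Sum>i<3. val phi_h c i)) \<le> area c * 4"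
      by (simp add: mult.assoc)
  qed
  then show ?thesis by (simp add: sum_distrib_right[symmetric] total_area)
qed

text \<open>This is the Cauchy--Schwarz inequality in the form \<open>0 \<le> \<langle>w + \<kappa> g, w + \<kappa> g\<rangle>\<close>. The choice \<open>\<kappa> = C / 4\<close>
  is optimal if \<open>\<langle>g, g\<rangle> = 4\<close>.\<close>

lemma norm_from_pairing:
  assumes w: "w \<in> S_h N" and C: "0 \<le> C" and p: "lumped_inner N w phi_h \<le> - C"
  shows "C / 3 \<le> L2_norm_Omega w"
proof -
  define \<kappa> where "\<kappa> = C / 4"
  define e where "e = (\<lambda>p. w p + \<kappa> * phi_h p)"
  have e: "e \<in> S_h N" unfolding e_def by (rule S_h_comb[OF w phi_h_mem])
  note s = lumped_symmetric and g = phi_h_mem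
  have "lumped_inner N e e = lumped_inner N w e + \<kappa> * lumped_inner N phi_h e"
    using linear_onD[OF form_linear1[OF s e] w g, of \<kappa>] by (simp add: e_def)
  also have "lumped_inner N w e = lumped_inner N w w + \<kappa> * lumped_inner N w phi_h"
    using linear_onD[OF form_linear2[OF s w] w g, of \<kappa>] by (simp add: e_def)
  also have "lumped_inner N phi_h e = lumped_inner N w phi_h + \<kappa> * lumped_inner N phi_h phi_h"
    using linear_onD[OF form_linear2[OF s g] w g, of \<kappa>] form_sym[OF s g w] by (simp add: e_def)
  finally have "lumped_inner N e e = lumped_inner N w w + 2 * \<kappa> * lumped_inner N w phi_h + \<kappa>\<^sup>2 * lumped_inner N phi_h phi_h"
    by (simp add: power2_eq_square algebra_simps)
  moreover have "0 \<le> lumped_inner N e e" using lumped_inner_product e by (simp add: inner_product_on_def)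
  moreover have "2 * \<kappa> * lumped_inner N w phi_h \<le> 2 * \<kappa> * (- C)" using p C by (intro mult_left_mono) (auto simp: \<kappa>_def)
  moreover have "\<kappa>\<^sup>2 * lumped_inner N phi_h phi_h \<le> \<kappa>\<^sup>2 * 4" by (intro mult_left_mono phi_h_lumped_norm) auto
  ultimately have "2 * \<kappa> * C - \<kappa>\<^sup>2 * 4 \<le> lumped_inner N w w" by linarith
  moreover have "2 * \<kappa> * C - \<kappa>\<^sup>2 * 4 = C\<^sup>2 / 4" by (simp add: \<kappa>_def power2_eq_square)
  ultimately have "C\<^sup>2 / 8 \<le> L2_inner w w" using lumped_le_L2[OF w] by linarith
  moreover have "(C / 3)\<^sup>2 \<le> C\<^sup>2 / 8" by (simp add: power_divide)
  ultimately have "(C / 3)\<^sup>2 \<le> L2_inner w w" by linarith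
  then show ?thesis unfolding L2_norm_Omega_def by (rule real_le_rsqrt)
qed

text \<open>The leading term is the pairing at time zero, decayed by the eigenvalue \<open>2 * pi\<^sup>2\<close>. The quadratic
  term collects the energies of \<open>Q_h N (v_h N d)\<close> and of the residual.\<close>

lemma pairing_bound:
  assumes d: "0 < d" "d < 1 / 4" and g: "\<forall>z\<in>square_P d. 1 \<le> inner (grad phi1 z) (3, -1)"
    and small: "h \<le> d" "h \<le> 1 / (36 * pi\<^sup>2)" and t: "0 \<le> t"
  shows "lumped_inner N (E_h N t (Laplace_h N (Q_h N (v_h N d)))) phi_h
    \<le> - (exp (- (2 * pi\<^sup>2 * t)) * (d\<^sup>2 / 648 * h)) + (1 / 4 + t / 2 * (39 * (6 * pi ^ 3)\<^sup>2)) * h\<^sup>2"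
proof -
  let ?K = "39 * (6 * pi ^ 3)\<^sup>2"
  define q where "q = Q_h N (v_h N d)"
  define \<mu> where "\<mu> = 2 * pi\<^sup>2"
  define r where "r = (\<lambda>p. - Laplace_h N phi_h p - \<mu> * phi_h p)"
  define P where "P = lumped_inner N (E_h N t (Laplace_h N q)) phi_h"
  note v = v_h_mem[OF d]
  have q: "q \<in> S_h N" unfolding q_def by (rule Q_h_mem[OF v])
  have "exp (\<mu> * t) * P \<le> lumped_inner N (Laplace_h N q) phi_h
      + exp (\<mu> * t) * (grad_inner q q / 4 + t / 2 * lumped_inner N r r)"
    unfolding P_def E_h_eq
    by (rule heat_pairing[OF lumped_inner_product grad_inner_product Laplace_h_form q phi_h_mem t _ r_def])
      (auto simp: \<mu>_def)
  moreover have "lumped_inner N (Laplace_h N q) phi_h \<le> - (d\<^sup>2 / 648 * h)"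
    using Laplace_h_form[OF q phi_h_mem] Q_h_form[OF v phi_h_mem] quad_error_v_h[OF d g small]
    by (simp add: q_def)
  moreover have "grad_inner q q \<le> h\<^sup>2"
    unfolding q_def by (rule Q_h_energy[OF v]) (simp add: v_h_val[OF d])
  then have "grad_inner q q / 4 + t / 2 * lumped_inner N r r \<le> h\<^sup>2 / 4 + t / 2 * (?K * h\<^sup>2)"
    using residual_energy t unfolding r_def \<mu>_def by (intro add_mono mult_left_mono) auto
  then have "exp (\<mu> * t) * (grad_inner q q / 4 + t / 2 * lumped_inner N r r)
      \<le> exp (\<mu> * t) * (h\<^sup>2 / 4 + t / 2 * (?K * h\<^sup>2))"
    by (intro mult_left_mono) auto
  ultimately have "exp (\<mu> * t) * P \<le> - (d\<^sup>2 / 648 * h) + exp (\<mu> * t) * (h\<^sup>2 / 4 + t / 2 * (?K * h\<^sup>2))"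
    by linarith
  then have "exp (- (\<mu> * t)) * (exp (\<mu> * t) * P) \<le> exp (- (\<mu> * t)) *
      (- (d\<^sup>2 / 648 * h) + exp (\<mu> * t) * (h\<^sup>2 / 4 + t / 2 * (?K * h\<^sup>2)))"
    by (intro mult_left_mono) auto
  moreover have "exp (- (\<mu> * t)) * (exp (\<mu> * t) * z) = z" for z
    by (simp add: mult.assoc[symmetric] exp_minus)
  ultimately have "P \<le> exp (- (\<mu> * t)) * (- (d\<^sup>2 / 648 * h)) + (h\<^sup>2 / 4 + t / 2 * (?K * h\<^sup>2))"
    by (simp only: distrib_left)
  then show ?thesis unfolding P_def q_def \<mu>_def by (simp add: algebra_simps)
qed

end

theorem proposition5p1:
  fixes d :: real
  assumes "0 < d" and "d < 1 / 4"
    and "\<forall>z\<in>square_P d. inner (grad phi1 z) (3, -1) \<ge> 1"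
  shows "\<forall>t::real. t > 0 \<longrightarrow> (\<exists>c>0. \<exists>h0>0. \<forall>N::nat.
           0 < N \<and> 4 dvd N \<and> mesh_h N < h0 \<longrightarrow>
             L2_norm_Omega (E_h N t (Laplace_h N (Q_h N (v_h N d))))
               \<ge> c * mesh_h N * L2_norm_Omega (v_h N d))"
proof (intro allI impI)
  fix t :: real assume t: "0 < t"
  \<comment> \<open>\<open>c1\<close> is half of the constant in the leading term of \<open>pairing_bound\<close>; below \<open>h0\<close> the quadratic term
    uses up at most the other half.\<close>
  define c1 where "c1 = exp (- (2 * pi\<^sup>2 * t)) * (d\<^sup>2 / 1296)"
  define C where "C = 1 / 4 + t / 2 * (39 * (6 * pi ^ 3)\<^sup>2)"
  have c1: "0 < c1" using assms(1) by (simp add: c1_def)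
  have C: "0 < C" unfolding C_def using t by (intro add_pos_nonneg) auto
  define h0 where "h0 = min (min d (1 / (36 * pi\<^sup>2))) (c1 / C)"
  have "0 < h0" using assms(1) c1 C by (simp add: h0_def)
  moreover have "c1 / 3 * mesh_h N * L2_norm_Omega (v_h N d)
      \<le> L2_norm_Omega (E_h N t (Laplace_h N (Q_h N (v_h N d))))"
    if N: "0 < N \<and> 4 dvd N \<and> mesh_h N < h0" for N
  proof -
    interpret mesh N using N by unfold_locales auto
    define w where "w = E_h N t (Laplace_h N (Q_h N (v_h N d)))"
    have h: "h \<le> d" "h \<le> 1 / (36 * pi\<^sup>2)" "h \<le> c1 / C" using N by (auto simp: h0_def)
    have w: "w \<in> S_h N" unfolding w_def E_h_eq
      by (intro expD_mem Laplace_h_mem Q_h_mem v_h_mem assms)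
    have "h * C \<le> c1" using h(3) C by (simp only: pos_le_divide_eq)
    then have "C * h\<^sup>2 \<le> c1 * h"
      using mult_right_mono[of "h * C" c1 h] h_pos by (simp add: power2_eq_square mult_ac)
    moreover have "e * (d\<^sup>2 / 648 * h) = 2 * (e * (d\<^sup>2 / 1296)) * h" for e :: real by simp
    then have "exp (- (2 * pi\<^sup>2 * t)) * (d\<^sup>2 / 648 * h) = 2 * c1 * h" unfolding c1_def by blast
    ultimately have "lumped_inner N w phi_h \<le> - (c1 * h)"
      using pairing_bound[OF assms h(1,2), of t] t unfolding w_def C_def by linarith
    then have "c1 * h / 3 \<le> L2_norm_Omega w"
      using norm_from_pairing[OF w] c1 h_pos by simp
    moreover have "c1 / 3 * h * L2_norm_Omega (v_h N d) \<le> c1 / 3 * h * 1"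
      using c1 h_pos by (intro mult_left_mono v_h_norm assms) auto
    ultimately show ?thesis unfolding w_def by simp
  qed
  ultimately show "\<exists>c>0. \<exists>h0>0. \<forall>N::nat. 0 < N \<and> 4 dvd N \<and> mesh_h N < h0 \<longrightarrow>
      L2_norm_Omega (E_h N t (Laplace_h N (Q_h N (v_h N d)))) \<ge> c * mesh_h N * L2_norm_Omega (v_h N d)"
    using c1 by (intro exI[of _ "c1 / 3"] conjI exI[of _ h0]) auto
qed

end
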